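(* Let $d\in\mathbb N$, $\alpha>1/2$, let $0<\gamma_j\le 1$ for $j=1,\ldots,d$, let $N>2$ be prime, and let $\delta\in(0,1)$ and $K>1$. Choose $$M=\max_{1/\alpha<\lambda\le 2}\left((N-1)(1-\delta)\prod_{j=1}^d\bigl(1+2\gamma_j^\lambda\zeta(\alpha\lambda)\bigr)^{-1}\right)^{1/\lambda},$$ assume that $M>1$, let $m_0\in\mathbb N$ satisfy $2^{m_0-1}<M^{1/\alpha}\le 2^{m_0}$, and set $R_*=1+(3^d-1)(m_0+d)^{d-1}$. Choose $\boldsymbol g$ uniformly at random from $\{1,\ldots,N-1\}^d$. Conditional on $\boldsymbol g$, put $R=R_{\alpha,\boldsymbol\gamma,N}(\boldsymbol g)$ and $S=\lceil 2KR\log N\rceil$, and choose the shifts $\boldsymbol y_m^{(s)}$, $m=1,\ldots,R$, $s=1,\ldots,S$, independently and uniformly from $[0,1)^d$. Then: (1) With probability at least $\delta$ the generating vector satisfies $\rho(\boldsymbol g)\ge M$ and $R_{\alpha,\boldsymbol\gamma,N}(\boldsymbol g)\le R_*$. (2) For all sufficiently large $N$ (with $d,\alpha,\boldsymbol\gamma,\delta,K$ fixed) one has $2N^{1-K}R_*^2<1$. For such $N$, conditional on a generating vector with the properties in (1), the shifts satisfy $\|[B_j^HB_j]^{-1}\|_2\le 1/S$ for all fibers ($j=1,\ldots,J$) with probability at least $1-2N^{1-K}R_*^2$. Consequently the conditions on $\boldsymbol g$ in (1) and this condition on the shifts hold jointly with probability at least $\delta\,(1-2N^{1-K}R_*^2)$,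 which is positive. (3) On this joint event, for every $\tau\in(0,1]$, $$\mathrm e_2^{\mathrm{ran}}((\mathcal A_{\boldsymbol\Delta})_{\boldsymbol\Delta},\mathcal K_{d,\alpha,\boldsymbol\gamma})\le C_{d,\alpha,\boldsymbol\gamma,\delta,K,\tau}\;p^{-\alpha+\tau},$$ where $\mathcal A_{\boldsymbol\Delta}$ is the randomly shifted lattice algorithm defined by $N,M,\boldsymbol g$, the shifts $\boldsymbol y_m^{(s)}$ and the random $\boldsymbol\Delta$, $p=NRS$ is the total number of function evaluations, and the constant $C_{d,\alpha,\boldsymbol\gamma,\delta,K,\tau}$ depends only on the displayed parameters. (4) If, in addition, $\alpha\in\mathbb N$, and instead $\boldsymbol g$ is constructed using the component-by-component (CBC) algorithm, $M$ is chosen as $$M=\max_{1/\alpha<\lambda\le2}\left(\frac N2\prod_{j=1}^d\bigl(1+2\gamma_j^\lambda\zeta(\alpha\lambda)\bigr)^{-1}\right)^{1/\lambda}$$ and satisfies $M>1$, and the shifts satisfy $\|[B_j^HB_j]^{-1}\|_2\le1/S$ for all fibers, with $S=\lceil 2KR\log N\rceil$, $R=R_{\alpha,\boldsymbol\gamma,N}(\boldsymbol g)$, then the error bound in (3) also holds.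
   Context: $\mathbb N=\{1,2,\ldots\}$, $\log$ is the natural logarithm, $\zeta$ is the Riemann zeta function, $\|\cdot\|_2$ of a matrix is the spectral norm, $B^H$ is the Hermitian transpose, and $\{\cdot\}$ applied to a vector is the componentwise fractional part. Function space. For $\boldsymbol k\in\mathbb Z^d$ let $r_{\alpha,\boldsymbol\gamma}(\boldsymbol k)=\prod_{j:\,k_j\ne0}|k_j|^\alpha/\gamma_j$ (empty product $=1$). The weighted Korobov space $\mathcal K_{d,\alpha,\boldsymbol\gamma}$ consists of the 1-periodic functions $f:[0,1)^d\to\mathbb C$ given by an absolutely convergent Fourier series $f(\boldsymbol x)=\sum_{\boldsymbol k\in\mathbb Z^d}\widehat f(\boldsymbol k)\mathrm e^{2\pi\mathrm i\boldsymbol k\cdot\boldsymbol x}$ with $\|f\|_{d,\alpha,\boldsymbol\gamma}=\bigl(\sum_{\boldsymbol k}|\widehat f(\boldsymbol k)|^2r_{\alpha,\boldsymbol\gamma}(\boldsymbol k)^2\bigr)^{1/2}<\infty$. For $\boldsymbol\Delta$ uniformly distributed in $[0,1)^d$ (with $\boldsymbol g$ and the shifts $\boldsymbol y_m^{(s)}$ held fixed), the random-case error is $$\mathrm e_2^{\mathrm{ran}}((\mathcal A_{\boldsymbol\Delta})_{\boldsymbol\Delta},\mathcal K_{d,\alpha,\boldsymbol\gamma})=\sup_{\|f\|_{d,\alpha,\boldsymbol\gamma}\le1}\sqrt{\mathbb E_{\boldsymbol\Delta}\|f-\mathcal A_{\boldsymbol\Delta}(f)\|_2^2},$$ where $\|\cdot\|_2$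 of a function is the $L_2([0,1)^d)$ norm. Lattice notions. For $\boldsymbol g\in\{1,\ldots,N-1\}^d$, the dual lattice is $\mathcal L_N^\perp(\boldsymbol g)=\{\boldsymbol k\in\mathbb Z^d:\boldsymbol g\cdot\boldsymbol k\equiv0\pmod N\}$, and the figure of merit is $\rho(\boldsymbol g)=\min_{\boldsymbol\ell\in\mathcal L_N^\perp(\boldsymbol g)\setminus\{\boldsymbol0\}}r_{\alpha,\boldsymbol\gamma}(\boldsymbol\ell)$. Let $A_{\alpha,\boldsymbol\gamma,M}=\{\boldsymbol k\in\mathbb Z^d:r_{\alpha,\boldsymbol\gamma}(\boldsymbol k)<M\}$. The fiber along $\boldsymbol\ell\in\mathbb Z^d$ is $\Gamma_{\alpha,\boldsymbol\gamma,N}(\boldsymbol\ell;\boldsymbol g)=\{\boldsymbol k\in A_{\alpha,\boldsymbol\gamma,M}:\boldsymbol k\cdot\boldsymbol g\equiv\boldsymbol\ell\cdot\boldsymbol g\pmod N\}$, and the maximal fiber length is $R_{\alpha,\boldsymbol\gamma,N}(\boldsymbol g)=\max_{\boldsymbol\ell\in\mathbb Z^d}|\Gamma_{\alpha,\boldsymbol\gamma,N}(\boldsymbol\ell;\boldsymbol g)|$. Choose $\boldsymbol\ell^{(1)},\ldots,\boldsymbol\ell^{(J)}\in A_{\alpha,\boldsymbol\gamma,M}$ such that the fibers $\Gamma_{\alpha,\boldsymbol\gamma,N}(\boldsymbol\ell^{(j)};\boldsymbol g)$, $j=1,\ldots,J$, are pairwise disjoint with union $A_{\alpha,\boldsymbol\gamma,M}$;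 put $v_j=|\Gamma_{\alpha,\boldsymbol\gamma,N}(\boldsymbol\ell^{(j)};\boldsymbol g)|$. Randomized algorithm. Given shifts $\boldsymbol y_m^{(s)}\in[0,1)^d$, $1\le m\le R$, $1\le s\le S$ (the same shifts are used for all fibers), and $\boldsymbol\Delta\in[0,1)^d$. For the $j$-th fiber, enumerated as $\{\boldsymbol\ell_1,\ldots,\boldsymbol\ell_{v_j}\}$, let $B_j\in\mathbb C^{v_jS\times v_j}$ be the matrix with rows indexed by $(m,s)$, $1\le m\le v_j$, $1\le s\le S$, columns indexed by $i=1,\ldots,v_j$, and entries $\mathrm e^{2\pi\mathrm i\boldsymbol\ell_i\cdot\boldsymbol y_m^{(s)}}$. The statement $\|[B_j^HB_j]^{-1}\|_2\le 1/S$ includes invertibility of $B_j^HB_j$. Let $D(\boldsymbol\Delta)=\mathrm{diag}(\mathrm e^{2\pi\mathrm i\boldsymbol\ell_1\cdot\boldsymbol\Delta},\ldots,\mathrm e^{2\pi\mathrm i\boldsymbol\ell_{v_j}\cdot\boldsymbol\Delta})$. For $1\le m\le v_j$, $1\le s\le S$ let $$\mathcal F_N(f,\boldsymbol\ell_m,\boldsymbol y_m^{(s)}+\boldsymbol\Delta)=\frac1N\sum_{n=0}^{N-1}f(\{n\boldsymbol g/N+\boldsymbol y_m^{(s)}+\boldsymbol\Delta\})\,\mathrm e^{-2\pi\mathrm i\boldsymbol\ell_m\cdot(n\boldsymbol g/N+\boldsymbol y_m^{(s)}+\boldsymbol\Delta)},$$ and let the vector $(\mathcal B_N(f,\boldsymbol\ell_i,\{\boldsymbol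 y_m^{(s)}\},\boldsymbol\Delta))_{i=1}^{v_j}$ be $D(\boldsymbol\Delta)^{-1}[B_j^HB_j]^{-1}B_j^H\bigl(\mathrm e^{2\pi\mathrm i\boldsymbol\ell_m\cdot(\boldsymbol y_m^{(s)}+\boldsymbol\Delta)}\mathcal F_N(f,\boldsymbol\ell_m,\boldsymbol y_m^{(s)}+\boldsymbol\Delta)\bigr)_{(m,s)}$. Then $\mathcal A_{\boldsymbol\Delta}(f)(\boldsymbol x)=\sum_{\boldsymbol k\in A_{\alpha,\boldsymbol\gamma,M}}\mathcal B_N(f,\boldsymbol k,\{\boldsymbol y_m^{(s)}\},\boldsymbol\Delta)\,\mathrm e^{2\pi\mathrm i\boldsymbol k\cdot\boldsymbol x}$. CBC algorithm (for $\alpha\in\mathbb N$, $N$ prime). For $1\le s\le d$ and $(g_1,\ldots,g_s)\in\{1,\ldots,N-1\}^s$ let $P_{\alpha,\boldsymbol\gamma,N}((g_1,\ldots,g_s))=\sum_{\boldsymbol k}r_{\alpha,\boldsymbol\gamma}(\boldsymbol k)^{-2}$, the sum being over $\boldsymbol k\in\mathbb Z^s\setminus\{\boldsymbol0\}$ with $k_1g_1+\cdots+k_sg_s\equiv0\pmod N$, where $r_{\alpha,\boldsymbol\gamma}$ on $\mathbb Z^s$ uses the weights $\gamma_1,\ldots,\gamma_s$. Set $g_1=1$; for $s=1,\ldots,d-1$, with $g_1,\ldots,g_s$ already found, choose $g_{s+1}\in\{1,\ldots,N-1\}$ minimizing $g\mapsto P_{\alpha,\boldsymbol\gamma,N}((g_1,\ldots,g_s,g))$.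 The output is $\boldsymbol g=(g_1,\ldots,g_d)$. *)

theory Defs
  imports
    "HOL-Probability.Probability"
    "HOL-Number_Theory.Cong"
    "Jordan_Normal_Form.Gauss_Jordan_Elimination"
    "Jordan_Normal_Form.Schur_Decomposition"
begin

no_notation Finite_Cartesian_Product.vec_nth (infixl \<open>$\<close> 90)

text \<open>
  All indices are shifted to start at 0: coordinates of $d$-dimensional vectors, fibers,
  elements of a fiber and the two indices of a shift. A vector indexed by coordinates
  $0,\ldots,d-1$ is a function on \<open>nat\<close> that is extensional (\<open>undefined\<close>) outside \<open>{..<d}\<close>,
  so that the points of the product measure \<open>cube d\<close> below are exactly the
  points of $[0,1)^d$.
\<close>

section \<open>Vectors, exponentials and the uniform distribution on the cube\<close>

definition int_vecs :: "nat \<Rightarrow> (nat \<Rightarrow> int) set" where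
  "int_vecs d = ({..<d} \<rightarrow>\<^sub>E UNIV)"

definition zero_vec :: "nat \<Rightarrow> nat \<Rightarrow> int" where
  "zero_vec d = (\<lambda>j\<in>{..<d}. 0)"

definition int_dot :: "nat \<Rightarrow> (nat \<Rightarrow> int) \<Rightarrow> (nat \<Rightarrow> int) \<Rightarrow> int" where
  "int_dot d k l = (\<Sum>j<d. k j * l j)"

definition real_dot :: "nat \<Rightarrow> (nat \<Rightarrow> int) \<Rightarrow> (nat \<Rightarrow> real) \<Rightarrow> real" where
  "real_dot d k x = (\<Sum>j<d. real_of_int (k j) * x j)"

text \<open>\<open>expi2 t\<close> is $\mathrm e^{2\pi\mathrm i t}$.\<close>

definition expi2 :: "real \<Rightarrow> complex" where
  "expi2 t = cis (2 * pi * t)"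

definition cube :: "nat \<Rightarrow> (nat \<Rightarrow> real) measure" where
  "cube d = PiM {..<d} (\<lambda>_. restrict_space lborel {0..<1})"

section \<open>The weighted Korobov space and the random-case error\<close>

definition korobov_r :: "nat \<Rightarrow> real \<Rightarrow> (nat \<Rightarrow> real) \<Rightarrow> (nat \<Rightarrow> int) \<Rightarrow> real" where
  "korobov_r d \<alpha> \<gamma> k = (\<Prod>j\<in>{j. j < d \<and> k j \<noteq> 0}. real_of_int \<bar>k j\<bar> powr \<alpha> / \<gamma> j)"

definition fourier_coeff :: "nat \<Rightarrow> ((nat \<Rightarrow> real) \<Rightarrow> complex) \<Rightarrow> (nat \<Rightarrow> int) \<Rightarrow> complex" where
  "fourier_coeff d f k = (LINT x|cube d. f x * expi2 (- real_dot d k x))"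

text \<open>
  A 1-periodic function is represented by its restriction to $[0,1)^d$; values of \<open>f\<close>
  elsewhere are irrelevant and never used.
\<close>

definition korobov_space ::
    "nat \<Rightarrow> real \<Rightarrow> (nat \<Rightarrow> real) \<Rightarrow> ((nat \<Rightarrow> real) \<Rightarrow> complex) set" where
  "korobov_space d \<alpha> \<gamma> = {f.
     (\<lambda>k. cmod (fourier_coeff d f k)) summable_on int_vecs d \<and>
     (\<forall>x\<in>space (cube d).
        ((\<lambda>k. fourier_coeff d f k * expi2 (real_dot d k x)) has_sum f x) (int_vecs d)) \<and>
     (\<lambda>k. (cmod (fourier_coeff d f k))\<^sup>2 * (korobov_r d \<alpha> \<gamma> k)\<^sup>2) summable_on int_vecs d}"

definition korobov_norm ::
    "nat \<Rightarrow> real \<Rightarrow> (nat \<Rightarrow> real) \<Rightarrow> ((nat \<Rightarrow> real) \<Rightarrow> complex) \<Rightarrow> real" where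
  "korobov_norm d \<alpha> \<gamma> f =
     sqrt (\<Sum>\<^sub>\<infinity>k\<in>int_vecs d. (cmod (fourier_coeff d f k))\<^sup>2 * (korobov_r d \<alpha> \<gamma> k)\<^sup>2)"

definition ennreal_sqrt :: "ennreal \<Rightarrow> ennreal" where
  "ennreal_sqrt x = (if x = \<top> then \<top> else ennreal (sqrt (enn2real x)))"

text \<open>
  The first argument of \<open>A\<close> is the random shift $\boldsymbol\Delta$. The error takes values in
  \<open>ennreal\<close>, so that neither the integrals nor the supremum need a finiteness side condition.
\<close>

definition ran_error ::
    "nat \<Rightarrow> real \<Rightarrow> (nat \<Rightarrow> real) \<Rightarrow>
     ((nat \<Rightarrow> real) \<Rightarrow> ((nat \<Rightarrow> real) \<Rightarrow> complex) \<Rightarrow> (nat \<Rightarrow> real) \<Rightarrow> complex) \<Rightarrow> ennreal" where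
  "ran_error d \<alpha> \<gamma> A =
     (SUP f\<in>{f\<in>korobov_space d \<alpha> \<gamma>. korobov_norm d \<alpha> \<gamma> f \<le> 1}.
        ennreal_sqrt (\<integral>\<^sup>+\<Delta>. (\<integral>\<^sup>+x. ennreal ((cmod (f x - A \<Delta> f x))\<^sup>2) \<partial>cube d) \<partial>cube d))"

section \<open>Lattice notions\<close>

definition gen_vecs :: "nat \<Rightarrow> nat \<Rightarrow> (nat \<Rightarrow> int) set" where
  "gen_vecs d N = ({..<d} \<rightarrow>\<^sub>E {1..int N - 1})"

definition dual_lattice :: "nat \<Rightarrow> nat \<Rightarrow> (nat \<Rightarrow> int) \<Rightarrow> (nat \<Rightarrow> int) set" where
  "dual_lattice d N g = {k\<in>int_vecs d. [int_dot d g k = 0] (mod int N)}"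

definition merit :: "nat \<Rightarrow> real \<Rightarrow> (nat \<Rightarrow> real) \<Rightarrow> nat \<Rightarrow> (nat \<Rightarrow> int) \<Rightarrow> real" where
  "merit d \<alpha> \<gamma> N g = (LEAST x. x \<in> korobov_r d \<alpha> \<gamma> ` (dual_lattice d N g - {zero_vec d}))"

definition freq_set :: "nat \<Rightarrow> real \<Rightarrow> (nat \<Rightarrow> real) \<Rightarrow> real \<Rightarrow> (nat \<Rightarrow> int) set" where
  "freq_set d \<alpha> \<gamma> M = {k\<in>int_vecs d. korobov_r d \<alpha> \<gamma> k < M}"

definition fiber ::
    "nat \<Rightarrow> real \<Rightarrow> (nat \<Rightarrow> real) \<Rightarrow> nat \<Rightarrow> real \<Rightarrow> (nat \<Rightarrow> int) \<Rightarrow> (nat \<Rightarrow> int) \<Rightarrow> (nat \<Rightarrow> int) set" where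
  "fiber d \<alpha> \<gamma> N M g l =
     {k\<in>freq_set d \<alpha> \<gamma> M. [int_dot d k g = int_dot d l g] (mod int N)}"

definition max_fiber_length ::
    "nat \<Rightarrow> real \<Rightarrow> (nat \<Rightarrow> real) \<Rightarrow> nat \<Rightarrow> real \<Rightarrow> (nat \<Rightarrow> int) \<Rightarrow> nat" where
  "max_fiber_length d \<alpha> \<gamma> N M g = Max ((\<lambda>l. card (fiber d \<alpha> \<gamma> N M g l)) ` int_vecs d)"

text \<open>
  A choice of representatives $\boldsymbol\ell^{(j)}$ together with an enumeration of each of the
  fibers: \<open>Fs ! j ! i\<close> is the element number \<open>i\<close> of the fiber number \<open>j\<close>.
\<close>

definition fiber_enum ::
    "nat \<Rightarrow> real \<Rightarrow> (nat \<Rightarrow> real) \<Rightarrow> nat \<Rightarrow> real \<Rightarrow> (nat \<Rightarrow> int) \<Rightarrow> (nat \<Rightarrow> int) list list \<Rightarrow> bool" where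
  "fiber_enum d \<alpha> \<gamma> N M g Fs \<longleftrightarrow>
     (\<exists>ls. length ls = length Fs \<and> set ls \<subseteq> freq_set d \<alpha> \<gamma> M \<and>
        (\<forall>j<length Fs. distinct (Fs ! j) \<and> set (Fs ! j) = fiber d \<alpha> \<gamma> N M g (ls ! j)) \<and>
        (\<forall>i<length Fs. \<forall>j<length Fs. i \<noteq> j \<longrightarrow>
           fiber d \<alpha> \<gamma> N M g (ls ! i) \<inter> fiber d \<alpha> \<gamma> N M g (ls ! j) = {}) \<and>
        (\<Union>j<length Fs. fiber d \<alpha> \<gamma> N M g (ls ! j)) = freq_set d \<alpha> \<gamma> M)"

section \<open>The randomly shifted lattice algorithm\<close>

definition euclid_norm :: "complex Matrix.vec \<Rightarrow> real" where
  "euclid_norm v = sqrt (\<Sum>i<dim_vec v. (cmod (v $ i))\<^sup>2)"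

definition spectral_norm :: "complex Matrix.mat \<Rightarrow> real" where
  "spectral_norm A =
     (SUP v\<in>{v\<in>carrier_vec (dim_col A). euclid_norm v \<le> 1}. euclid_norm (A *\<^sub>v v))"

text \<open>
  In the following, \<open>F\<close> is the enumeration of one fiber and \<open>y (m, s)\<close> are the shifts.
  The row index \<open>(m, s)\<close> with \<open>m < length F\<close>, \<open>s < S\<close> is encoded as \<open>m * S + s\<close>.
\<close>

definition B_mat ::
    "nat \<Rightarrow> nat \<Rightarrow> (nat \<times> nat \<Rightarrow> nat \<Rightarrow> real) \<Rightarrow> (nat \<Rightarrow> int) list \<Rightarrow> complex Matrix.mat" where
  "B_mat d S y F = Matrix.mat (length F * S) (length F)
     (\<lambda>(q, i). expi2 (real_dot d (F ! i) (y (q div S, q mod S))))"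

definition gram_mat ::
    "nat \<Rightarrow> nat \<Rightarrow> (nat \<times> nat \<Rightarrow> nat \<Rightarrow> real) \<Rightarrow> (nat \<Rightarrow> int) list \<Rightarrow> complex Matrix.mat" where
  "gram_mat d S y F = mat_adjoint (B_mat d S y F) * B_mat d S y F"

definition D_mat ::
    "nat \<Rightarrow> (nat \<Rightarrow> int) list \<Rightarrow> (nat \<Rightarrow> real) \<Rightarrow> complex Matrix.mat" where
  "D_mat d F \<Delta> = mat_diag (length F) (\<lambda>i. expi2 (real_dot d (F ! i) \<Delta>))"

definition good_shifts ::
    "nat \<Rightarrow> nat \<Rightarrow> (nat \<Rightarrow> int) list list \<Rightarrow> (nat \<times> nat \<Rightarrow> nat \<Rightarrow> real) \<Rightarrow> bool" where
  "good_shifts d S Fs y \<longleftrightarrow>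
     (\<forall>F\<in>set Fs. invertible_mat (gram_mat d S y F) \<and>
        spectral_norm (the (mat_inverse (gram_mat d S y F))) \<le> 1 / real S)"

text \<open>\<open>lattice_coeff d N g f l z\<close> is $\mathcal F_N(f,\boldsymbol\ell,\boldsymbol z)$.\<close>

definition lattice_coeff ::
    "nat \<Rightarrow> nat \<Rightarrow> (nat \<Rightarrow> int) \<Rightarrow> ((nat \<Rightarrow> real) \<Rightarrow> complex) \<Rightarrow> (nat \<Rightarrow> int) \<Rightarrow> (nat \<Rightarrow> real) \<Rightarrow> complex" where
  "lattice_coeff d N g f l z = 1 / of_nat N *
     (\<Sum>n<N. let t = (\<lambda>j. real n * real_of_int (g j) / real N + z j) in
        f (\<lambda>j\<in>{..<d}. frac (t j)) * expi2 (- real_dot d l t))"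

definition data_vec ::
    "nat \<Rightarrow> nat \<Rightarrow> (nat \<Rightarrow> int) \<Rightarrow> nat \<Rightarrow> (nat \<times> nat \<Rightarrow> nat \<Rightarrow> real) \<Rightarrow> (nat \<Rightarrow> int) list \<Rightarrow>
     (nat \<Rightarrow> real) \<Rightarrow> ((nat \<Rightarrow> real) \<Rightarrow> complex) \<Rightarrow> complex Matrix.vec" where
  "data_vec d N g S y F \<Delta> f = Matrix.vec (length F * S)
     (\<lambda>q. let l = F ! (q div S); z = (\<lambda>j. y (q div S, q mod S) j + \<Delta> j) in
        expi2 (real_dot d l z) * lattice_coeff d N g f l z)"

definition approx_coeffs ::
    "nat \<Rightarrow> nat \<Rightarrow> (nat \<Rightarrow> int) \<Rightarrow> nat \<Rightarrow> (nat \<times> nat \<Rightarrow> nat \<Rightarrow> real) \<Rightarrow> (nat \<Rightarrow> int) list \<Rightarrow>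
     (nat \<Rightarrow> real) \<Rightarrow> ((nat \<Rightarrow> real) \<Rightarrow> complex) \<Rightarrow> complex Matrix.vec" where
  "approx_coeffs d N g S y F \<Delta> f =
     (the (mat_inverse (D_mat d F \<Delta>)) * the (mat_inverse (gram_mat d S y F))
        * mat_adjoint (B_mat d S y F)) *\<^sub>v data_vec d N g S y F \<Delta> f"

text \<open>
  When \<open>fiber_enum\<close> holds for \<open>Fs\<close>, every frequency in \<open>freq_set\<close> is \<open>Fs ! j ! i\<close> for exactly one
  pair \<open>(j, i)\<close>, so the double sum is the sum over \<open>freq_set\<close>.
\<close>

definition lattice_algorithm ::
    "nat \<Rightarrow> nat \<Rightarrow> (nat \<Rightarrow> int) \<Rightarrow> nat \<Rightarrow> (nat \<times> nat \<Rightarrow> nat \<Rightarrow> real) \<Rightarrow> (nat \<Rightarrow> int) list list \<Rightarrow>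
     (nat \<Rightarrow> real) \<Rightarrow> ((nat \<Rightarrow> real) \<Rightarrow> complex) \<Rightarrow> (nat \<Rightarrow> real) \<Rightarrow> complex" where
  "lattice_algorithm d N g S y Fs \<Delta> f x =
     (\<Sum>j<length Fs. \<Sum>i<length (Fs ! j).
        approx_coeffs d N g S y (Fs ! j) \<Delta> f $ i * expi2 (real_dot d (Fs ! j ! i) x))"

section \<open>Choice of the parameters\<close>

text \<open>The Riemann zeta function, only used for real arguments \<open>s > 1\<close>, where its series converges.\<close>

definition real_zeta :: "real \<Rightarrow> real" where
  "real_zeta s = (\<Sum>n. 1 / real (Suc n) powr s)"

definition threshold :: "nat \<Rightarrow> real \<Rightarrow> (nat \<Rightarrow> real) \<Rightarrow> real \<Rightarrow> real" where
  "threshold d \<alpha> \<gamma> c =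
     (GREATEST x. x \<in> (\<lambda>l. (c * (\<Prod>j<d. inverse (1 + 2 * \<gamma> j powr l * real_zeta (\<alpha> * l)))) powr (1 / l))
        ` {1 / \<alpha> <.. 2})"

definition M_ran :: "nat \<Rightarrow> real \<Rightarrow> (nat \<Rightarrow> real) \<Rightarrow> real \<Rightarrow> nat \<Rightarrow> real" where
  "M_ran d \<alpha> \<gamma> \<delta> N = threshold d \<alpha> \<gamma> ((real N - 1) * (1 - \<delta>))"

definition M_cbc :: "nat \<Rightarrow> real \<Rightarrow> (nat \<Rightarrow> real) \<Rightarrow> nat \<Rightarrow> real" where
  "M_cbc d \<alpha> \<gamma> N = threshold d \<alpha> \<gamma> (real N / 2)"

definition R_star :: "nat \<Rightarrow> nat \<Rightarrow> real" where
  "R_star d m0 = 1 + (3 ^ d - 1) * (real m0 + real d) ^ (d - 1)"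

definition num_shifts :: "real \<Rightarrow> nat \<Rightarrow> nat \<Rightarrow> nat" where
  "num_shifts K N R = nat \<lceil>2 * K * real R * ln (real N)\<rceil>"

section \<open>Component-by-component construction\<close>

text \<open>Only the coordinates \<open>g j\<close> with \<open>j < s\<close> enter \<open>cbc_P s \<alpha> \<gamma> N g\<close>.\<close>

definition cbc_P :: "nat \<Rightarrow> real \<Rightarrow> (nat \<Rightarrow> real) \<Rightarrow> nat \<Rightarrow> (nat \<Rightarrow> int) \<Rightarrow> real" where
  "cbc_P s \<alpha> \<gamma> N g =
     (\<Sum>\<^sub>\<infinity>k\<in>{k\<in>int_vecs s - {zero_vec s}. [int_dot s k g = 0] (mod int N)}.
        1 / (korobov_r s \<alpha> \<gamma> k)\<^sup>2)"

text \<open>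
  Ties between minimizers may be broken arbitrarily, so the possible outputs are described by a
  predicate.
\<close>

definition cbc_output :: "nat \<Rightarrow> real \<Rightarrow> (nat \<Rightarrow> real) \<Rightarrow> nat \<Rightarrow> (nat \<Rightarrow> int) \<Rightarrow> bool" where
  "cbc_output d \<alpha> \<gamma> N g \<longleftrightarrow>
     g \<in> gen_vecs d N \<and> g 0 = 1 \<and>
     (\<forall>s\<in>{1..<d}. is_arg_min (\<lambda>z. cbc_P (Suc s) \<alpha> \<gamma> N (g(s := z))) (\<lambda>z. z \<in> {1..int N - 1}) (g s))"

section \<open>Probability laws\<close>

definition shift_law :: "nat \<Rightarrow> nat \<Rightarrow> nat \<Rightarrow> (nat \<times> nat \<Rightarrow> nat \<Rightarrow> real) measure" where
  "shift_law d R S = PiM ({..<R} \<times> {..<S}) (\<lambda>_. cube d)"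

text \<open>
  The law of a pair whose first component has the discrete law \<open>p\<close> and whose second component
  has, conditionally on the first being \<open>g\<close>, the law \<open>\<kappa> g\<close>. The measurable spaces of the
  \<open>\<kappa> g\<close> may differ (the number of shifts depends on the generating vector), which rules out
  the monadic bind of measures.
\<close>

definition joint_law :: "'a pmf \<Rightarrow> ('a \<Rightarrow> 'b measure) \<Rightarrow> ('a \<times> 'b) measure" where
  "joint_law p \<kappa> = measure_of (SIGMA g:set_pmf p. space (\<kappa> g))
     {X. X \<subseteq> (SIGMA g:set_pmf p. space (\<kappa> g)) \<and> (\<forall>g\<in>set_pmf p. Pair g -` X \<in> sets (\<kappa> g))}
     (\<lambda>X. \<integral>\<^sup>+g. emeasure (\<kappa> g) (Pair g -` X) \<partial>measure_pmf p)"

lemma sigma_algebra_joint_law: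
  "sigma_algebra (SIGMA g:set_pmf p. space (\<kappa> g))
     {X. X \<subseteq> (SIGMA g:set_pmf p. space (\<kappa> g)) \<and> (\<forall>g\<in>set_pmf p. Pair g -` X \<in> sets (\<kappa> g))}"
  (is "sigma_algebra ?\<Omega> ?\<A>")
  unfolding sigma_algebra_iff2
proof (intro conjI ballI allI impI)
  show "?\<A> \<subseteq> Pow ?\<Omega>" by auto
  show "{} \<in> ?\<A>" by auto
next
  fix X assume X: "X \<in> ?\<A>"
  have "Pair g -` (?\<Omega> - X) = space (\<kappa> g) - Pair g -` X" if "g \<in> set_pmf p" for g
    using that by auto
  with X show "?\<Omega> - X \<in> ?\<A>" by auto
next
  fix X :: "nat \<Rightarrow> _" assume X: "range X \<subseteq> ?\<A>"
  have "Pair g -` (\<Union>i. X i) = (\<Union>i. Pair g -` X i)" for g by auto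
  with X show "(\<Union>i. X i) \<in> ?\<A>" by (auto simp: image_subset_iff)
qed

lemma space_joint_law: "space (joint_law p \<kappa>) = (SIGMA g:set_pmf p. space (\<kappa> g))"
  unfolding joint_law_def by (rule space_measure_of) auto

lemma sets_joint_law:
  "sets (joint_law p \<kappa>) =
     {X. X \<subseteq> (SIGMA g:set_pmf p. space (\<kappa> g)) \<and> (\<forall>g\<in>set_pmf p. Pair g -` X \<in> sets (\<kappa> g))}"
  unfolding joint_law_def by (rule sigma_algebra.sets_measure_of_eq[OF sigma_algebra_joint_law])

lemma emeasure_joint_law:
  assumes "X \<in> sets (joint_law p \<kappa>)"
  shows "emeasure (joint_law p \<kappa>) X = (\<integral>\<^sup>+g. emeasure (\<kappa> g) (Pair g -` X) \<partial>measure_pmf p)"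
proof (rule emeasure_measure_of[OF joint_law_def])
  let ?\<mu> = "\<lambda>X. \<integral>\<^sup>+g. emeasure (\<kappa> g) (Pair g -` X) \<partial>measure_pmf p"
  show "positive (sets (joint_law p \<kappa>)) ?\<mu>" by (simp add: positive_def)
  show "countably_additive (sets (joint_law p \<kappa>)) ?\<mu>"
  proof (rule countably_additiveI)
    fix X :: "nat \<Rightarrow> _"
    assume X: "range X \<subseteq> sets (joint_law p \<kappa>)" and disj: "disjoint_family X"
    have "(\<Sum>i. ?\<mu> (X i)) = (\<integral>\<^sup>+g. (\<Sum>i. emeasure (\<kappa> g) (Pair g -` X i)) \<partial>measure_pmf p)"
      by (rule nn_integral_suminf[symmetric]) simp
    also have "\<dots> = ?\<mu> (\<Union>i. X i)"
    proof (rule nn_integral_cong_AE, rule AE_pmfI)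
      fix g assume g: "g \<in> set_pmf p"
      have "range (\<lambda>i. Pair g -` X i) \<subseteq> sets (\<kappa> g)"
        using X g by (auto simp: sets_joint_law image_subset_iff)
      moreover have "disjoint_family (\<lambda>i. Pair g -` X i)"
        using disj by (auto simp: disjoint_family_on_def)
      ultimately have "(\<Sum>i. emeasure (\<kappa> g) (Pair g -` X i)) = emeasure (\<kappa> g) (\<Union>i. Pair g -` X i)"
        by (rule suminf_emeasure)
      then show "(\<Sum>i. emeasure (\<kappa> g) (Pair g -` X i)) = emeasure (\<kappa> g) (Pair g -` (\<Union>i. X i))"
        by (simp add: vimage_UN)
    qed
    finally show "(\<Sum>i. ?\<mu> (X i)) = ?\<mu> (\<Union>i. X i)" .
  qed
qed (use assms in auto)

lemma prob_space_joint_law: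
  assumes "\<And>g. g \<in> set_pmf p \<Longrightarrow> prob_space (\<kappa> g)"
  shows "prob_space (joint_law p \<kappa>)"
proof
  have "emeasure (joint_law p \<kappa>) (space (joint_law p \<kappa>)) =
      (\<integral>\<^sup>+g. emeasure (\<kappa> g) (Pair g -` space (joint_law p \<kappa>)) \<partial>measure_pmf p)"
    by (rule emeasure_joint_law) simp
  also have "\<dots> = (\<integral>\<^sup>+g. 1 \<partial>measure_pmf p)"
  proof (rule nn_integral_cong_AE, rule AE_pmfI)
    fix g assume "g \<in> set_pmf p"
    then have "Pair g -` space (joint_law p \<kappa>) = space (\<kappa> g)"
      by (auto simp: space_joint_law)
    then show "emeasure (\<kappa> g) (Pair g -` space (joint_law p \<kappa>)) = 1"
      using prob_space.emeasure_space_1[OF assms[OF \<open>g \<in> set_pmf p\<close>]] by simp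
  qed
  finally show "emeasure (joint_law p \<kappa>) (space (joint_law p \<kappa>)) = 1" by simp
qed

section \<open>Standing hypotheses and events\<close>

definition admissible :: "nat \<Rightarrow> real \<Rightarrow> (nat \<Rightarrow> real) \<Rightarrow> real \<Rightarrow> nat \<Rightarrow> nat \<Rightarrow> bool" where
  "admissible d \<alpha> \<gamma> \<delta> N m0 \<longleftrightarrow>
     prime N \<and> N > 2 \<and> M_ran d \<alpha> \<gamma> \<delta> N > 1 \<and>
     m0 \<ge> 1 \<and> 2 ^ (m0 - 1) < M_ran d \<alpha> \<gamma> \<delta> N powr (1 / \<alpha>) \<and> M_ran d \<alpha> \<gamma> \<delta> N powr (1 / \<alpha>) \<le> 2 ^ m0"

definition good_gen ::
    "nat \<Rightarrow> real \<Rightarrow> (nat \<Rightarrow> real) \<Rightarrow> real \<Rightarrow> nat \<Rightarrow> nat \<Rightarrow> (nat \<Rightarrow> int) \<Rightarrow> bool" where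
  "good_gen d \<alpha> \<gamma> \<delta> N m0 g \<longleftrightarrow>
     merit d \<alpha> \<gamma> N g \<ge> M_ran d \<alpha> \<gamma> \<delta> N \<and>
     real (max_fiber_length d \<alpha> \<gamma> N (M_ran d \<alpha> \<gamma> \<delta> N) g) \<le> R_star d m0"

text \<open>
  The error bound with constant \<open>C\<close> and exponent loss \<open>\<tau>\<close>, for \<open>R * S\<close> shifts and
  \<open>N * R * S\<close> function evaluations.
\<close>

definition error_bound ::
    "nat \<Rightarrow> real \<Rightarrow> (nat \<Rightarrow> real) \<Rightarrow> real \<Rightarrow> real \<Rightarrow> nat \<Rightarrow> (nat \<Rightarrow> int) \<Rightarrow> nat \<Rightarrow> nat \<Rightarrow>
     (nat \<Rightarrow> int) list list \<Rightarrow> (nat \<times> nat \<Rightarrow> nat \<Rightarrow> real) \<Rightarrow> bool" where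
  "error_bound d \<alpha> \<gamma> \<tau> C N g R S Fs y \<longleftrightarrow>
     ran_error d \<alpha> \<gamma> (lattice_algorithm d N g S y Fs)
       \<le> ennreal (C * real (N * R * S) powr (- \<alpha> + \<tau>))"

end

theory Submission
  imports Defs "HOL-Library.Discrete_Functions"
begin

text \<open>
  \<^emph>\<open>Recovery.\<close> A lattice rule cannot distinguish two frequencies that agree
  modulo the dual lattice (\<open>lattice_coeff_has_sum\<close>), so the rules for one fiber
  return the sum of all \<open>f\<close>-coefficients of one residue class, each multiplied by a
  phase that depends on the shift. With \<open>S\<close> times as many equations as unknowns,
  least squares separates the frequencies in the fiber. If \<open>B\<^sup>H B\<close> expands
  vectors at least by the factor \<open>S\<close>, the squared error in the coefficients is at
  most \<open>1 / S\<close> times the squared norm of the residual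
  (\<open>approx_coeffs_error\<close>), and the residual consists of the aliasing from frequencies
  outside the frequency set. Averaging over \<open>\<Delta>\<close> makes the aliasing terms
  orthogonal, and the squared error of the algorithm on the unit ball is at most \<open>(1 + R) /
  M\<^sup>2\<close> (\<open>ran_error_le\<close>). Everything else serves to make \<open>M\<close>
  large and \<open>R\<close> small.

  \<^emph>\<open>Fibers.\<close> If the figure of merit is at least \<open>M\<close>, two points
  of a fiber cannot be so close that their difference has weight below \<open>M\<close>. A dyadic
  decomposition then bounds \<open>R\<close> by a power of \<open>log M\<close>
  (\<open>card_fiber_le\<close>).

  \<^emph>\<open>Generating vectors.\<close> The sum of \<open>r k powr (- l)\<close> over all
  frequencies is the Euler-type product in the definition of \<open>M\<close>. For random
  \<open>g\<close> a union bound shows that the figure of merit is at least \<open>M\<close> with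
  probability \<open>\<delta>\<close> (\<open>prob_dual_lattice_avoids\<close>). For the
  component-by-component construction, averaging over the choices for each component bounds
  \<open>cbc_P\<close>, and a dual lattice point of weight below \<open>M\<close> would violate
  that bound (\<open>korobov_r_ge_if_cbc_output\<close>). The maximum defining \<open>M\<close> is
  attained at some \<open>l\<close>, to which both arguments apply, and \<open>M\<close> is at
  least a constant times \<open>N powr \<beta>\<close> for every \<open>\<beta> < \<alpha>\<close>
  (\<open>threshold_equation\<close>, \<open>threshold_ge\<close>), so that the loss
  \<open>\<tau>\<close> in the exponent absorbs all logarithms.

  \<^emph>\<open>Shifts.\<close> The entries of \<open>B\<^sup>H B\<close> off the diagonal are
  sums of independent points uniformly distributed on the unit circle. If all are at most
  \<open>S\<close> in modulus, then diagonal dominance gives the required expansion, since the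
  diagonal is \<open>S\<close> times the size of the matrix. A sharp subgaussian estimate for the
  uniform distribution on the circle makes the probability of failure small enough
  (\<open>exp_cos_moment\<close>, \<open>prob_not_gram_expands\<close>).
\<close>

section \<open>Exponentials and their integrals over the cube\<close>

lemma expi2_add: "expi2 (s + t) = expi2 s * expi2 t"
  by (simp add: expi2_def cis_mult ring_distribs)

lemma norm_expi2 [simp]: "norm (expi2 t) = 1"
  by (simp add: expi2_def)

lemma cnj_expi2: "cnj (expi2 t) = expi2 (- t)"
  by (simp add: expi2_def cis_cnj)

lemma expi2_0 [simp]: "expi2 0 = 1"
  by (simp add: expi2_def)

lemma expi2_of_int [simp]: "expi2 (of_int n) = 1"
  unfolding expi2_def by (rule cis_multiple_2pi) simp

lemma expi2_diff: "expi2 (s - t) = expi2 s * expi2 (- t)"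
  by (simp flip: expi2_add)

lemma expi2_mult_minus [simp]: "expi2 t * expi2 (- t) = 1"
  by (simp flip: expi2_add)

lemma expi2_power: "expi2 t ^ n = expi2 (real n * t)"
  unfolding expi2_def Complex.DeMoivre by (simp add: mult_ac)

lemma expi2_sum: "finite A \<Longrightarrow> expi2 (sum f A) = (\<Prod>i\<in>A. expi2 (f i))"
  by (induction A rule: finite_induct) (auto simp: expi2_add)

lemma expi2_eq_1_iff: "expi2 t = 1 \<longleftrightarrow> t \<in> \<int>"
proof
  assume "expi2 t = 1"
  then have "cos (2 * pi * t) = 1"
    unfolding expi2_def by (metis cis.simps(1) one_complex.simps(1))
  then obtain n :: int where "2 * pi * t = of_int n * 2 * pi"
    unfolding cos_one_2pi_int by metis
  then have "t = n" by simp
  then show "t \<in> \<int>" by simp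
qed (auto elim!: Ints_cases)

lemma expi2_borel [measurable]: "expi2 \<in> borel_measurable borel"
  unfolding expi2_def by (intro borel_measurable_continuous_onI continuous_intros)

abbreviation wave :: "nat \<Rightarrow> (nat \<Rightarrow> int) \<Rightarrow> (nat \<Rightarrow> real) \<Rightarrow> complex" where
  "wave d k x \<equiv> expi2 (real_dot d k x)"

lemma real_dot_add: "real_dot d k (\<lambda>j. x j + y j) = real_dot d k x + real_dot d k y"
  by (simp add: real_dot_def ring_distribs sum.distrib)

lemma real_dot_diff_left: "real_dot d (\<lambda>j. k j - l j) x = real_dot d k x - real_dot d l x"
  by (simp add: real_dot_def ring_distribs sum_subtractf)

lemma expi2_real_dot_frac:
  "wave d k (\<lambda>j\<in>{..<d}. frac (t j)) = wave d k t"
proof -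
  have "real_dot d k t = real_dot d k (\<lambda>j\<in>{..<d}. frac (t j)) + of_int (\<Sum>j<d. k j * \<lfloor>t j\<rfloor>)"
    by (simp add: real_dot_def frac_def sum.distrib [symmetric] algebra_simps)
  then show ?thesis by (simp add: expi2_add del: of_int_sum)
qed

lemma sum_expi2_multiples:
  assumes "N > 0"
  shows "(\<Sum>n<N. expi2 (real n * (real_of_int a / real N))) = (if int N dvd a then of_nat N else 0)"
proof -
  let ?w = "expi2 (real_of_int a / real N)"
  have *: "(\<Sum>n<N. expi2 (real n * (real_of_int a / real N))) = (\<Sum>n<N. ?w ^ n)"
    by (simp add: expi2_power)
  have "?w = 1 \<longleftrightarrow> int N dvd a"
  proof -
    have "real_of_int a / real N \<in> \<int> \<longleftrightarrow> int N dvd a"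
      by (metis assms of_int_div_of_int_in_Ints_iff of_int_of_nat_eq of_nat_0_eq_iff not_gr_zero)
    then show ?thesis by (simp add: expi2_eq_1_iff)
  qed
  moreover have "(\<Sum>n<N. ?w ^ n) = 0" if "?w \<noteq> 1"
  proof -
    have "?w ^ N = 1" using assms by (simp add: expi2_power)
    then show ?thesis using that by (simp add: sum_gp_strict)
  qed
  ultimately show ?thesis unfolding * by auto
qed

abbreviation unit_law :: "real measure" where
  "unit_law \<equiv> restrict_space lborel {0..<1}"

lemma prob_space_unit_law: "prob_space unit_law"
  by (rule prob_spaceI) (simp add: emeasure_restrict_space space_restrict_space)

lemma prob_space_cube: "prob_space (cube d)"
  unfolding cube_def by (intro prob_space_PiM prob_space_unit_law)

lemma space_cube: "space (cube d) = ({..<d} \<rightarrow>\<^sub>E {0..<1})"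
  by (simp add: cube_def space_PiM space_restrict_space)

lemma measurable_cube_coord: "j < d \<Longrightarrow> (\<lambda>x. x j) \<in> borel_measurable (cube d)"
proof -
  assume j: "j < d"
  have "(\<lambda>x. x j) \<in> measurable (cube d) unit_law"
    unfolding cube_def using j by (intro measurable_component_singleton) simp
  moreover have "(\<lambda>x. x) \<in> measurable unit_law borel"
    by (intro measurable_restrict_space1) simp
  ultimately show ?thesis
    using measurable_compose by blast
qed

lemma measurable_real_dot [measurable]: "real_dot d k \<in> borel_measurable (cube d)"
  unfolding real_dot_def by (intro borel_measurable_sum borel_measurable_times measurable_cube_coord) auto

lemma measurable_expi2_real_dot [measurable]:
  "(\<lambda>x. wave d k x) \<in> borel_measurable (cube d)"
  by measurable

lemma integral_expi2_int:
  "(LINT x|unit_law. expi2 (real_of_int k * x)) = (if k = 0 then 1 else 0)"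
proof (cases "k = 0")
  case True
  then show ?thesis using prob_space.prob_space[OF prob_space_unit_law] by simp
next
  case False
  let ?G = "\<lambda>z. exp (2 * of_real pi * \<i> * of_int k * z) / (2 * of_real pi * \<i> * of_int k)"
  let ?F = "\<lambda>x. ?G (complex_of_real x)"
  have e: "expi2 (real_of_int k * x) = exp (2 * of_real pi * \<i> * of_int k * of_real x)" for x
    by (simp add: expi2_def cis_conv_exp mult_ac)
  have deriv: "(?F has_vector_derivative expi2 (real_of_int k * x)) (at x within {0..1})" for x
    unfolding e using False
    by (intro has_vector_derivative_real_field) (auto intro!: derivative_eq_intros)
  have "(LINT x|unit_law. expi2 (real_of_int k * x)) =
      (LINT x|lborel. indicator {0..<1} x *\<^sub>R expi2 (real_of_int k * x))"
    by (rule integral_restrict_space) simp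
  also have "\<dots> = (LINT x|lborel. indicator {0..1} x *\<^sub>R expi2 (real_of_int k * x))"
  proof (rule integral_cong_AE)
    show "AE x in lborel. indicator {0..<1} x *\<^sub>R expi2 (real_of_int k * x) =
        indicator {0..1} x *\<^sub>R expi2 (real_of_int k * x)"
      using AE_lborel_singleton[of "1::real"] by eventually_elim (auto simp: indicator_def)
  qed measurable
  also have "\<dots> = ?F 1 - ?F 0"
    by (rule integral_FTC_atLeastAtMost[OF _ deriv])
       (auto intro!: continuous_intros simp: expi2_def)
  also have "\<dots> = 0" using e[of 1] by simp
  finally show ?thesis using False by simp
qed

lemma integrable_expi2_real_dot: "integrable (cube d) (\<lambda>x. wave d k x)"
proof -
  interpret prob_space "cube d" by (rule prob_space_cube)
  show ?thesis by (rule integrable_const_bound[of _ 1]) auto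
qed

lemma integral_expi2_real_dot:
  "(LINT x|cube d. wave d k x) = (if \<forall>j<d. k j = 0 then 1 else 0)"
proof -
  interpret P: product_sigma_finite "\<lambda>_. unit_law"
    by unfold_locales (rule sigma_finite_measure.sigma_finite_countable
        [OF prob_space_imp_sigma_finite[OF prob_space_unit_law]])
  have int: "integrable unit_law (\<lambda>x. expi2 (real_of_int m * x))" for m
    by (rule finite_measure.integrable_const_bound
        [OF prob_space.finite_measure[OF prob_space_unit_law], of _ 1])
       (auto intro!: measurable_restrict_space1)
  have "(LINT x|cube d. wave d k x) =
      (LINT x|PiM {..<d} (\<lambda>_. unit_law). (\<Prod>j<d. expi2 (real_of_int (k j) * x j)))"
    by (simp add: cube_def real_dot_def expi2_sum)
  also have "\<dots> = (\<Prod>j<d. LINT x|unit_law. expi2 (real_of_int (k j) * x))"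
    by (rule P.product_integral_prod) (use int in auto)
  also have "\<dots> = (if \<forall>j<d. k j = 0 then 1 else 0)"
    by (auto simp: integral_expi2_int intro!: prod.neutral)
  finally show ?thesis .
qed

lemma int_vecs_eqI: "k \<in> int_vecs d \<Longrightarrow> l \<in> int_vecs d \<Longrightarrow> (\<And>j. j < d \<Longrightarrow> k j = l j) \<Longrightarrow> k = l"
  unfolding int_vecs_def by (rule PiE_ext) auto

lemma trig_poly_L2:
  fixes \<kappa> :: "'i \<Rightarrow> nat \<Rightarrow> int"
  assumes fin: "finite X" and inj: "inj_on \<kappa> X" and sub: "\<kappa> ` X \<subseteq> int_vecs d"
  shows "(\<integral>\<^sup>+x. ennreal ((cmod (\<Sum>i\<in>X. c i * wave d (\<kappa> i) x))\<^sup>2) \<partial>cube d) =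
    ennreal (\<Sum>i\<in>X. (cmod (c i))\<^sup>2)"
proof -
  interpret prob_space "cube d" by (rule prob_space_cube)
  let ?p = "\<lambda>x. \<Sum>i\<in>X. c i * wave d (\<kappa> i) x"
  have expand: "complex_of_real ((cmod (?p x))\<^sup>2) =
      (\<Sum>i\<in>X. \<Sum>l\<in>X. c i * cnj (c l) * wave d (\<lambda>j. \<kappa> i j - \<kappa> l j) x)" for x
  proof -
    have "complex_of_real ((cmod (?p x))\<^sup>2) = ?p x * cnj (?p x)"
      by (rule complex_norm_square)
    also have "\<dots> = (\<Sum>i\<in>X. \<Sum>l\<in>X. (c i * wave d (\<kappa> i) x) *
        (cnj (c l) * expi2 (- real_dot d (\<kappa> l) x)))"
      by (simp add: cnj_expi2 sum_product)
    also have "\<dots> = (\<Sum>i\<in>X. \<Sum>l\<in>X. c i * cnj (c l) * wave d (\<lambda>j. \<kappa> i j - \<kappa> l j) x)"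
      by (simp add: real_dot_diff_left expi2_diff mult_ac)
    finally show ?thesis .
  qed
  have int: "integrable (cube d) (\<lambda>x. (cmod (?p x))\<^sup>2)"
  proof (rule integrable_const_bound[of _ "(\<Sum>i\<in>X. cmod (c i))\<^sup>2"])
    have "cmod (?p x) \<le> (\<Sum>i\<in>X. cmod (c i))" for x
      by (rule order_trans[OF norm_sum]) (simp add: norm_mult)
    then show "AE x in cube d. norm ((cmod (?p x))\<^sup>2) \<le> (\<Sum>i\<in>X. cmod (c i))\<^sup>2"
      by (auto intro!: power_mono)
  qed measurable
  have "complex_of_real (LINT x|cube d. (cmod (?p x))\<^sup>2) = (LINT x|cube d. complex_of_real ((cmod (?p x))\<^sup>2))"
    using int by (simp del: of_real_power)
  also have "\<dots> = (\<Sum>i\<in>X. \<Sum>l\<in>X. c i * cnj (c l) *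
      (LINT x|cube d. wave d (\<lambda>j. \<kappa> i j - \<kappa> l j) x))"
    unfolding expand using integrable_expi2_real_dot
    by (subst Bochner_Integration.integral_sum; (intro Bochner_Integration.integrable_sum)?; simp)+
  also have "\<dots> = (\<Sum>i\<in>X. \<Sum>l\<in>X. if i = l then c i * cnj (c i) else 0)"
  proof (intro sum.cong refl)
    fix i l assume il: "i \<in> X" "l \<in> X"
    then have "(\<forall>j<d. \<kappa> i j - \<kappa> l j = 0) \<longleftrightarrow> i = l"
      using int_vecs_eqI[of "\<kappa> i" d "\<kappa> l"] sub inj by (auto dest: inj_onD)
    then show "c i * cnj (c l) * (LINT x|cube d. wave d (\<lambda>j. \<kappa> i j - \<kappa> l j) x) =
        (if i = l then c i * cnj (c i) else 0)"
      by (simp add: integral_expi2_real_dot)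
  qed
  also have "\<dots> = complex_of_real (\<Sum>i\<in>X. (cmod (c i))\<^sup>2)"
    using fin by (simp add: complex_norm_square del: of_real_power)
  finally have "(LINT x|cube d. (cmod (?p x))\<^sup>2) = (\<Sum>i\<in>X. (cmod (c i))\<^sup>2)"
    by (simp only: of_real_eq_iff)
  then show ?thesis
    using nn_integral_eq_integral[OF int] by simp
qed

text \<open>By Fatou's lemma, orthonormality yields one half of Parseval's identity for every
  pointwise limit of trigonometric polynomials. The frequencies are indexed by an arbitrary type
  so that the lemma covers both Fourier series and the exponential series in a single
  character.\<close>

lemma parseval_le:
  fixes \<kappa> :: "'i \<Rightarrow> nat \<Rightarrow> int"
  assumes X: "\<And>n. finite (X n)" "\<And>n. inj_on \<kappa> (X n)" "\<And>n. \<kappa> ` X n \<subseteq> int_vecs d"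
    and lim: "\<And>x. x \<in> space (cube d) \<Longrightarrow>
      (\<lambda>n. \<Sum>i\<in>X n. c i * wave d (\<kappa> i) x) \<longlonglongrightarrow> F x"
    and B: "\<And>n. (\<Sum>i\<in>X n. (cmod (c i))\<^sup>2) \<le> B"
  shows "(\<integral>\<^sup>+x. ennreal ((cmod (F x))\<^sup>2) \<partial>cube d) \<le> ennreal B"
proof -
  let ?p = "\<lambda>n x. \<Sum>i\<in>X n. c i * wave d (\<kappa> i) x"
  have "(\<integral>\<^sup>+x. ennreal ((cmod (F x))\<^sup>2) \<partial>cube d) =
      (\<integral>\<^sup>+x. liminf (\<lambda>n. ennreal ((cmod (?p n x))\<^sup>2)) \<partial>cube d)"
  proof (rule nn_integral_cong)
    fix x assume "x \<in> space (cube d)"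
    then have "(\<lambda>n. ennreal ((cmod (?p n x))\<^sup>2)) \<longlonglongrightarrow> ennreal ((cmod (F x))\<^sup>2)"
      by (intro tendsto_intros tendsto_ennrealI lim)
    then show "ennreal ((cmod (F x))\<^sup>2) = liminf (\<lambda>n. ennreal ((cmod (?p n x))\<^sup>2))"
      by (intro lim_imp_Liminf[symmetric]) auto
  qed
  also have "\<dots> \<le> liminf (\<lambda>n. \<integral>\<^sup>+x. ennreal ((cmod (?p n x))\<^sup>2) \<partial>cube d)"
    by (rule nn_integral_liminf) measurable
  also have "\<dots> \<le> liminf (\<lambda>n::nat. ennreal B)"
    by (intro Liminf_mono always_eventually allI) (simp add: trig_poly_L2 X B ennreal_leI)
  also have "\<dots> = ennreal B" by (simp add: Liminf_const)
  finally show ?thesis .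
qed

text \<open>An exhausting sequence of finite sets is cofinal in the filter that defines unordered
  sums.\<close>

lemma has_sum_LIMSEQ_exhaustion:
  assumes "(f has_sum s) A" "\<And>n. finite (X n)" "incseq X" "(\<Union>n. X n) = A"
  shows "(\<lambda>n. sum f (X n)) \<longlonglongrightarrow> s"
proof -
  have "filterlim X (finite_subsets_at_top A) sequentially"
    unfolding filterlim_finite_subsets_at_top
  proof (intro allI impI)
    fix Y assume "finite Y \<and> Y \<subseteq> A"
    then have Y: "finite Y" "Y \<subseteq> A" by auto
    have "\<exists>n. Y \<subseteq> X n"
      using Y
    proof (induction Y rule: finite_induct)
      case (insert y Y)
      then obtain m n where "y \<in> X m" "Y \<subseteq> X n"
        using assms(4) by blast
      then have "insert y Y \<subseteq> X (max m n)"
        using incseqD[OF assms(3), of m "max m n"] incseqD[OF assms(3), of n "max m n"] by auto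
      then show ?case by blast
    qed simp
    then obtain n where "Y \<subseteq> X n" by blast
    then show "\<forall>\<^sub>F m in sequentially. finite (X m) \<and> Y \<subseteq> X m \<and> X m \<subseteq> A"
      using assms by (intro eventually_sequentiallyI[of n]) (auto dest: incseqD)
  qed
  with assms(1) show ?thesis
    unfolding has_sum_def by (rule filterlim_compose)
qed

definition int_box :: "nat \<Rightarrow> nat \<Rightarrow> (nat \<Rightarrow> int) set" where
  "int_box d n = ({..<d} \<rightarrow>\<^sub>E {- int n..int n})"

lemma finite_int_box [simp]: "finite (int_box d n)"
  unfolding int_box_def by (intro finite_PiE) auto

lemma int_box_subset: "int_box d n \<subseteq> int_vecs d"
  by (auto simp: int_box_def int_vecs_def)

lemma incseq_int_box: "incseq (int_box d)"
  unfolding int_box_def by (intro monoI PiE_mono) auto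

lemma Union_int_box: "(\<Union>n. int_box d n) = int_vecs d"
proof
  show "int_vecs d \<subseteq> (\<Union>n. int_box d n)"
  proof
    fix k assume k: "k \<in> int_vecs d"
    let ?n = "nat (\<Sum>j<d. \<bar>k j\<bar>)"
    have "k j \<in> {- int ?n..int ?n}" if "j < d" for j
    proof -
      have "\<bar>k j\<bar> \<le> (\<Sum>j<d. \<bar>k j\<bar>)"
        by (rule member_le_sum) (use that in auto)
      then show ?thesis by auto
    qed
    then have "k \<in> int_box d ?n"
      using k by (auto simp: int_box_def int_vecs_def PiE_iff)
    then show "k \<in> (\<Union>n. int_box d n)" by blast
  qed
qed (use int_box_subset in blast)

lemma fourier_parseval_le:
  assumes "\<And>x. x \<in> space (cube d) \<Longrightarrow>
      ((\<lambda>k. c k * wave d k x) has_sum F x) (int_vecs d)"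
    and "\<And>X. finite X \<Longrightarrow> X \<subseteq> int_vecs d \<Longrightarrow> (\<Sum>k\<in>X. (cmod (c k))\<^sup>2) \<le> B"
  shows "(\<integral>\<^sup>+x. ennreal ((cmod (F x))\<^sup>2) \<partial>cube d) \<le> ennreal B"
proof (rule parseval_le[where \<kappa> = "\<lambda>k. k" and X = "int_box d" and c = c])
  show "(\<lambda>n. \<Sum>k\<in>int_box d n. c k * wave d k x) \<longlonglongrightarrow> F x" if "x \<in> space (cube d)" for x
    by (rule has_sum_LIMSEQ_exhaustion[OF assms(1)[OF that] _ incseq_int_box Union_int_box]) simp
  show "(\<Sum>k\<in>int_box d n. (cmod (c k))\<^sup>2) \<le> B" for n
    by (rule assms(2)) (simp_all add: int_box_subset)
qed (use int_box_subset in auto)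

section \<open>Concentration of sums of random exponentials\<close>

lemma cmod_exp_coeff_squared:
  assumes "cmod u = 1"
  shows "(cmod ((of_real (\<theta> / 2) * u) ^ i /\<^sub>R fact i))\<^sup>2 = (\<theta>\<^sup>2 / 4) ^ i / (fact i)\<^sup>2"
proof -
  have w: "cmod (of_real (\<theta> / 2) * u) = \<bar>\<theta>\<bar> / 2"
    using assms by (simp add: norm_mult norm_divide)
  have c: "cmod ((of_real (\<theta> / 2) * u) ^ i /\<^sub>R fact i) = (\<bar>\<theta>\<bar> / 2) ^ i / fact i"
    unfolding norm_scaleR norm_power w
    by (subst abs_of_nonneg)
       (simp_all only: divide_inverse mult.commute inverse_nonnegative_iff_nonnegative fact_ge_zero)
  have "((\<bar>\<theta>\<bar> / 2) ^ i)\<^sup>2 = ((\<bar>\<theta>\<bar> / 2)\<^sup>2) ^ i"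
    by (metis power_mult mult.commute)
  also have "(\<bar>\<theta>\<bar> / 2)\<^sup>2 = \<theta>\<^sup>2 / 4"
    by (simp add: power_divide)
  finally show ?thesis
    unfolding c power_divide[of _ "fact i"] by (rule arg_cong)
qed

text \<open>A point \<open>z\<close> uniformly distributed on the unit circle is subgaussian with
  variance factor \<open>1/2\<close>, twice better than what Hoeffding's lemma gives for variables
  in \<open>[-1, 1]\<close>; the exponent \<open>K\<close> in the failure probability depends on
  this factor. The reason is that \<open>exp (\<theta> Re z)\<close> is the squared modulus of
  \<open>exp (\<theta> z / 2)\<close>, whose Taylor series is a Fourier series in the argument of
  \<open>z\<close>.\<close>

lemma exp_cos_moment:
  assumes k: "k \<in> int_vecs d" "k \<noteq> zero_vec d" and u: "cmod u = 1"
  shows "(\<integral>\<^sup>+x. ennreal (exp (\<theta> * Re (u * wave d k x))) \<partial>cube d) \<le> ennreal (exp (\<theta>\<^sup>2 / 4))"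
proof -
  let ?w = "\<lambda>x. of_real (\<theta> / 2) * (u * wave d k x)"
  let ?c = "\<lambda>n. (of_real (\<theta> / 2) * u) ^ n /\<^sub>R fact n"
  let ?k = "\<lambda>n::nat. \<lambda>j\<in>{..<d}. int n * k j"
  obtain j where j: "j < d" "k j \<noteq> 0"
    using k int_vecs_eqI[of k d "zero_vec d"] by (auto simp: zero_vec_def int_vecs_def)
  have inj: "inj ?k"
  proof (rule injI)
    fix m n assume "?k m = ?k n"
    then have "?k m j = ?k n j" by metis
    with j show "m = n" by simp
  qed
  have dot: "real_dot d (?k n) x = real n * real_dot d k x" for n x
    by (simp add: real_dot_def sum_distrib_left mult.assoc)
  have "exp (\<theta> * Re (u * wave d k x)) = (cmod (exp (?w x)))\<^sup>2" for x
    by (simp add: power2_eq_square mult_exp_exp flip: of_real_mult)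
  then have "(\<integral>\<^sup>+x. ennreal (exp (\<theta> * Re (u * wave d k x))) \<partial>cube d) =
      (\<integral>\<^sup>+x. ennreal ((cmod (exp (?w x)))\<^sup>2) \<partial>cube d)"
    by simp
  also have "\<dots> \<le> ennreal (exp (\<theta>\<^sup>2 / 4))"
  proof (rule parseval_le[where \<kappa> = ?k and X = "\<lambda>n. {..<n}" and c = ?c])
    show "inj_on ?k {..<n}" for n
      using inj by (rule inj_on_subset) simp
    show "?k ` {..<n} \<subseteq> int_vecs d" for n
      by (simp add: int_vecs_def image_subset_iff restrict_PiE_iff)
    show "(\<lambda>n. \<Sum>i<n. ?c i * wave d (?k i) x) \<longlonglongrightarrow> exp (?w x)" for x
    proof -
      have "?c i * wave d (?k i) x = ?w x ^ i /\<^sub>R fact i" for i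
        unfolding dot expi2_power[symmetric] by (simp add: power_mult_distrib power_divide mult_ac)
      then show ?thesis
        using exp_converges[of "?w x"] by (simp add: sums_def)
    qed
    show "(\<Sum>i<n. (cmod (?c i))\<^sup>2) \<le> exp (\<theta>\<^sup>2 / 4)" for n
    proof -
      have "(cmod (?c i))\<^sup>2 \<le> (\<theta>\<^sup>2 / 4) ^ i /\<^sub>R fact i" for i
      proof -
        have "(cmod (?c i))\<^sup>2 = (\<theta>\<^sup>2 / 4) ^ i / (fact i)\<^sup>2"
          by (rule cmod_exp_coeff_squared[OF u])
        also have "\<dots> \<le> (\<theta>\<^sup>2 / 4) ^ i / fact i"
          by (rule divide_left_mono)
             (simp_all only: self_le_power fact_ge_1 zero_less_numeral zero_le_power zero_le_divide_iff
               zero_le_power2 zero_le_numeral mult_pos_pos zero_less_power fact_gt_zero simp_thms)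
        also have "\<dots> = (\<theta>\<^sup>2 / 4) ^ i /\<^sub>R fact i"
          by (simp only: real_scaleR_def divide_inverse mult.commute)
        finally show ?thesis .
      qed
      then have "(\<Sum>i<n. (cmod (?c i))\<^sup>2) \<le> (\<Sum>i<n. (\<theta>\<^sup>2 / 4) ^ i /\<^sub>R fact i)"
        by (intro sum_mono)
      also have "\<dots> \<le> exp (\<theta>\<^sup>2 / 4)"
        unfolding exp_def
        by (rule sum_le_suminf[OF summable_exp_generic]) simp_all
      finally show ?thesis .
    qed
  qed simp
  finally show ?thesis .
qed

text \<open>Chernoff's method: Markov's inequality for the exponential moment, which factorizes by
  independence.\<close>

lemma sum_expi2_tail:
  assumes I: "finite I" and J: "J \<subseteq> I" "J \<noteq> {}" and k: "k \<in> int_vecs d" "k \<noteq> zero_vec d"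
    and u: "cmod u = 1" and a: "a > 0"
  shows "measure (PiM I (\<lambda>_. cube d))
      {y \<in> space (PiM I (\<lambda>_. cube d)). Re (u * (\<Sum>q\<in>J. wave d k (y q))) \<ge> a}
    \<le> exp (- a\<^sup>2 / real (card J))"
proof -
  let ?P = "PiM I (\<lambda>_. cube d)" and ?n = "real (card J)"
  interpret P: product_prob_space "\<lambda>_. cube d" I
    by (intro product_prob_spaceI prob_space_cube)
  have finJ: "finite J" using I J finite_subset by blast
  then have n: "?n > 0" using J by (simp add: card_gt_0_iff)
  (* minimizes the exponent of exp (- \<theta> a + n \<theta>^2 / 4) *)
  define \<theta> where "\<theta> = 2 * a / ?n"
  have \<theta>: "\<theta> > 0" using a n by (simp add: \<theta>_def)
  define h where "h = (\<lambda>q x. if q \<in> J then ennreal (exp (\<theta> * Re (u * wave d k x))) else 1)"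
  have [measurable]: "h q \<in> borel_measurable (cube d)" for q
    unfolding h_def by measurable
  have prod: "(\<Prod>q\<in>I. h q (y q)) = ennreal (exp (\<theta> * Re (u * (\<Sum>q\<in>J. wave d k (y q)))))" for y
  proof -
    have "(\<Prod>q\<in>I. h q (y q)) = (\<Prod>q\<in>J. ennreal (exp (\<theta> * Re (u * wave d k (y q)))))"
      using I J by (intro prod.mono_neutral_cong_right) (auto simp: h_def)
    also have "\<dots> = ennreal (\<Prod>q\<in>J. exp (\<theta> * Re (u * wave d k (y q))))"
      by (simp add: prod_ennreal)
    also have "\<dots> = ennreal (exp (\<Sum>q\<in>J. \<theta> * Re (u * wave d k (y q))))"
      using finJ by (simp add: exp_sum)
    also have "(\<Sum>q\<in>J. \<theta> * Re (u * wave d k (y q))) = \<theta> * Re (u * (\<Sum>q\<in>J. wave d k (y q)))"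
      by (simp only: sum_distrib_left[symmetric] Re_sum[symmetric])
    finally show ?thesis .
  qed
  let ?A = "{y \<in> space ?P. Re (u * (\<Sum>q\<in>J. wave d k (y q))) \<ge> a}"
  have meas: "(\<lambda>y. \<Prod>q\<in>I. h q (y q)) \<in> borel_measurable ?P"
    using I by measurable
  have "emeasure ?P ?A \<le> emeasure ?P ({y \<in> space ?P. 1 \<le> ennreal (exp (- \<theta> * a)) * (\<Prod>q\<in>I. h q (y q))} \<inter> space ?P)"
  proof (rule emeasure_mono)
    show "?A \<subseteq> {y \<in> space ?P. 1 \<le> ennreal (exp (- \<theta> * a)) * (\<Prod>q\<in>I. h q (y q))} \<inter> space ?P"
      unfolding prod using \<theta> by (auto simp: ennreal_mult'[symmetric] mult_exp_exp)
  qed (use meas in measurable)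
  also have "\<dots> \<le> ennreal (exp (- \<theta> * a)) * (\<integral>\<^sup>+y. (\<Prod>q\<in>I. h q (y q)) * indicator (space ?P) y \<partial>?P)"
    using nn_integral_Markov_inequality[of "\<lambda>y. \<Prod>q\<in>I. h q (y q)" "space ?P" ?P "ennreal (exp (- \<theta> * a))"] meas
    by (simp add: Int_def conj_commute)
  also have "(\<integral>\<^sup>+y. (\<Prod>q\<in>I. h q (y q)) * indicator (space ?P) y \<partial>?P) = (\<integral>\<^sup>+y. (\<Prod>q\<in>I. h q (y q)) \<partial>?P)"
    by (rule nn_integral_cong) simp
  also have "\<dots> = (\<Prod>q\<in>I. \<integral>\<^sup>+x. h q x \<partial>cube d)"
    by (rule P.product_nn_integral_prod[OF I]) measurable
  finally have le: "emeasure ?P ?A \<le> ennreal (exp (- \<theta> * a)) * (\<Prod>q\<in>I. \<integral>\<^sup>+x. h q x \<partial>cube d)"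
    .
  have "(\<Prod>q\<in>I. \<integral>\<^sup>+x. h q x \<partial>cube d) \<le> (\<Prod>q\<in>I. if q \<in> J then ennreal (exp (\<theta>\<^sup>2 / 4)) else 1)"
  proof (rule prod_mono_ennreal)
    fix q assume "q \<in> I"
    show "(\<integral>\<^sup>+x. h q x \<partial>cube d) \<le> (if q \<in> J then ennreal (exp (\<theta>\<^sup>2 / 4)) else 1)"
      using exp_cos_moment[OF k u, of \<theta>] by (auto simp: h_def prob_space.emeasure_space_1[OF prob_space_cube])
  qed
  also have "\<dots> = (\<Prod>q\<in>J. ennreal (exp (\<theta>\<^sup>2 / 4)))"
    using I J by (intro prod.mono_neutral_cong_right) auto
  also have "\<dots> = ennreal (exp (?n * (\<theta>\<^sup>2 / 4)))"
    by (simp only: prod_constant ennreal_power[OF exp_ge_zero] exp_of_nat_mult)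
  finally have prod_le: "(\<Prod>q\<in>I. \<integral>\<^sup>+x. h q x \<partial>cube d) \<le> ennreal (exp (?n * (\<theta>\<^sup>2 / 4)))" .
  have "emeasure ?P ?A \<le> ennreal (exp (- \<theta> * a)) * ennreal (exp (?n * (\<theta>\<^sup>2 / 4)))"
    by (rule order_trans[OF le mult_left_mono[OF prod_le zero_le]])
  also have "\<dots> = ennreal (exp (- \<theta> * a) * exp (?n * (\<theta>\<^sup>2 / 4)))"
    by (rule ennreal_mult[symmetric]) auto
  also have "exp (- \<theta> * a) * exp (?n * (\<theta>\<^sup>2 / 4)) = exp (- a\<^sup>2 / ?n)"
    unfolding mult_exp_exp using n by (simp add: \<theta>_def field_simps power2_eq_square)
  finally show ?thesis
    unfolding measure_def by (simp add: enn2real_leI)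
qed

section \<open>Lower bounds for matrices\<close>

abbreviation l2norm :: "nat \<Rightarrow> (nat \<Rightarrow> complex) \<Rightarrow> real" where
  "l2norm n w \<equiv> L2_set (\<lambda>i. cmod (w i)) {..<n}"

lemma euclid_norm_eq_l2norm: "euclid_norm v = l2norm (dim_vec v) (\<lambda>i. v $ i)"
  by (simp add: euclid_norm_def L2_set_def)

lemma l2norm_cong: "(\<And>i. i < n \<Longrightarrow> v i = w i) \<Longrightarrow> l2norm n v = l2norm n w"
  by (intro L2_set_cong) auto

lemma norm_sum_mult_le_L2: "cmod (\<Sum>i\<in>A. a i * b i) \<le> L2_set (\<lambda>i. cmod (a i)) A * L2_set (\<lambda>i. cmod (b i)) A"
proof -
  have "cmod (\<Sum>i\<in>A. a i * b i) \<le> (\<Sum>i\<in>A. \<bar>cmod (a i)\<bar> * \<bar>cmod (b i)\<bar>)"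
    by (rule order_trans[OF norm_sum]) (simp add: norm_mult)
  also have "\<dots> \<le> L2_set (\<lambda>i. cmod (a i)) A * L2_set (\<lambda>i. cmod (b i)) A"
    by (rule L2_set_mult_ineq)
  finally show ?thesis .
qed

lemma sum_cnj_mult_self: "(\<Sum>i<n. cnj (w i) * w i) = complex_of_real ((l2norm n w)\<^sup>2)"
  by (simp add: L2_set_def sum_nonneg complex_norm_square mult.commute del: of_real_power)

text \<open>For \<open>c > 0\<close> this is invertibility of \<open>G\<close> together with the
  bound \<open>1 / c\<close> on the spectral norm of the inverse. In this form the condition
  refers to \<open>G\<close> alone and is closed, which makes it accessible to diagonal dominance
  and to measure theory.\<close>

definition expands :: "nat \<Rightarrow> real \<Rightarrow> (nat \<Rightarrow> nat \<Rightarrow> complex) \<Rightarrow> bool" where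
  "expands n c G \<longleftrightarrow> (\<forall>w. c * l2norm n w \<le> l2norm n (\<lambda>i. \<Sum>j<n. G i j * w j))"

lemma euclid_norm_mult_mat_vec_le:
  assumes A: "A \<in> carrier_mat n n" and v: "v \<in> carrier_vec n"
  shows "euclid_norm (A *\<^sub>v v) \<le> spectral_norm A * euclid_norm v"
proof (cases "euclid_norm v = 0")
  case True
  then have "v $ i = 0" if "i < n" for i
    using v that by (simp add: euclid_norm_def sum_nonneg_eq_0_iff)
  then have "A *\<^sub>v v = 0\<^sub>v n"
    using A v by (intro eq_vecI) (auto simp: scalar_prod_def)
  then show ?thesis using True by (simp add: euclid_norm_def)
next
  case False
  define c where "c = euclid_norm v"
  have c: "c > 0" using False by (simp add: c_def euclid_norm_def sum_nonneg order_less_le)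
  then have ci: "0 \<le> 1 / c" by simp
  let ?V = "{v \<in> carrier_vec (dim_col A). euclid_norm v \<le> 1}"
  have bdd: "bdd_above ((\<lambda>v. euclid_norm (A *\<^sub>v v)) ` ?V)"
  proof (rule bdd_aboveI2)
    fix w assume w: "w \<in> ?V"
    have w': "cmod (w $ j) \<le> 1" if "j < n" for j
    proof -
      have "cmod (w $ j) \<le> euclid_norm w"
        unfolding euclid_norm_eq_l2norm
        by (rule member_le_L2_set) (use w A that in auto)
      then show ?thesis using w by simp
    qed
    have "cmod ((A *\<^sub>v w) $ i) \<le> (\<Sum>j<n. cmod (A $$ (i, j)))" if "i < n" for i
    proof -
      have "cmod ((A *\<^sub>v w) $ i) = cmod (\<Sum>j<n. A $$ (i, j) * w $ j)"
        using A w that by (auto simp: scalar_prod_def atLeast0LessThan intro!: arg_cong[where f = cmod] sum.cong)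
      also have "\<dots> \<le> (\<Sum>j<n. cmod (A $$ (i, j)))"
        by (rule order_trans[OF norm_sum], rule sum_mono)
           (use w' in \<open>auto simp: norm_mult intro!: mult_left_le\<close>)
      finally show ?thesis .
    qed
    then show "euclid_norm (A *\<^sub>v w) \<le> L2_set (\<lambda>i. \<Sum>j<n. cmod (A $$ (i, j))) {..<n}"
      unfolding euclid_norm_eq_l2norm using A by (simp, intro L2_set_mono) auto
  qed
  have "complex_of_real (1 / c) \<cdot>\<^sub>v v \<in> ?V"
  proof -
    have "euclid_norm (complex_of_real (1 / c) \<cdot>\<^sub>v v) = (1 / c) * euclid_norm v"
      using c unfolding euclid_norm_eq_l2norm L2_set_right_distrib[OF ci]
      by (intro L2_set_cong) (auto simp: norm_mult norm_divide)
    then show ?thesis using A v c by (auto simp: c_def)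
  qed
  then have "euclid_norm (A *\<^sub>v (complex_of_real (1 / c) \<cdot>\<^sub>v v)) \<le> spectral_norm A"
    unfolding spectral_norm_def by (intro cSUP_upper bdd)
  moreover have "euclid_norm (A *\<^sub>v (complex_of_real (1 / c) \<cdot>\<^sub>v v)) = (1 / c) * euclid_norm (A *\<^sub>v v)"
    using A v c unfolding euclid_norm_eq_l2norm L2_set_right_distrib[OF ci]
    by (intro L2_set_cong) (auto simp: norm_mult norm_divide mult_mat_vec)
  ultimately have "1 / c * euclid_norm (A *\<^sub>v v) \<le> spectral_norm A" by simp
  then show ?thesis
    using c unfolding c_def[symmetric] by (simp add: divide_le_eq)
qed

lemma mat_inverse_unique:
  assumes A: "A \<in> carrier_mat n n" and B: "B \<in> carrier_mat n n" and AB: "A * B = 1\<^sub>m n"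
  shows "the (mat_inverse A) = (B :: 'a :: field mat)"
proof -
  have "det A * det B = 1"
    using AB det_mult[OF A B] by simp
  then have "det A \<noteq> 0" by auto
  then have U: "A \<in> Units (ring_mat TYPE('a) n ())"
    by (rule det_non_zero_imp_unit[OF A])
  then obtain C where C: "mat_inverse A = Some C"
    using mat_inverse(1)[OF A, where b = "()"] by blast
  from mat_inverse(2)[OF A C] have CA: "C * A = 1\<^sub>m n" and C': "C \<in> carrier_mat n n" by auto
  have "C = C * (A * B)" using AB C' by simp
  also have "\<dots> = C * A * B" using A B C' by (simp add: assoc_mult_mat)
  also have "\<dots> = B" using CA B by simp
  finally show ?thesis using C by simp
qed

lemma euclid_norm_mult_mat_vec:
  assumes "A \<in> carrier_mat n n" "v \<in> carrier_vec n"
  shows "euclid_norm (A *\<^sub>v v) = l2norm n (\<lambda>i. \<Sum>j<n. A $$ (i, j) * v $ j)"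
  using assms by (auto simp: euclid_norm_eq_l2norm scalar_prod_def atLeast0LessThan intro!: L2_set_cong)

text \<open>Substitute \<open>A v\<close> for the argument of the inverse in one direction, and
  the inverse applied to \<open>v\<close> for the vector in the other; an expanding matrix is
  injective, hence invertible.\<close>

lemma spectral_norm_inverse_le_iff:
  fixes A :: "complex Matrix.mat"
  assumes A: "A \<in> carrier_mat n n" and c: "c > 0"
  shows "invertible_mat A \<and> spectral_norm (the (mat_inverse A)) \<le> 1 / c \<longleftrightarrow>
    expands n c (\<lambda>i j. A $$ (i, j))"
proof
  assume asm: "invertible_mat A \<and> spectral_norm (the (mat_inverse A)) \<le> 1 / c"
  then obtain B where "A * B = 1\<^sub>m n" "B * A = 1\<^sub>m (dim_row B)"
    using A by (auto simp: invertible_mat_def inverts_mat_def)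
  moreover from this have B: "B \<in> carrier_mat n n"
    using A by (metis carrier_matI carrier_matD index_mult_mat(2,3) index_one_mat(2,3))
  ultimately have BA: "B * A = 1\<^sub>m n" and inv: "the (mat_inverse A) = B"
    using mat_inverse_unique[OF A B] by auto
  show "expands n c (\<lambda>i j. A $$ (i, j))"
    unfolding expands_def
  proof
    fix w :: "nat \<Rightarrow> complex"
    define v where "v = Matrix.vec n w"
    have v: "v \<in> carrier_vec n" by (simp add: v_def)
    have Av: "A *\<^sub>v v \<in> carrier_vec n" using A v by simp
    have "l2norm n w = euclid_norm v" by (auto simp: v_def euclid_norm_eq_l2norm intro!: L2_set_cong)
    also have "v = B *\<^sub>v (A *\<^sub>v v)"
      using A B v BA by (metis assoc_mult_mat_vec one_mult_mat_vec)
    also have "euclid_norm (B *\<^sub>v (A *\<^sub>v v)) \<le> spectral_norm B * euclid_norm (A *\<^sub>v v)"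
      by (rule euclid_norm_mult_mat_vec_le[OF B Av])
    also have "\<dots> \<le> 1 / c * euclid_norm (A *\<^sub>v v)"
      using asm inv by (intro mult_right_mono) (auto simp: euclid_norm_def sum_nonneg)
    also have "euclid_norm (A *\<^sub>v v) = l2norm n (\<lambda>i. \<Sum>j<n. A $$ (i, j) * w j)"
      using euclid_norm_mult_mat_vec[OF A v] by (simp add: v_def)
    finally show "c * l2norm n w \<le> l2norm n (\<lambda>i. \<Sum>j<n. A $$ (i, j) * w j)"
      using c by (simp add: field_simps)
  qed
next
  assume ex: "expands n c (\<lambda>i j. A $$ (i, j))"
  have lower: "c * euclid_norm v \<le> euclid_norm (A *\<^sub>v v)" if "v \<in> carrier_vec n" for v
    using ex that unfolding expands_def euclid_norm_mult_mat_vec[OF A that]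
    by (auto simp: euclid_norm_eq_l2norm)
  have "det A \<noteq> 0"
  proof
    assume "det A = 0"
    then obtain v where v: "v \<in> carrier_vec n" "v \<noteq> 0\<^sub>v n" "A *\<^sub>v v = 0\<^sub>v n"
      using det_0_iff_vec_prod_zero_field[OF A] by blast
    have "c * euclid_norm v \<le> 0" using lower[OF v(1)] v(3) by (simp add: euclid_norm_def)
    then have "euclid_norm v \<le> 0" using c by (simp add: mult_le_0_iff)
    moreover have "euclid_norm v \<ge> 0" by (simp add: euclid_norm_def sum_nonneg)
    ultimately have "euclid_norm v = 0" by simp
    then have "\<forall>i<n. v $ i = 0"
      using v(1) by (auto simp: euclid_norm_def sum_nonneg_eq_0_iff)
    with v show False by (metis carrier_vecD eq_vecI index_zero_vec)
  qed
  then have "A \<in> Units (ring_mat TYPE(complex) n ())"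
    by (rule det_non_zero_imp_unit[OF A])
  then obtain B where inv: "mat_inverse A = Some B"
    using mat_inverse(1)[OF A, where b = "()"] by blast
  from mat_inverse(2)[OF A this] have B: "A * B = 1\<^sub>m n" "B * A = 1\<^sub>m n" "B \<in> carrier_mat n n" by auto
  have "invertible_mat A"
    using A B by (auto simp: invertible_mat_def inverts_mat_def)
  moreover have "spectral_norm B \<le> 1 / c"
    unfolding spectral_norm_def
  proof (rule cSUP_least)
    have "0\<^sub>v n \<in> {v \<in> carrier_vec (dim_col B). euclid_norm v \<le> 1}"
      using B by (simp add: euclid_norm_def)
    then show "{v \<in> carrier_vec (dim_col B). euclid_norm v \<le> 1} \<noteq> {}" by blast
    fix v assume v: "v \<in> {v \<in> carrier_vec (dim_col B). euclid_norm v \<le> 1}"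
    then have Bv: "B *\<^sub>v v \<in> carrier_vec n" "v \<in> carrier_vec n" using B by auto
    have "c * euclid_norm (B *\<^sub>v v) \<le> euclid_norm (A *\<^sub>v (B *\<^sub>v v))"
      by (rule lower[OF Bv(1)])
    also have "A *\<^sub>v (B *\<^sub>v v) = v"
      using A B Bv by (metis assoc_mult_mat_vec one_mult_mat_vec)
    finally have "c * euclid_norm (B *\<^sub>v v) \<le> 1" using v by simp
    then show "euclid_norm (B *\<^sub>v v) \<le> 1 / c" using c by (simp add: field_simps)
  qed
  ultimately show "invertible_mat A \<and> spectral_norm (the (mat_inverse A)) \<le> 1 / c"
    using inv by simp
qed

text \<open>The quadratic form of \<open>G\<close> at \<open>w\<close> is at least \<open>n c
  |w|\<^sup>2 - c ((\<Sum>i. |w i|)\<^sup>2 - |w|\<^sup>2)\<close>, and \<open>(\<Sum>i. |w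
  i|)\<^sup>2 \<le> n |w|\<^sup>2\<close>.\<close>

lemma expands_if_small_off_diagonal:
  assumes c: "c \<ge> 0" and diag: "\<And>i. i < n \<Longrightarrow> G i i = complex_of_real (real n * c)"
    and off: "\<And>i j. i < n \<Longrightarrow> j < n \<Longrightarrow> i \<noteq> j \<Longrightarrow> cmod (G i j) \<le> c"
  shows "expands n c G"
  unfolding expands_def
proof
  fix w :: "nat \<Rightarrow> complex"
  let ?W = "l2norm n w" and ?Gw = "\<lambda>i. \<Sum>j<n. G i j * w j"
  define E where "E = (\<Sum>i<n. \<Sum>j\<in>{..<n} - {i}. cnj (w i) * (G i j * w j))"
  have "(\<Sum>i<n. cnj (w i) * ?Gw i) =
      (\<Sum>i<n. complex_of_real (real n * c) * (cnj (w i) * w i)) + E"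
    unfolding E_def sum.distrib[symmetric]
  proof (intro sum.cong refl)
    fix i assume i: "i \<in> {..<n}"
    have "?Gw i = G i i * w i + (\<Sum>j\<in>{..<n} - {i}. G i j * w j)"
      by (rule sum.remove) (use i in auto)
    then show "cnj (w i) * ?Gw i = complex_of_real (real n * c) * (cnj (w i) * w i) +
        (\<Sum>j\<in>{..<n} - {i}. cnj (w i) * (G i j * w j))"
      using i diag by (simp add: algebra_simps sum_distrib_left)
  qed
  also have "(\<Sum>i<n. complex_of_real (real n * c) * (cnj (w i) * w i)) = complex_of_real (real n * c * ?W\<^sup>2)"
    by (simp only: sum_distrib_left[symmetric] sum_cnj_mult_self of_real_mult)
  finally have eq: "(\<Sum>i<n. cnj (w i) * ?Gw i) = complex_of_real (real n * c * ?W\<^sup>2) + E" .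
  have "cmod E \<le> (\<Sum>i<n. \<Sum>j\<in>{..<n} - {i}. c * (cmod (w i) * cmod (w j)))"
    unfolding E_def
  proof (intro sum_norm_le)
    fix i j assume "i \<in> {..<n}" "j \<in> {..<n} - {i}"
    then have "cmod (G i j) * (cmod (w i) * cmod (w j)) \<le> c * (cmod (w i) * cmod (w j))"
      using off by (intro mult_right_mono) auto
    then show "cmod (cnj (w i) * (G i j * w j)) \<le> c * (cmod (w i) * cmod (w j))"
      by (simp add: norm_mult mult_ac)
  qed
  also have "\<dots> = (\<Sum>i<n. (\<Sum>j<n. c * (cmod (w i) * cmod (w j))) - c * (cmod (w i))\<^sup>2)"
    by (intro sum.cong refl) (simp add: sum_diff1 power2_eq_square)
  also have "\<dots> = c * ((\<Sum>i<n. cmod (w i))\<^sup>2 - ?W\<^sup>2)"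
    by (simp add: sum_subtractf sum_distrib_left[symmetric] power2_eq_square[of "sum _ _"]
        sum_product L2_set_def sum_nonneg right_diff_distrib)
  also have "\<dots> \<le> c * (real n * ?W\<^sup>2 - ?W\<^sup>2)"
  proof (intro mult_left_mono diff_right_mono c)
    have "(\<Sum>i<n. cmod (w i))\<^sup>2 \<le> (\<Sum>i<n. (cmod (w i))\<^sup>2) * (\<Sum>i<n. 1\<^sup>2)"
      using Cauchy_Schwarz_ineq_sum[of "\<lambda>i. cmod (w i)" "\<lambda>_. 1" "{..<n}"] by simp
    then show "(\<Sum>i<n. cmod (w i))\<^sup>2 \<le> real n * ?W\<^sup>2"
      by (simp add: L2_set_def sum_nonneg mult.commute)
  qed
  finally have "cmod E \<le> c * (real n * ?W\<^sup>2 - ?W\<^sup>2)" .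
  moreover have "real n * c * ?W\<^sup>2 - cmod E \<le> cmod (complex_of_real (real n * c * ?W\<^sup>2) + E)"
  proof -
    have "cmod (complex_of_real (real n * c * ?W\<^sup>2)) = real n * c * ?W\<^sup>2"
      unfolding norm_of_real using c by (intro abs_of_nonneg) (auto intro!: mult_nonneg_nonneg)
    then show ?thesis
      using norm_diff_ineq[of "complex_of_real (real n * c * ?W\<^sup>2)" E] by linarith
  qed
  moreover have "cmod (\<Sum>i<n. cnj (w i) * ?Gw i) \<le> ?W * l2norm n ?Gw"
    using norm_sum_mult_le_L2[of "\<lambda>i. cnj (w i)" ?Gw "{..<n}"] by simp
  ultimately have "c * ?W\<^sup>2 \<le> ?W * l2norm n ?Gw"
    unfolding eq by (simp add: algebra_simps)
  then have "?W * (c * ?W) \<le> ?W * l2norm n ?Gw"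
    by (simp add: power2_eq_square mult_ac)
  then show "c * ?W \<le> l2norm n ?Gw"
    using L2_set_nonneg[of "\<lambda>i. cmod (w i)" "{..<n}"] 
    by (cases "?W = 0") (auto simp: mult_le_cancel_left)
qed

text \<open>Stability of least squares: with \<open>G = B\<^sup>H B\<close> and \<open>G u =
  B\<^sup>H \<eta>\<close>, solve \<open>G w = u\<close>. Then \<open>|u|\<^sup>2 = \<langle>G u,
  w\<rangle> = \<langle>\<eta>, B w\<rangle>\<close> and \<open>|B w|\<^sup>2 = \<langle>w, G
  w\<rangle> = \<langle>w, u\<rangle> \<le> |u|\<^sup>2 / c\<close>. This gains a square root over
  the trivial bound \<open>|u| \<le> |B\<^sup>H \<eta>| / c\<close>.\<close>

lemma least_squares_stability:
  fixes B :: "nat \<Rightarrow> nat \<Rightarrow> complex" and p :: nat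
  defines "G \<equiv> \<lambda>i j. \<Sum>q<p. cnj (B q i) * B q j"
  assumes ex: "expands n c G" and c: "c > 0"
    and w: "\<And>i. i < n \<Longrightarrow> (\<Sum>j<n. G i j * w j) = u i"
    and u: "\<And>i. i < n \<Longrightarrow> (\<Sum>j<n. G i j * u j) = (\<Sum>q<p. cnj (B q i) * \<eta> q)"
  shows "c * (\<Sum>i<n. (cmod (u i))\<^sup>2) \<le> (\<Sum>q<p. (cmod (\<eta> q))\<^sup>2)"
proof -
  let ?U = "l2norm n u" and ?H = "l2norm p \<eta>"
  define b where "b = (\<lambda>q. \<Sum>j<n. B q j * w j)"
  let ?b = "l2norm p b"
  have Gh: "cnj (G i j) = G j i" for i j
    by (simp add: G_def mult.commute)
  have "?b\<^sup>2 \<le> l2norm n w * ?U"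
  proof -
    have "complex_of_real (?b\<^sup>2) = (\<Sum>q<p. \<Sum>i<n. \<Sum>j<n. cnj (w i) * (cnj (B q i) * B q j * w j))"
      unfolding sum_cnj_mult_self[symmetric] b_def cnj_sum sum_product by (simp add: mult_ac)
    also have "\<dots> = (\<Sum>i<n. \<Sum>j<n. \<Sum>q<p. cnj (w i) * (cnj (B q i) * B q j * w j))"
      by (subst sum.swap, subst sum.swap) (rule refl)
    also have "\<dots> = (\<Sum>i<n. cnj (w i) * (\<Sum>j<n. G i j * w j))"
      by (simp add: G_def sum_distrib_left sum_distrib_right)
    also have "\<dots> = (\<Sum>i<n. cnj (w i) * u i)"
      using w by simp
    finally have "?b\<^sup>2 = cmod (\<Sum>i<n. cnj (w i) * u i)"
      by (metis abs_power2 norm_of_real)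
    also have "\<dots> \<le> l2norm n w * ?U"
      using norm_sum_mult_le_L2[of "\<lambda>i. cnj (w i)" u "{..<n}"] by simp
    finally show ?thesis .
  qed
  also have "l2norm n w \<le> ?U / c"
  proof -
    have "c * l2norm n w \<le> l2norm n (\<lambda>i. \<Sum>j<n. G i j * w j)"
      using ex by (simp add: expands_def)
    also have "\<dots> = ?U" using w by (intro l2norm_cong) auto
    finally show ?thesis using c by (simp add: field_simps)
  qed
  finally have b: "?b\<^sup>2 \<le> ?U\<^sup>2 / c"
    by (simp add: power2_eq_square mult_right_mono)
  have "complex_of_real (?U\<^sup>2) = (\<Sum>i<n. cnj (u i) * (\<Sum>j<n. G i j * w j))"
    unfolding sum_cnj_mult_self[symmetric] using w by simp
  also have "\<dots> = (\<Sum>j<n. cnj (\<Sum>i<n. G j i * u i) * w j)"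
    unfolding sum_distrib_left cnj_sum sum_distrib_right
    by (subst sum.swap) (simp add: Gh mult_ac)
  also have "\<dots> = (\<Sum>j<n. cnj (\<Sum>q<p. cnj (B q j) * \<eta> q) * w j)"
    using u by simp
  also have "\<dots> = (\<Sum>j<n. \<Sum>q<p. cnj (\<eta> q) * (B q j * w j))"
    unfolding cnj_sum sum_distrib_right by (intro sum.cong refl) (simp add: mult_ac)
  also have "\<dots> = (\<Sum>q<p. cnj (\<eta> q) * b q)"
    unfolding b_def sum_distrib_left by (rule sum.swap)
  finally have "?U\<^sup>2 = cmod (\<Sum>q<p. cnj (\<eta> q) * b q)"
    by (metis abs_power2 norm_of_real)
  also have "\<dots> \<le> ?H * ?b"
    using norm_sum_mult_le_L2[of "\<lambda>q. cnj (\<eta> q)" b "{..<p}"] by simp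
  finally have "(?U\<^sup>2)\<^sup>2 \<le> (?H * ?b)\<^sup>2" by (intro power_mono) auto
  also have "\<dots> \<le> ?H\<^sup>2 * (?U\<^sup>2 / c)"
    unfolding power_mult_distrib using b by (intro mult_left_mono) auto
  finally have "?U\<^sup>2 * (c * ?U\<^sup>2) \<le> ?U\<^sup>2 * ?H\<^sup>2"
    using c by (simp add: field_simps power2_eq_square)
  then have "c * ?U\<^sup>2 \<le> ?H\<^sup>2"
    by (cases "?U = 0") (auto simp: mult_le_cancel_left)
  then show ?thesis by (simp add: L2_set_def sum_nonneg)
qed

text \<open>For the measurability of the event that the shifts are good: continuity in the vector
  allows testing \<open>expands\<close> on a countable dense set only.\<close>

lemma pred_expands:
  assumes [measurable]: "\<And>i j. i < n \<Longrightarrow> j < n \<Longrightarrow> (\<lambda>y. G y i j) \<in> borel_measurable M"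
  shows "Measurable.pred M (\<lambda>y. expands n c (G y))"
proof -
  obtain D :: "complex set" where D: "countable D" "\<And>X. open X \<Longrightarrow> X \<noteq> {} \<Longrightarrow> \<exists>d\<in>D. d \<in> X"
    using countable_dense_exists by blast
  let ?P = "\<lambda>y w. c * l2norm n w \<le> l2norm n (\<lambda>i. \<Sum>j<n. G y i j * w j)"
  have "expands n c (G y) \<longleftrightarrow> (\<forall>w\<in>({..<n} \<rightarrow>\<^sub>E D). ?P y w)" for y
  proof
    assume ae: "\<forall>w\<in>({..<n} \<rightarrow>\<^sub>E D). ?P y w"
    have "?P y w" for w
    proof -
      have "\<exists>x\<in>D. dist x z < inverse (real (Suc m))" for z m
        using D(2)[of "ball z (inverse (real (Suc m)))"] by (auto simp: dist_commute)
      then obtain a where a: "\<And>z m. a z m \<in> D" "\<And>z m. dist (a z m) z < inverse (real (Suc m))"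
        by metis
      have lim: "a z \<longlonglongrightarrow> z" for z
      proof (rule metric_LIMSEQ_I)
        fix r :: real assume "r > 0"
        then obtain m0 where "inverse (real (Suc m0)) < r" using reals_Archimedean by blast
        then have "dist (a z m) z < r" if "m \<ge> m0" for m
          using a(2)[of z m] that by (smt (verit, best) inverse_le_iff_le of_nat_0_less_iff of_nat_le_iff zero_less_Suc Suc_le_mono)
        then show "\<exists>m0. \<forall>m\<ge>m0. dist (a z m) z < r" by blast
      qed
      define v where "v = (\<lambda>m. \<lambda>i\<in>{..<n}. a (w i) m)"
      have v: "(\<lambda>m. v m i) \<longlonglongrightarrow> w i" if "i < n" for i
        using lim that by (simp add: v_def)
      have "v m \<in> ({..<n} \<rightarrow>\<^sub>E D)" for m
        using a(1) by (auto simp: v_def)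
      then have P: "?P y (v m)" for m using ae by blast
      have "(\<lambda>m. c * l2norm n (v m)) \<longlonglongrightarrow> c * l2norm n w"
        unfolding L2_set_def by (intro tendsto_intros v) auto
      moreover have "(\<lambda>m. l2norm n (\<lambda>i. \<Sum>j<n. G y i j * v m j)) \<longlonglongrightarrow> l2norm n (\<lambda>i. \<Sum>j<n. G y i j * w j)"
        unfolding L2_set_def by (intro tendsto_intros v) auto
      ultimately show ?thesis
        by (rule LIMSEQ_le) (use P in blast)
    qed
    then show "expands n c (G y)" by (simp add: expands_def)
  qed (simp add: expands_def)
  moreover have "Measurable.pred M (\<lambda>y. \<forall>w\<in>({..<n} \<rightarrow>\<^sub>E D). ?P y w)"
  proof -
    let ?W = "{..<n} \<rightarrow>\<^sub>E D"
    have "countable ?W" by (intro countable_PiE D) auto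
    moreover have "D \<noteq> {}" using D(2)[of UNIV] by auto
    then have "?W \<noteq> {}" by (simp add: PiE_eq_empty_iff)
    moreover have "{y \<in> space M. ?P y w} \<in> sets M" for w
      unfolding L2_set_def by measurable
    ultimately have "(\<Inter>w\<in>?W. {y \<in> space M. ?P y w}) \<in> sets M"
      by (intro sets.countable_INT') auto
    also have "(\<Inter>w\<in>?W. {y \<in> space M. ?P y w}) = {y \<in> space M. \<forall>w\<in>?W. ?P y w}"
      using \<open>?W \<noteq> {}\<close> by auto
    finally show ?thesis by (simp add: pred_def)
  qed
  ultimately show ?thesis by simp
qed

section \<open>Random shifts are good with high probability\<close>

lemma B_mat_carrier: "B_mat d S y F \<in> carrier_mat (length F * S) (length F)"
  by (simp add: B_mat_def)

lemma B_mat_index: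
  "q < length F * S \<Longrightarrow> i < length F \<Longrightarrow>
    B_mat d S y F $$ (q, i) = wave d (F ! i) (y (q div S, q mod S))"
  by (simp add: B_mat_def)

lemma mat_adjoint_carrier: "A \<in> carrier_mat m n \<Longrightarrow> mat_adjoint A \<in> carrier_mat n m"
  by (auto simp: mat_adjoint_def mat_of_rows_def)

lemma mat_adjoint_index:
  fixes A :: "complex Matrix.mat"
  shows "A \<in> carrier_mat m n \<Longrightarrow> i < n \<Longrightarrow> j < m \<Longrightarrow> mat_adjoint A $$ (i, j) = cnj (A $$ (j, i))"
  by (auto simp: mat_adjoint_def mat_of_rows_def)

lemma gram_mat_carrier: "gram_mat d S y F \<in> carrier_mat (length F) (length F)"
  unfolding gram_mat_def using mult_carrier_mat[OF mat_adjoint_carrier[OF B_mat_carrier] B_mat_carrier] .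

lemma gram_mat_index:
  assumes "i < length F" "j < length F"
  shows "gram_mat d S y F $$ (i, j) =
    (\<Sum>q<length F * S. cnj (B_mat d S y F $$ (q, i)) * B_mat d S y F $$ (q, j))"
proof -
  note [simp] = mat_adjoint_index[OF B_mat_carrier]
  have "dim_row (mat_adjoint (B_mat d S y F)) = length F" "dim_col (mat_adjoint (B_mat d S y F)) = length F * S"
    using mat_adjoint_carrier[OF B_mat_carrier, of d S y F] by auto
  then show ?thesis
    using assms B_mat_carrier[of d S y F]
    by (auto simp: gram_mat_def scalar_prod_def atLeast0LessThan intro!: sum.cong)
qed

lemma bij_betw_div_mod:
  fixes S n :: nat
  assumes "S > 0"
  shows "bij_betw (\<lambda>q. (q div S, q mod S)) {..<n * S} ({..<n} \<times> {..<S})"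
proof (rule bij_betw_byWitness[where f' = "\<lambda>(m, s). m * S + s"])
  show "(\<lambda>(m, s). m * S + s) ` ({..<n} \<times> {..<S}) \<subseteq> {..<n * S}"
  proof clarsimp
    fix m s assume "m < n" "s < S"
    then have "m * S + s < Suc m * S" by simp
    also have "\<dots> \<le> n * S" using \<open>m < n\<close> by (intro mult_right_mono) auto
    finally show "m * S + s < n * S" .
  qed
qed (use assms in \<open>auto simp: less_mult_imp_div_less\<close>)

lemma gram_mat_index':
  assumes "i < length F" "j < length F" "S > 0"
  shows "gram_mat d S y F $$ (i, j) =
    (\<Sum>q\<in>{..<length F} \<times> {..<S}. wave d (\<lambda>k. (F ! j) k - (F ! i) k) (y q))"
proof -
  have "gram_mat d S y F $$ (i, j) = (\<Sum>q<length F * S.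
      wave d (\<lambda>k. (F ! j) k - (F ! i) k) (y (q div S, q mod S)))"
    using assms
    by (auto simp: gram_mat_index B_mat_index cnj_expi2 real_dot_diff_left expi2_diff mult.commute intro!: sum.cong)
  then show ?thesis
    using sum.reindex_bij_betw[OF bij_betw_div_mod[OF assms(3), of "length F"],
        of "\<lambda>q. wave d (\<lambda>k. (F ! j) k - (F ! i) k) (y q)"]
    by simp
qed

abbreviation gram_expands where
  "gram_expands d S y F \<equiv> expands (length F) (real S) (\<lambda>i j. gram_mat d S y F $$ (i, j))"

lemma good_shifts_iff:
  assumes "S > 0"
  shows "good_shifts d S Fs y \<longleftrightarrow> (\<forall>F\<in>set Fs. gram_expands d S y F)"
  unfolding good_shifts_def
  using spectral_norm_inverse_le_iff[OF gram_mat_carrier, of "real S" d S y] assms by auto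

lemma prob_space_shift_law: "prob_space (shift_law d R S)"
  unfolding shift_law_def by (intro prob_space_PiM prob_space_cube)

lemma measurable_gram_mat:
  assumes "S > 0" "length F \<le> R" "i < length F" "j < length F"
  shows "(\<lambda>y. gram_mat d S y F $$ (i, j)) \<in> borel_measurable (shift_law d R S)"
proof -
  have "(\<lambda>y. wave d k (y q)) \<in> borel_measurable (shift_law d R S)"
    if "q \<in> {..<length F} \<times> {..<S}" for k q
  proof -
    have "(\<lambda>y. y q) \<in> measurable (shift_law d R S) (cube d)"
      unfolding shift_law_def using that assms(2) by (intro measurable_component_singleton) auto
    then show ?thesis
      by (rule measurable_compose) (rule measurable_expi2_real_dot)
  qed
  then show ?thesis
    unfolding gram_mat_index'[OF assms(3,4,1)] by (intro borel_measurable_sum)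
qed

lemma sets_gram_expands:
  assumes "S > 0" "length F \<le> R"
  shows "{y \<in> space (shift_law d R S). gram_expands d S y F} \<in> sets (shift_law d R S)"
  using pred_expands[of "length F" "\<lambda>y i j. gram_mat d S y F $$ (i, j)" "shift_law d R S" "real S"]
    measurable_gram_mat[OF assms]
  by (simp add: pred_def)

lemma exists_direction:
  assumes "cmod z > a" "a > 0"
  shows "\<exists>u\<in>{1, - 1, \<i>, - \<i>}. Re (u * z) \<ge> a / sqrt 2"
proof (rule ccontr)
  assume "\<not> ?thesis"
  then have "\<bar>Re z\<bar> \<le> a / sqrt 2" "\<bar>Im z\<bar> \<le> a / sqrt 2" by auto
  then have "(Re z)\<^sup>2 \<le> (a / sqrt 2)\<^sup>2" "(Im z)\<^sup>2 \<le> (a / sqrt 2)\<^sup>2"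
    using assms(2) by (auto simp: power2_le_iff_abs_le)
  then have "(cmod z)\<^sup>2 \<le> a\<^sup>2"
    by (simp add: cmod_power2 power_divide)
  then show False using assms by (simp add: power2_le_iff_abs_le)
qed

text \<open>By diagonal dominance the condition can only fail if an entry above the diagonal
  exceeds \<open>S\<close> in modulus. Such an entry is a sum of \<open>S * length F\<close>
  independent points uniformly distributed on the unit circle, and one of its projections to the
  four coordinate directions then is at least \<open>S / sqrt 2\<close>.\<close>

lemma prob_not_gram_expands:
  assumes S: "S > 0" and F: "distinct F" "set F \<subseteq> int_vecs d" "length F \<le> R"
  shows "measure (shift_law d R S) {y \<in> space (shift_law d R S). \<not> gram_expands d S y F}
    \<le> 2 * (real (length F))\<^sup>2 * exp (- real S / (2 * real (length F)))"
proof -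
  let ?P = "shift_law d R S" and ?v = "length F"
  interpret prob_space ?P by (rule prob_space_shift_law)
  define T where "T = (SIGMA j:{..<?v}. {..<j}) \<times> {1, - 1, \<i>, - \<i> :: complex}"
  define A where "A = (\<lambda>((j, i), u). {y \<in> space ?P. Re (u * gram_mat d S y F $$ (i, j)) \<ge> real S / sqrt 2})"
  have A: "A t \<in> sets ?P \<and> measure ?P (A t) \<le> exp (- real S / (2 * real ?v))" if tT: "t \<in> T" for t
  proof -
    obtain i j u where t: "t = ((j, i), u)" and ij: "i < j" "j < ?v" and "u \<in> {1, - 1, \<i>, - \<i>}"
      using tT unfolding T_def by blast
    then have u: "cmod u = 1" by auto
    define k where "k = (\<lambda>l\<in>{..<d}. (F ! j) l - (F ! i) l)"
    have dot: "real_dot d (\<lambda>l. (F ! j) l - (F ! i) l) x = real_dot d k x" for x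
      by (simp add: real_dot_def k_def)
    have k: "k \<in> int_vecs d" by (simp add: k_def int_vecs_def)
    have "k \<noteq> zero_vec d"
    proof
      assume k0: "k = zero_vec d"
      have "F ! j = F ! i"
      proof (rule int_vecs_eqI)
        show "F ! j \<in> int_vecs d" "F ! i \<in> int_vecs d" using F ij by auto
        show "(F ! j) l = (F ! i) l" if "l < d" for l
          using fun_cong[OF k0, of l] that by (simp add: k_def zero_vec_def)
      qed
      then show False using F ij by (simp add: nth_eq_iff_index_eq)
    qed
    have gram: "gram_mat d S y F $$ (i, j) = (\<Sum>q\<in>{..<?v} \<times> {..<S}. wave d k (y q))" for y
      using ij by (simp add: gram_mat_index' S dot)
    have [measurable]: "(\<lambda>y. gram_mat d S y F $$ (i, j)) \<in> borel_measurable ?P"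
      by (rule measurable_gram_mat) (use S F ij in auto)
    have "A t \<in> sets ?P" unfolding t A_def prod.case by measurable
    moreover have "measure ?P (A t) \<le> exp (- (real S / sqrt 2)\<^sup>2 / real (card ({..<?v} \<times> {..<S})))"
      unfolding t A_def prod.case gram shift_law_def
      by (rule sum_expi2_tail) (use S F ij k \<open>k \<noteq> zero_vec d\<close> u in auto)
    moreover have "- (real S / sqrt 2)\<^sup>2 / real (card ({..<?v} \<times> {..<S})) = - real S / (2 * real ?v)"
      using S ij by (simp add: power_divide card_cartesian_product power2_eq_square field_simps)
    ultimately show ?thesis by simp
  qed
  have fin: "finite T" by (simp add: T_def)
  have sub: "{y \<in> space ?P. \<not> gram_expands d S y F} \<subseteq> (\<Union>t\<in>T. A t)"
  proof clarify
    fix y assume y: "y \<in> space ?P" and n: "\<not> gram_expands d S y F"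
    have "gram_expands d S y F" if le: "\<And>i j. i < j \<Longrightarrow> j < ?v \<Longrightarrow> cmod (gram_mat d S y F $$ (i, j)) \<le> real S"
    proof (rule expands_if_small_off_diagonal)
      show "gram_mat d S y F $$ (i, i) = complex_of_real (real ?v * real S)" if "i < ?v" for i
        using that by (simp add: gram_mat_index' S card_cartesian_product real_dot_def)
      show "cmod (gram_mat d S y F $$ (i, j)) \<le> real S" if ij: "i < ?v" "j < ?v" "i \<noteq> j" for i j
      proof (cases "i < j")
        case False
        have "gram_mat d S y F $$ (i, j) = cnj (gram_mat d S y F $$ (j, i))"
          using ij by (simp add: gram_mat_index mult.commute)
        then show ?thesis using le[of j i] ij False by simp
      qed (use le ij in auto)
    qed simp
    then obtain i j where ij: "i < j" "j < ?v" "cmod (gram_mat d S y F $$ (i, j)) > real S"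
      using n by (meson not_le)
    then obtain u where "u \<in> {1, - 1, \<i>, - \<i>}" "Re (u * gram_mat d S y F $$ (i, j)) \<ge> real S / sqrt 2"
      using exists_direction[of "real S"] S by (metis of_nat_0_less_iff)
    then show "y \<in> (\<Union>t\<in>T. A t)"
      using y ij by (intro UN_I[of "((j, i), u)"]) (auto simp: T_def A_def)
  qed
  have "measure ?P {y \<in> space ?P. \<not> gram_expands d S y F} \<le> measure ?P (\<Union>t\<in>T. A t)"
    by (rule finite_measure_mono[OF sub]) (use A fin in auto)
  also have "\<dots> \<le> (\<Sum>t\<in>T. measure ?P (A t))"
    by (rule finite_measure_subadditive_finite) (use A fin in auto)
  also have "\<dots> \<le> real (card T) * exp (- real S / (2 * real ?v))"
    by (rule sum_bounded_above) (use A in auto)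
  also have "real (card T) \<le> 2 * (real ?v)\<^sup>2"
  proof -
    have "card {1, - 1, \<i>, - \<i>} = 4" by (simp add: complex_eq_iff)
    moreover have "2 * (\<Sum>j<n. j) \<le> n\<^sup>2" for n :: nat
      by (induction n) (auto simp: power2_eq_square)
    ultimately have "card T \<le> 2 * ?v\<^sup>2"
      by (simp add: T_def card_cartesian_product card_SigmaI)
    then have "real (card T) \<le> real (2 * ?v\<^sup>2)" by (rule of_nat_mono)
    then show ?thesis by simp
  qed
  finally show ?thesis by (simp add: mult_right_mono)
qed

lemma sets_good_shifts:
  assumes "S > 0" "\<And>F. F \<in> set Fs \<Longrightarrow> length F \<le> R"
  shows "{y \<in> space (shift_law d R S). good_shifts d S Fs y} \<in> sets (shift_law d R S)"
  unfolding good_shifts_iff[OF assms(1)]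
  by (intro sets.sets_Collect_finite_All sets_gram_expands assms) auto

text \<open>The choice of \<open>S\<close> makes the exponential in
  \<open>prob_not_gram_expands\<close> at most \<open>N powr (- K)\<close> for every fiber of
  length at most \<open>R\<close>; a union bound over the fibers follows.\<close>

lemma prob_good_shifts:
  assumes S: "S > 0" "real S \<ge> 2 * K * real R * ln (real N)" and K: "K > 0" and N: "N \<ge> 1"
    and F: "\<And>F. F \<in> set Fs \<Longrightarrow> distinct F \<and> set F \<subseteq> int_vecs d \<and> F \<noteq> [] \<and> length F \<le> R"
  shows "measure (shift_law d R S) {y \<in> space (shift_law d R S). good_shifts d S Fs y}
    \<ge> 1 - real (card (set Fs)) * (2 * (real R)\<^sup>2 * real N powr (- K))"
proof -
  let ?P = "shift_law d R S"
  interpret prob_space ?P by (rule prob_space_shift_law)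
  let ?G = "{y \<in> space ?P. good_shifts d S Fs y}"
  let ?E = "\<lambda>F. {y \<in> space ?P. \<not> gram_expands d S y F}"
  have G: "?G \<in> sets ?P" by (rule sets_good_shifts) (use S F in auto)
  have E: "?E F \<in> sets ?P" if "F \<in> set Fs" for F
    using sets_gram_expands[of S F R d] S F[OF that] by (auto intro: sets.sets_Collect_neg)
  have bound: "measure ?P (?E F) \<le> 2 * (real R)\<^sup>2 * real N powr (- K)" if "F \<in> set Fs" for F
  proof -
    let ?v = "real (length F)"
    have v: "0 < ?v" "?v \<le> real R" using F[OF that] by auto
    have "measure ?P (?E F) \<le> 2 * ?v\<^sup>2 * exp (- real S / (2 * ?v))"
      by (rule prob_not_gram_expands) (use F[OF that] S in auto)
    also have "exp (- real S / (2 * ?v)) \<le> real N powr (- K)"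
    proof -
      have "K * ln (real N) * (2 * ?v) \<le> K * ln (real N) * (2 * real R)"
        using v K N by (intro mult_left_mono) auto
      also have "\<dots> \<le> real S" using S by (simp add: mult_ac)
      finally have "K * ln (real N) \<le> real S / (2 * ?v)" using v by (simp add: field_simps)
      then show ?thesis using N by (simp add: powr_def)
    qed
    then have "2 * ?v\<^sup>2 * exp (- real S / (2 * ?v)) \<le> 2 * (real R)\<^sup>2 * real N powr (- K)"
      using v by (intro mult_mono) (auto simp: power_mono)
    finally show ?thesis .
  qed
  have "space ?P - ?G \<subseteq> (\<Union>F\<in>set Fs. ?E F)"
    using good_shifts_iff[OF S(1)] by auto
  then have "measure ?P (space ?P - ?G) \<le> measure ?P (\<Union>F\<in>set Fs. ?E F)"
    using E by (intro finite_measure_mono) auto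
  also have "\<dots> \<le> (\<Sum>F\<in>set Fs. measure ?P (?E F))"
    by (rule finite_measure_subadditive_finite) (use E in auto)
  also have "\<dots> \<le> real (card (set Fs)) * (2 * (real R)\<^sup>2 * real N powr (- K))"
    by (rule sum_bounded_above) (use bound in auto)
  finally show ?thesis using prob_compl[OF G] by simp
qed

section \<open>The weight function, fibers and the figure of merit\<close>

definition pos_weights :: "nat \<Rightarrow> (nat \<Rightarrow> real) \<Rightarrow> bool" where
  "pos_weights d \<gamma> \<longleftrightarrow> (\<forall>j<d. 0 < \<gamma> j \<and> \<gamma> j \<le> 1)"

text \<open>The factor of the weight that belongs to one coordinate, with value \<open>1\<close>
  at \<open>0\<close> so that the product runs over all coordinates.\<close>

definition korobov_factor :: "real \<Rightarrow> real \<Rightarrow> int \<Rightarrow> real" where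
  "korobov_factor \<alpha> c m = (if m = 0 then 1 else real_of_int \<bar>m\<bar> powr \<alpha> / c)"

lemma korobov_r_eq_prod: "korobov_r d \<alpha> \<gamma> k = (\<Prod>j<d. korobov_factor \<alpha> (\<gamma> j) (k j))"
proof -
  have "{j. j < d \<and> k j \<noteq> 0} = {j \<in> {..<d}. k j \<noteq> 0}" by auto
  then show ?thesis
    unfolding korobov_r_def
    by (simp only: prod.inter_filter[OF finite_lessThan]) (intro prod.cong, auto simp: korobov_factor_def)
qed

lemma korobov_factor_ge_1: "\<lbrakk>0 < c; c \<le> 1; \<alpha> \<ge> 0\<rbrakk> \<Longrightarrow> korobov_factor \<alpha> c m \<ge> 1"
proof -
  assume a: "0 < c" "c \<le> 1" "\<alpha> \<ge> 0"
  show ?thesis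
  proof (cases "m = 0")
    case False
    then have "real_of_int \<bar>m\<bar> powr \<alpha> \<ge> 1" using a by (intro ge_one_powr_ge_zero) auto
    then show ?thesis using False a by (simp add: korobov_factor_def)
  qed (simp add: korobov_factor_def)
qed

lemma korobov_factor_mono:
  assumes "0 < c" "c \<le> 1" "\<alpha> \<ge> 0" and "\<bar>m\<bar> \<le> \<bar>n\<bar>"
  shows "korobov_factor \<alpha> c m \<le> korobov_factor \<alpha> c n"
proof (cases "m = 0")
  case True
  then show ?thesis using korobov_factor_ge_1[OF assms(1-3), of n] by (simp add: korobov_factor_def)
next
  case False
  then show ?thesis
    using assms by (auto simp: korobov_factor_def intro!: divide_right_mono powr_mono2)
qed

lemma korobov_r_mono:
  assumes "pos_weights d \<gamma>" "\<alpha> \<ge> 0" "\<And>j. j < d \<Longrightarrow> \<bar>k j\<bar> \<le> \<bar>l j\<bar>"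
  shows "korobov_r d \<alpha> \<gamma> k \<le> korobov_r d \<alpha> \<gamma> l"
  unfolding korobov_r_eq_prod
proof (rule prod_mono)
  fix j assume j: "j \<in> {..<d}"
  then have "korobov_factor \<alpha> (\<gamma> j) (k j) \<ge> 1"
    using assms by (intro korobov_factor_ge_1) (auto simp: pos_weights_def)
  with j show "0 \<le> korobov_factor \<alpha> (\<gamma> j) (k j) \<and> korobov_factor \<alpha> (\<gamma> j) (k j) \<le> korobov_factor \<alpha> (\<gamma> j) (l j)"
    using assms by (auto simp: pos_weights_def intro!: korobov_factor_mono)
qed

lemma korobov_r_zero [simp]: "korobov_r d \<alpha> \<gamma> (zero_vec d) = 1"
  unfolding korobov_r_def by (intro prod.neutral) (auto simp: zero_vec_def)

lemma korobov_r_ge_1: "pos_weights d \<gamma> \<Longrightarrow> \<alpha> \<ge> 0 \<Longrightarrow> korobov_r d \<alpha> \<gamma> k \<ge> 1"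
  unfolding korobov_r_eq_prod by (intro prod_ge_1 korobov_factor_ge_1) (auto simp: pos_weights_def)

lemma korobov_r_ge_powr:
  assumes "pos_weights d \<gamma>" "\<alpha> > 0" "j < d"
  shows "real_of_int \<bar>k j\<bar> powr \<alpha> \<le> korobov_r d \<alpha> \<gamma> k"
proof (cases "k j = 0")
  case True
  then show ?thesis using korobov_r_ge_1[OF assms(1), of \<alpha> k] assms(2) by simp
next
  case False
  have w: "0 < \<gamma> i" "\<gamma> i \<le> 1" if "i < d" for i using assms(1) that by (auto simp: pos_weights_def)
  have "real_of_int \<bar>k j\<bar> powr \<alpha> \<le> korobov_factor \<alpha> (\<gamma> j) (k j)"
    using False w[OF assms(3)] by (simp add: korobov_factor_def field_simps mult_left_le)
  also have "\<dots> \<le> korobov_factor \<alpha> (\<gamma> j) (k j) * (\<Prod>i\<in>{..<d} - {j}. korobov_factor \<alpha> (\<gamma> i) (k i))"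
  proof -
    have "(\<Prod>i\<in>{..<d} - {j}. korobov_factor \<alpha> (\<gamma> i) (k i)) \<ge> 1"
      using w assms(2) by (intro prod_ge_1 korobov_factor_ge_1) auto
    moreover have "korobov_factor \<alpha> (\<gamma> j) (k j) \<ge> 0"
      using korobov_factor_ge_1[of "\<gamma> j" \<alpha> "k j"] w[OF assms(3)] assms(2) by linarith
    ultimately show ?thesis by (simp add: mult_le_cancel_left1)
  qed
  also have "\<dots> = korobov_r d \<alpha> \<gamma> k"
    unfolding korobov_r_eq_prod using assms(3) by (subst prod.remove[of "{..<d}" j]) auto
  finally show ?thesis .
qed

lemma abs_less_if_korobov_r_less:
  assumes "pos_weights d \<gamma>" "\<alpha> > 0" "j < d" "korobov_r d \<alpha> \<gamma> k < M"
  shows "real_of_int \<bar>k j\<bar> < M powr (1 / \<alpha>)"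
proof -
  have "real_of_int \<bar>k j\<bar> powr \<alpha> < M"
    using korobov_r_ge_powr[OF assms(1-3), of k] assms(4) by linarith
  then have "(real_of_int \<bar>k j\<bar> powr \<alpha>) powr (1 / \<alpha>) < M powr (1 / \<alpha>)"
    using assms(2) by (intro powr_less_mono2) auto
  then show ?thesis using assms(2) by (simp add: powr_powr)
qed

lemma zero_vec_in_int_vecs [simp]: "zero_vec d \<in> int_vecs d"
  by (simp add: zero_vec_def int_vecs_def)

lemma zero_vec_apply [simp]: "j < d \<Longrightarrow> zero_vec d j = 0"
  by (simp add: zero_vec_def)

lemma int_vecs_neq_zero_iff: "k \<in> int_vecs d \<Longrightarrow> k \<noteq> zero_vec d \<longleftrightarrow> (\<exists>j<d. k j \<noteq> 0)"
  by (metis int_vecs_eqI zero_vec_in_int_vecs zero_vec_apply)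

lemma finite_freq_set:
  assumes "pos_weights d \<gamma>" "\<alpha> > 0"
  shows "finite (freq_set d \<alpha> \<gamma> M)"
proof (rule finite_subset)
  let ?n = "nat \<lceil>M powr (1 / \<alpha>)\<rceil>"
  show "freq_set d \<alpha> \<gamma> M \<subseteq> int_box d ?n"
  proof
    fix k assume k: "k \<in> freq_set d \<alpha> \<gamma> M"
    have "\<bar>k j\<bar> \<le> int ?n" if "j < d" for j
      using abs_less_if_korobov_r_less[OF assms that, of k M] k by (simp add: freq_set_def) linarith
    then show "k \<in> int_box d ?n"
      using k by (auto simp: freq_set_def int_vecs_def int_box_def PiE_iff abs_le_iff minus_le_iff)
  qed
qed simp

lemma fiber_subset_freq_set: "fiber d \<alpha> \<gamma> N M g l \<subseteq> freq_set d \<alpha> \<gamma> M"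
  by (auto simp: fiber_def)

lemma finite_card_fibers:
  assumes "pos_weights d \<gamma>" "\<alpha> > 0"
  shows "finite ((\<lambda>l. card (fiber d \<alpha> \<gamma> N M g l)) ` int_vecs d)"
proof (rule finite_subset)
  show "(\<lambda>l. card (fiber d \<alpha> \<gamma> N M g l)) ` int_vecs d \<subseteq> {..card (freq_set d \<alpha> \<gamma> M)}"
    using card_mono[OF finite_freq_set[OF assms] fiber_subset_freq_set] by auto
qed simp

lemma card_fiber_le_max_fiber_length:
  assumes "pos_weights d \<gamma>" "\<alpha> > 0" "l \<in> int_vecs d"
  shows "card (fiber d \<alpha> \<gamma> N M g l) \<le> max_fiber_length d \<alpha> \<gamma> N M g"
  unfolding max_fiber_length_def using assms by (intro Max_ge finite_card_fibers) auto

lemma max_fiber_length_le: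
  assumes "pos_weights d \<gamma>" "\<alpha> > 0" "\<And>l. card (fiber d \<alpha> \<gamma> N M g l) \<le> n"
  shows "max_fiber_length d \<alpha> \<gamma> N M g \<le> n"
  unfolding max_fiber_length_def
  by (rule Max.boundedI[OF finite_card_fibers[OF assms(1,2)]]) (use assms(3) zero_vec_in_int_vecs[of d] in blast)+

lemma max_fiber_length_pos:
  assumes "pos_weights d \<gamma>" "\<alpha> > 0" "M > 1"
  shows "max_fiber_length d \<alpha> \<gamma> N M g \<ge> 1"
proof -
  have "zero_vec d \<in> fiber d \<alpha> \<gamma> N M g (zero_vec d)"
    using assms by (simp add: fiber_def freq_set_def)
  then have "card (fiber d \<alpha> \<gamma> N M g (zero_vec d)) > 0"
    using finite_subset[OF fiber_subset_freq_set finite_freq_set[OF assms(1,2)]]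
    by (auto simp: card_gt_0_iff)
  then show ?thesis
    using card_fiber_le_max_fiber_length[OF assms(1,2) zero_vec_in_int_vecs, of N M g] by linarith
qed

text \<open>The minimum defining the figure of merit is attained: the dual lattice contains
  \<open>N\<close> times every unit vector, and only finitely many points have a smaller weight
  than a given one.\<close>

lemma merit_ge_iff:
  assumes "pos_weights d \<gamma>" "\<alpha> > 0" "d \<ge> 1" "N > 0"
  shows "merit d \<alpha> \<gamma> N g \<ge> M \<longleftrightarrow> (\<forall>k\<in>dual_lattice d N g - {zero_vec d}. korobov_r d \<alpha> \<gamma> k \<ge> M)"
proof -
  let ?D = "dual_lattice d N g - {zero_vec d}" and ?r = "korobov_r d \<alpha> \<gamma>"
  define e where "e = (\<lambda>j\<in>{..<d}. if j = 0 then int N else 0)"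
  have "e \<in> int_vecs d" by (simp add: e_def int_vecs_def)
  moreover have "int_dot d g e = g 0 * int N"
  proof -
    have "int_dot d g e = (\<Sum>j<d. if j = 0 then g 0 * int N else 0)"
      unfolding int_dot_def by (intro sum.cong) (auto simp: e_def)
    then show ?thesis using assms(3) by simp
  qed
  moreover have "e \<noteq> zero_vec d"
  proof
    assume "e = zero_vec d"
    then have "e 0 = zero_vec d 0" by simp
    then show False using assms by (simp add: e_def)
  qed
  ultimately have e: "e \<in> ?D" by (auto simp: dual_lattice_def cong_0_iff)
  define X where "X = {k \<in> ?D. ?r k \<le> ?r e}"
  have "X \<subseteq> freq_set d \<alpha> \<gamma> (?r e + 1)"
    by (auto simp: X_def dual_lattice_def freq_set_def)
  then have "finite X" using finite_freq_set[OF assms(1,2)] finite_subset by blast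
  moreover have "X \<noteq> {}" using e by (auto simp: X_def)
  ultimately obtain m where m: "m \<in> X" "\<And>k. k \<in> X \<Longrightarrow> ?r m \<le> ?r k"
    using ex_is_arg_min_if_finite[of X ?r] by (auto simp: is_arg_min_linorder)
  have min: "?r m \<le> ?r k" if "k \<in> ?D" for k
    using m that by (cases "?r k \<le> ?r e") (auto simp: X_def)
  have "merit d \<alpha> \<gamma> N g = ?r m"
    unfolding merit_def
    by (rule Least_equality) (use m min in \<open>auto simp: X_def\<close>)
  then show ?thesis using min m by (fastforce simp: X_def)
qed

text \<open>Partition the frequencies according to the signs of all coordinates and the binary
  orders of magnitude of all but the last coordinate. The difference of two points in the same
  class is dominated, coordinate by coordinate, by the one with the larger last coordinate. So a
  fiber, whose differences lie in the dual lattice, meets each class at most once.\<close>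

lemma card_fiber_le:
  assumes w: "pos_weights d \<gamma>" and \<alpha>: "\<alpha> > 0" and d: "d \<ge> 1" and m0: "m0 \<ge> 1"
    and merit: "\<And>k. k \<in> dual_lattice d N g - {zero_vec d} \<Longrightarrow> korobov_r d \<alpha> \<gamma> k \<ge> M"
    and M: "M powr (1 / \<alpha>) \<le> 2 ^ m0"
  shows "card (fiber d \<alpha> \<gamma> N M g l) \<le> 1 + (3 ^ d - 1) * m0 ^ (d - 1)"
proof -
  let ?F = "fiber d \<alpha> \<gamma> N M g l"
  define sg where "sg = (\<lambda>k::nat \<Rightarrow> int. \<lambda>j\<in>{..<d}. sgn (k j))"
  define lg where "lg = (\<lambda>k::nat \<Rightarrow> int. \<lambda>j\<in>{..<d - 1}. floor_log (nat \<bar>k j\<bar>))"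
  let ?\<phi> = "\<lambda>k. (sg k, lg k)"
  let ?S = "{..<d} \<rightarrow>\<^sub>E {- 1, 0, 1 :: int}" and ?L = "{..<d - 1} \<rightarrow>\<^sub>E {..<m0}"
  let ?z = "\<lambda>j\<in>{..<d}. 0 :: int" and ?z' = "\<lambda>j\<in>{..<d - 1}. 0 :: nat"
  have diff_le: "korobov_r d \<alpha> \<gamma> (\<lambda>j\<in>{..<d}. a j - b j) \<le> korobov_r d \<alpha> \<gamma> a"
    if eq: "sg a = sg b" "lg a = lg b" and last: "\<bar>b (d - 1)\<bar> \<le> \<bar>a (d - 1)\<bar>" for a b
  proof (rule korobov_r_mono[OF w])
    fix j assume j: "j < d"
    have s: "sgn (a j) = sgn (b j)" using fun_cong[OF eq(1), of j] j by (simp add: sg_def)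
    have "\<bar>a j - b j\<bar> \<le> \<bar>a j\<bar>"
    proof (cases "a j = 0 \<or> \<not> j < d - 1")
      case True
      then have "a j = 0 \<or> j = d - 1" using j by linarith
      then show ?thesis using s last by (auto simp: sgn_if split: if_splits)
    next
      case False
      then have "floor_log (nat \<bar>a j\<bar>) = floor_log (nat \<bar>b j\<bar>)"
        using fun_cong[OF eq(2), of j] j by (simp add: lg_def split: if_splits)
      moreover have "b j \<noteq> 0" using s False by (auto simp: sgn_0_0)
      ultimately have "2 ^ floor_log (nat \<bar>a j\<bar>) \<le> nat \<bar>a j\<bar>" "nat \<bar>b j\<bar> < 2 * 2 ^ floor_log (nat \<bar>a j\<bar>)"
        using False floor_log_exp2_le[of "nat \<bar>a j\<bar>"] floor_log_exp2_gt[of "nat \<bar>b j\<bar>"] by auto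
      then have "nat \<bar>b j\<bar> < 2 * nat \<bar>a j\<bar>" by linarith
      then have "\<bar>b j\<bar> < 2 * \<bar>a j\<bar>" by linarith
      then show ?thesis using s False by (auto simp: sgn_if split: if_splits)
    qed
    then show "\<bar>(\<lambda>j\<in>{..<d}. a j - b j) j\<bar> \<le> \<bar>a j\<bar>" using j by simp
  qed (use \<alpha> in simp)
  have no_two: False
    if ab: "a \<in> ?F" "b \<in> ?F" "a \<noteq> b" and eq: "sg a = sg b" "lg a = lg b"
      and last: "\<bar>b (d - 1)\<bar> \<le> \<bar>a (d - 1)\<bar>" for a b
  proof -
    let ?h = "\<lambda>j\<in>{..<d}. a j - b j"
    have int: "a \<in> int_vecs d" "b \<in> int_vecs d" using ab by (auto simp: fiber_def freq_set_def)
    have "[int_dot d a g = int_dot d b g] (mod int N)"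
      using ab by (auto simp: fiber_def cong_def)
    moreover have "int_dot d g ?h = int_dot d a g - int_dot d b g"
      by (simp add: int_dot_def sum_subtractf[symmetric] algebra_simps)
    ultimately have "?h \<in> dual_lattice d N g"
      by (simp add: dual_lattice_def int_vecs_def cong_diff_iff_cong_0)
    moreover have "?h \<noteq> zero_vec d"
    proof
      assume h: "?h = zero_vec d"
      have "a j = b j" if "j < d" for j
        using fun_cong[OF h, of j] that by (simp add: zero_vec_def)
      then show False using int_vecs_eqI[OF int] ab(3) by blast
    qed
    ultimately have "M \<le> korobov_r d \<alpha> \<gamma> ?h" by (intro merit) auto
    also have "\<dots> \<le> korobov_r d \<alpha> \<gamma> a" by (rule diff_le[OF eq last])
    also have "\<dots> < M" using ab by (auto simp: fiber_def freq_set_def)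
    finally show False by simp
  qed
  have "inj_on ?\<phi> ?F"
  proof (rule inj_onI, rule ccontr)
    fix a b assume *: "a \<in> ?F" "b \<in> ?F" "?\<phi> a = ?\<phi> b" "a \<noteq> b"
    show False
      using no_two[of a b] no_two[of b a] * by (cases "\<bar>b (d - 1)\<bar> \<le> \<bar>a (d - 1)\<bar>") auto
  qed
  moreover have "?\<phi> ` ?F \<subseteq> insert (?z, ?z') ((?S - {?z}) \<times> ?L)"
  proof
    fix p assume "p \<in> ?\<phi> ` ?F"
    then obtain k where k: "k \<in> ?F" "p = ?\<phi> k" by blast
    have sg: "sg k \<in> ?S" by (auto simp: sg_def sgn_if)
    have "floor_log (nat \<bar>k j\<bar>) < m0" if "j < d" for j
    proof (cases "k j = 0")
      case False
      have "real_of_int \<bar>k j\<bar> < M powr (1 / \<alpha>)"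
        using k by (intro abs_less_if_korobov_r_less[OF w \<alpha> that]) (auto simp: fiber_def freq_set_def)
      also have "\<dots> \<le> 2 ^ m0" by (rule M)
      finally have "\<bar>k j\<bar> < 2 ^ m0" by (metis of_int_less_numeral_power_cancel_iff)
      then have "nat \<bar>k j\<bar> < 2 ^ m0" by (simp add: nat_less_iff)
      then have "2 ^ floor_log (nat \<bar>k j\<bar>) < (2::nat) ^ m0"
        using floor_log_exp2_le[of "nat \<bar>k j\<bar>"] False by linarith
      then show ?thesis by simp
    qed (use m0 in simp)
    then have lg: "lg k \<in> ?L" using d by (auto simp: lg_def)
    have "lg k = ?z'" if "sg k = ?z"
    proof
      fix j
      have "k j = 0" if "j < d - 1"
        using fun_cong[OF \<open>sg k = ?z\<close>, of j] that by (simp add: sg_def sgn_0_0 split: if_splits)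
      then show "lg k j = ?z' j" by (simp add: lg_def)
    qed
    then show "p \<in> insert (?z, ?z') ((?S - {?z}) \<times> ?L)"
      using k sg lg by auto
  qed
  moreover have "finite (insert (?z, ?z') ((?S - {?z}) \<times> ?L))"
    by (intro finite.insertI finite_cartesian_product finite_Diff finite_PiE) auto
  ultimately have "card ?F \<le> card (insert (?z, ?z') ((?S - {?z}) \<times> ?L))"
    by (intro card_inj_on_le)
  also have "\<dots> \<le> Suc (card ((?S - {?z}) \<times> ?L))"
    by (rule card_insert_le_m1) auto
  also have "\<dots> = 1 + (3 ^ d - 1) * m0 ^ (d - 1)"
  proof -
    have "?z \<in> ?S" by auto
    then have "card (?S - {?z}) = 3 ^ d - 1"
      by (subst card_Diff_singleton) (auto simp: card_PiE numeral_3_eq_3)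
    moreover have "card ?L = m0 ^ (d - 1)" by (simp add: card_PiE)
    ultimately show ?thesis by (simp only: card_cartesian_product plus_1_eq_Suc)
  qed
  finally show ?thesis .
qed

lemma max_fiber_length_le_R_star:
  assumes w: "pos_weights d \<gamma>" and \<alpha>: "\<alpha> > 0" and d: "d \<ge> 1" and m0: "m0 \<ge> 1" and N: "N > 0"
    and merit: "merit d \<alpha> \<gamma> N g \<ge> M" and M: "M powr (1 / \<alpha>) \<le> 2 ^ m0"
  shows "real (max_fiber_length d \<alpha> \<gamma> N M g) \<le> R_star d m0"
proof -
  have "max_fiber_length d \<alpha> \<gamma> N M g \<le> 1 + (3 ^ d - 1) * m0 ^ (d - 1)"
    using merit merit_ge_iff[OF w \<alpha> d N]
    by (intro max_fiber_length_le[OF w \<alpha>] card_fiber_le[OF w \<alpha> d m0 _ M]) auto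
  then have "real (max_fiber_length d \<alpha> \<gamma> N M g) \<le> real (1 + (3 ^ d - 1) * m0 ^ (d - 1))"
    by (rule of_nat_mono)
  also have "\<dots> = 1 + (3 ^ d - 1) * real m0 ^ (d - 1)"
    by (simp add: of_nat_diff)
  also have "\<dots> \<le> R_star d m0"
    unfolding R_star_def by (intro add_left_mono mult_left_mono power_mono) auto
  finally show ?thesis .
qed

section \<open>Sums over the weight function\<close>

definition euler_prod :: "nat \<Rightarrow> real \<Rightarrow> (nat \<Rightarrow> real) \<Rightarrow> real \<Rightarrow> real" where
  "euler_prod d \<alpha> \<gamma> l = (\<Prod>j<d. 1 + 2 * \<gamma> j powr l * real_zeta (\<alpha> * l))"

lemma summable_zeta: "s > 1 \<Longrightarrow> summable (\<lambda>n. 1 / real (Suc n) powr s)"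
  using summable_real_powr_iff[of "- s"] summable_Suc_iff[of "\<lambda>n. real n powr - s"]
  by (simp add: powr_minus_divide)

lemma sum_le_real_zeta: "s > 1 \<Longrightarrow> (\<Sum>n<m. 1 / real (Suc n) powr s) \<le> real_zeta s"
  unfolding real_zeta_def by (intro sum_le_suminf summable_zeta) auto

lemma real_zeta_ge_1: "s > 1 \<Longrightarrow> real_zeta s \<ge> 1"
  using sum_le_real_zeta[of s 1] by simp

lemma euler_prod_ge_1:
  assumes "pos_weights d \<gamma>" "\<alpha> * l > 1"
  shows "euler_prod d \<alpha> \<gamma> l \<ge> 1"
  unfolding euler_prod_def using real_zeta_ge_1[OF assms(2)] by (intro prod_ge_1) simp

lemma sum_korobov_factor_le:
  assumes "c > 0" "\<alpha> * l > 1"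
  shows "(\<Sum>m\<in>{- int n..int n}. korobov_factor \<alpha> c m powr (- l)) \<le> 1 + 2 * c powr l * real_zeta (\<alpha> * l)"
proof -
  let ?f = "\<lambda>m. korobov_factor \<alpha> c m powr (- l)"
  have powr: "(x powr \<alpha> / c) powr (- l) = c powr l * (1 / x powr (\<alpha> * l))" if "x > 0" for x :: real
  proof -
    have "(x powr \<alpha> / c) powr l = x powr (\<alpha> * l) / c powr l"
      using that assms(1) by (simp add: powr_divide powr_powr)
    then show ?thesis by (simp add: powr_minus)
  qed
  have "korobov_factor \<alpha> c (int (Suc m)) = real (Suc m) powr \<alpha> / c"
    "korobov_factor \<alpha> c (- int (Suc m)) = real (Suc m) powr \<alpha> / c" for m
    by (simp_all add: korobov_factor_def add.commute)
  then have f: "?f (int (Suc m)) = c powr l * (1 / real (Suc m) powr (\<alpha> * l))"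
    "?f (- int (Suc m)) = c powr l * (1 / real (Suc m) powr (\<alpha> * l))" for m
    by (simp_all only: powr of_nat_0_less_iff zero_less_Suc)
  let ?A = "(\<lambda>m. int (Suc m)) ` {..<n}" and ?B = "(\<lambda>m. - int (Suc m)) ` {..<n}"
  have "{- int n..int n} = insert 0 (?A \<union> ?B)"
  proof (intro equalityI subsetI)
    fix m assume m: "m \<in> {- int n..int n}"
    consider "m = 0" | "m > 0" | "m < 0" by linarith
    then show "m \<in> insert 0 (?A \<union> ?B)"
    proof cases
      case 2
      then have "m = int (Suc (nat (m - 1)))" "nat (m - 1) < n" using m by auto
      then show ?thesis by blast
    next
      case 3
      then have "m = - int (Suc (nat (- m - 1)))" "nat (- m - 1) < n" using m by auto
      then show ?thesis by blast
    qed simp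
  qed auto
  moreover have "0 \<notin> ?A \<union> ?B" "?A \<inter> ?B = {}" by auto
  ultimately have "(\<Sum>m\<in>{- int n..int n}. ?f m) = ?f 0 + (sum ?f ?A + sum ?f ?B)"
    by (simp only: sum.insert[OF finite_UnI] sum.union_disjoint finite_imageI finite_lessThan finite_UnI not_False_eq_True)
  also have "\<dots> = 1 + 2 * c powr l * (\<Sum>m<n. 1 / real (Suc m) powr (\<alpha> * l))"
    by (subst (1 2) sum.reindex; simp add: inj_on_def f del: of_nat_Suc)
       (simp add: korobov_factor_def sum_distrib_left)
  also have "\<dots> \<le> 1 + 2 * c powr l * real_zeta (\<alpha> * l)"
    using sum_le_real_zeta[OF assms(2)] assms(1) by (intro add_left_mono mult_left_mono) auto
  finally show ?thesis .
qed

text \<open>Finite sets lie in boxes, over which the sum factorizes.\<close>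

lemma sum_korobov_r_le:
  assumes w: "pos_weights d \<gamma>" and l: "\<alpha> * l > 1" and X: "finite X" "X \<subseteq> int_vecs d"
  shows "(\<Sum>k\<in>X. korobov_r d \<alpha> \<gamma> k powr (- l)) \<le> euler_prod d \<alpha> \<gamma> l"
proof -
  let ?f = "\<lambda>j m. korobov_factor \<alpha> (\<gamma> j) m powr (- l)"
  have "\<exists>n. X \<subseteq> int_box d n" using X
  proof (induction X rule: finite_induct)
    case (insert k X)
    then obtain n where n: "X \<subseteq> int_box d n" by auto
    have "k \<in> (\<Union>m. int_box d m)" using insert.prems Union_int_box by simp
    then obtain m where "k \<in> int_box d m" by blast
    with n have "insert k X \<subseteq> int_box d (max m n)"
      using incseqD[OF incseq_int_box, of m "max m n" d] incseqD[OF incseq_int_box, of n "max m n" d] by auto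
    then show ?case by blast
  qed simp
  then obtain n where n: "X \<subseteq> int_box d n" by blast
  have "(\<Sum>k\<in>X. korobov_r d \<alpha> \<gamma> k powr (- l)) \<le> (\<Sum>k\<in>int_box d n. korobov_r d \<alpha> \<gamma> k powr (- l))"
    using n by (intro sum_mono2) auto
  also have "\<dots> = (\<Sum>k\<in>int_box d n. \<Prod>j<d. ?f j (k j))"
  proof (intro sum.cong refl)
    fix k
    show "korobov_r d \<alpha> \<gamma> k powr (- l) = (\<Prod>j<d. ?f j (k j))"
      unfolding korobov_r_eq_prod by (rule prod_powr_distrib)
  qed
  also have "\<dots> = (\<Prod>j<d. \<Sum>m\<in>{- int n..int n}. ?f j m)"
    unfolding int_box_def by (rule prod_sum_PiE[symmetric]) simp_all
  also have "\<dots> \<le> euler_prod d \<alpha> \<gamma> l"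
    unfolding euler_prod_def
    using w l by (intro prod_mono) (auto simp: pos_weights_def intro!: sum_nonneg sum_korobov_factor_le)
  finally show ?thesis .
qed

section \<open>Random generating vectors\<close>

lemma pos_if_mult_gt_1:
  fixes a l :: real
  assumes "a > 0" "a * l > 1"
  shows "l > 0"
proof (rule ccontr)
  assume "\<not> l > 0"
  then have "a * l \<le> 0" using assms(1) by (simp add: mult_le_0_iff)
  with assms(2) show False by simp
qed

lemma card_gen_vecs: "N \<ge> 1 \<Longrightarrow> card (gen_vecs d N) = (N - 1) ^ d"
  by (simp add: gen_vecs_def card_PiE nat_diff_distrib')

lemma finite_gen_vecs [simp]: "finite (gen_vecs d N)"
  unfolding gen_vecs_def by (intro finite_PiE) auto

lemma gen_vecs_nonempty: "N \<ge> 2 \<Longrightarrow> gen_vecs d N \<noteq> {}"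
  by (auto simp: gen_vecs_def PiE_eq_empty_iff)

lemma eq_if_dvd_diff:
  fixes a b :: int
  assumes "a \<in> {1..int N - 1}" "b \<in> {1..int N - 1}" "int N dvd a - b"
  shows "a = b"
  using assms zdvd_imp_le[of "int N" "a - b"] zdvd_imp_le[of "int N" "b - a"]
  by (cases a b rule: linorder_cases) (auto simp: dvd_diff_commute)

text \<open>The other components of \<open>g\<close> determine \<open>g j\<close> modulo
  \<open>N\<close>.\<close>

lemma card_gen_vecs_orthogonal_le:
  assumes N: "prime N" and j: "j < d" "\<not> int N dvd k j"
  shows "card {g \<in> gen_vecs d N. int N dvd int_dot d g k} \<le> (N - 1) ^ (d - 1)"
proof -
  let ?G = "{g \<in> gen_vecs d N. int N dvd int_dot d g k}"
  let ?T = "({..<d} - {j}) \<rightarrow>\<^sub>E {1..int N - 1}"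
  have "inj_on (\<lambda>g. restrict g ({..<d} - {j})) ?G"
  proof (rule inj_onI)
    fix g h assume g: "g \<in> ?G" and h: "h \<in> ?G"
      and eq: "restrict g ({..<d} - {j}) = restrict h ({..<d} - {j})"
    have off: "g i = h i" if "i < d" "i \<noteq> j" for i
      using fun_cong[OF eq, of i] that by simp
    have "int_dot d g k - int_dot d h k = (\<Sum>i<d. (g i - h i) * k i)"
      by (simp add: int_dot_def sum_subtractf left_diff_distrib)
    also have "\<dots> = (\<Sum>i<d. if i = j then (g j - h j) * k j else 0)"
      using off by (intro sum.cong) auto
    also have "\<dots> = (g j - h j) * k j" using j by simp
    finally have "int N dvd (g j - h j) * k j"
      using g h by (metis (no_types, lifting) dvd_diff mem_Collect_eq)
    then have "int N dvd g j - h j"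
      using j N prime_dvd_mult_iff[of "int N"] by (auto simp: prime_int_nat_transfer)
    moreover have "g j \<in> {1..int N - 1}" "h j \<in> {1..int N - 1}"
      using g h j by (auto simp: gen_vecs_def PiE_iff)
    ultimately have "g j = h j" by (intro eq_if_dvd_diff)
    show "g = h"
    proof (rule PiE_ext)
      show "g \<in> ({..<d} \<rightarrow>\<^sub>E {1..int N - 1})" "h \<in> ({..<d} \<rightarrow>\<^sub>E {1..int N - 1})"
        using g h by (auto simp: gen_vecs_def)
      show "g i = h i" if "i \<in> {..<d}" for i
        using off[of i] \<open>g j = h j\<close> that by (cases "i = j") auto
    qed
  qed
  moreover have "(\<lambda>g. restrict g ({..<d} - {j})) ` ?G \<subseteq> ?T"
  proof (rule image_subsetI)
    fix g assume "g \<in> ?G"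
    then have "g i \<in> {1..int N - 1}" if "i < d" for i using that by (auto simp: gen_vecs_def PiE_iff)
    then show "restrict g ({..<d} - {j}) \<in> ?T" by (subst restrict_PiE_iff) auto
  qed
  ultimately have "card ?G \<le> card ?T"
    by (intro card_inj_on_le finite_PiE) auto
  also have "\<dots> = (N - 1) ^ (d - 1)"
    using N j prime_gt_1_nat[OF N] by (simp add: card_PiE nat_diff_distrib')
  finally show ?thesis .
qed

text \<open>The union bound applies \<open>card_gen_vecs_orthogonal_le\<close> and needs a
  coordinate that is invertible modulo \<open>N\<close>; a multiple of \<open>N\<close> in a
  nonzero coordinate alone brings the weight to \<open>N powr \<alpha>\<close>.\<close>

lemma not_all_dvd_if_korobov_r_small:
  assumes w: "pos_weights d \<gamma>" and \<alpha>: "\<alpha> > 0" and k: "k \<in> int_vecs d" "k \<noteq> zero_vec d"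
    and r: "korobov_r d \<alpha> \<gamma> k < M" "M \<le> real N powr \<alpha>"
  shows "\<exists>j<d. \<not> int N dvd k j"
proof -
  obtain j where j: "j < d" "k j \<noteq> 0" using int_vecs_neq_zero_iff[OF k(1)] k(2) by blast
  have "\<not> int N dvd k j"
  proof
    assume "int N dvd k j"
    then have "int N \<le> \<bar>k j\<bar>" using j dvd_imp_le_int[of "k j" "int N"] by simp
    then have "real N powr \<alpha> \<le> real_of_int \<bar>k j\<bar> powr \<alpha>"
      using \<alpha> by (intro powr_mono2) auto
    also have "\<dots> \<le> korobov_r d \<alpha> \<gamma> k" by (rule korobov_r_ge_powr[OF w \<alpha> j(1)])
    finally show False using r by simp
  qed
  then show ?thesis using j by blast
qed

lemma sum_korobov_r_le':
  assumes w: "pos_weights d \<gamma>" and l: "\<alpha> * l > 1" and X: "finite X" "X \<subseteq> int_vecs d - {zero_vec d}"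
  shows "(\<Sum>k\<in>X. korobov_r d \<alpha> \<gamma> k powr (- l)) \<le> euler_prod d \<alpha> \<gamma> l - 1"
proof -
  have "(\<Sum>k\<in>insert (zero_vec d) X. korobov_r d \<alpha> \<gamma> k powr (- l)) \<le> euler_prod d \<alpha> \<gamma> l"
    using X by (intro sum_korobov_r_le[OF w l]) auto
  then show ?thesis using X by (subst (asm) sum.insert) auto
qed

text \<open>A union bound over the nonzero frequencies \<open>k\<close> of weight below
  \<open>M\<close>: each is orthogonal to at most one generating vector in \<open>N - 1\<close>,
  and there are at most \<open>M powr l\<close> times the sum of all \<open>r k powr (- l)\<close>
  of them.\<close>

lemma prob_dual_lattice_avoids:
  assumes w: "pos_weights d \<gamma>" and \<alpha>: "\<alpha> > 0" and l: "\<alpha> * l > 1" and d: "d \<ge> 1" and N: "prime N"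
    and M: "0 < M" "M \<le> real N powr \<alpha>" and \<delta>: "\<delta> \<le> 1"
    and Ml: "M powr l * euler_prod d \<alpha> \<gamma> l \<le> (real N - 1) * (1 - \<delta>)"
  shows "measure_pmf.prob (pmf_of_set (gen_vecs d N))
    {g. \<forall>k\<in>dual_lattice d N g - {zero_vec d}. korobov_r d \<alpha> \<gamma> k \<ge> M} \<ge> \<delta>"
proof -
  let ?r = "korobov_r d \<alpha> \<gamma>" and ?p = "pmf_of_set (gen_vecs d N)" and ?W = "euler_prod d \<alpha> \<gamma> l"
  let ?Good = "{g. \<forall>k\<in>dual_lattice d N g - {zero_vec d}. ?r k \<ge> M}"
  let ?X = "freq_set d \<alpha> \<gamma> M - {zero_vec d}"
  have N1: "N > 1" using N prime_gt_1_nat by blast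
  have finX: "finite ?X" using finite_freq_set[OF w \<alpha>] by simp
  have lpos: "l > 0" using pos_if_mult_gt_1 l \<alpha> by blast
  have "gen_vecs d N - ?Good \<subseteq> (\<Union>k\<in>?X. {g \<in> gen_vecs d N. int N dvd int_dot d g k})"
    by (force simp: dual_lattice_def freq_set_def cong_0_iff not_le)
  then have "card (gen_vecs d N - ?Good) \<le> card (\<Union>k\<in>?X. {g \<in> gen_vecs d N. int N dvd int_dot d g k})"
    using finX by (intro card_mono) auto
  also have "\<dots> \<le> (\<Sum>k\<in>?X. card {g \<in> gen_vecs d N. int N dvd int_dot d g k})"
    by (rule card_UN_le[OF finX])
  also have "\<dots> \<le> (\<Sum>k\<in>?X. (N - 1) ^ (d - 1))"
  proof (rule sum_mono)
    fix k assume k: "k \<in> ?X"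
    then obtain j where "j < d" "\<not> int N dvd k j"
      using not_all_dvd_if_korobov_r_small[OF w \<alpha> _ _ _ M(2), of k] by (auto simp: freq_set_def)
    then show "card {g \<in> gen_vecs d N. int N dvd int_dot d g k} \<le> (N - 1) ^ (d - 1)"
      by (rule card_gen_vecs_orthogonal_le[OF N])
  qed
  finally have "real (card (gen_vecs d N - ?Good)) \<le> real (card ?X * (N - 1) ^ (d - 1))"
    by (intro of_nat_mono) simp
  also have "\<dots> = real (card ?X) * (real N - 1) ^ (d - 1)"
    using N1 by (simp add: of_nat_diff)
  also have "real (card ?X) \<le> M powr l * (?W - 1)"
  proof -
    have "real (card ?X) = (\<Sum>k\<in>?X. 1)" by simp
    also have "\<dots> \<le> (\<Sum>k\<in>?X. M powr l * ?r k powr (- l))"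
    proof (rule sum_mono)
      fix k assume k: "k \<in> ?X"
      have r: "1 \<le> ?r k" "?r k < M"
        using korobov_r_ge_1[OF w, of \<alpha> k] \<alpha> k by (auto simp: freq_set_def)
      then have "?r k powr l \<le> M powr l" using lpos by (intro powr_mono2) auto
      then show "1 \<le> M powr l * ?r k powr (- l)"
        using r by (simp add: powr_minus field_simps)
    qed
    also have "\<dots> = M powr l * (\<Sum>k\<in>?X. ?r k powr (- l))" by (simp add: sum_distrib_left)
    also have "\<dots> \<le> M powr l * (?W - 1)"
      using finX by (intro mult_left_mono sum_korobov_r_le'[OF w l]) (auto simp: freq_set_def)
    finally show ?thesis .
  qed
  also have "M powr l * (?W - 1) \<le> M powr l * ?W" by (simp add: right_diff_distrib)
  also note Ml
  finally have "real (card (gen_vecs d N - ?Good)) \<le> (real N - 1) * (1 - \<delta>) * (real N - 1) ^ (d - 1)"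
    using N1 by (simp add: mult_right_mono)
  also have "\<dots> = (1 - \<delta>) * real (card (gen_vecs d N))"
    using d N1 by (cases d) (auto simp: card_gen_vecs of_nat_diff)
  finally have bad: "real (card (gen_vecs d N - ?Good)) \<le> (1 - \<delta>) * real (card (gen_vecs d N))" .
  have pos: "real (card (gen_vecs d N)) > 0" using N1 by (simp add: card_gen_vecs)
  have "gen_vecs d N \<inter> ?Good \<union> (gen_vecs d N - ?Good) = gen_vecs d N" by auto
  then have "card (gen_vecs d N) = card (gen_vecs d N \<inter> ?Good) + card (gen_vecs d N - ?Good)"
    by (metis (no_types, lifting) card_Diff_subset_Int card_Int_Diff finite_gen_vecs)
  then have "\<delta> * real (card (gen_vecs d N)) \<le> real (card (gen_vecs d N \<inter> ?Good))"
    using bad by (simp add: algebra_simps)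
  moreover have "measure_pmf.prob ?p ?Good = real (card (gen_vecs d N \<inter> ?Good)) / real (card (gen_vecs d N))"
    using gen_vecs_nonempty[of N d] N1 by (intro measure_pmf_of_set) auto
  ultimately show ?thesis using pos by (simp add: field_simps)
qed

section \<open>The component-by-component construction\<close>

text \<open>Every \<open>a x\<close> is at most \<open>T\<close>, hence \<open>a x powr e \<le> a
  x * T powr (e - 1)\<close>. This plays the part of Jensen's inequality in the analysis of the
  construction.\<close>

lemma sum_powr_le:
  assumes "\<And>x. x \<in> X \<Longrightarrow> a x \<ge> 0" and e: "e \<ge> 1" and T: "sum a X \<le> T"
  shows "(\<Sum>x\<in>X. a x powr e) \<le> T powr (e :: real)"
proof (cases "finite X")
  case True
  have le: "a x \<le> T" if "x \<in> X" for x
    using member_le_sum[OF that, of a] assms True by force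
  have T0: "T \<ge> 0" using sum_nonneg[of X a] assms by force
  have "(\<Sum>x\<in>X. a x powr e) \<le> (\<Sum>x\<in>X. a x * T powr (e - 1))"
  proof (rule sum_mono)
    fix x assume x: "x \<in> X"
    have "a x powr e = a x * a x powr (e - 1)"
      using assms(1)[OF x] by (cases "a x = 0") (auto simp: powr_diff)
    also have "\<dots> \<le> a x * T powr (e - 1)"
      using assms(1)[OF x] le[OF x] e by (intro mult_left_mono powr_mono2) auto
    finally show "a x powr e \<le> a x * T powr (e - 1)" .
  qed
  also have "\<dots> = sum a X * T powr (e - 1)" by (simp add: sum_distrib_right)
  also have "\<dots> \<le> T * T powr (e - 1)" using T by (intro mult_right_mono) auto
  also have "\<dots> = T powr e" using T0 by (cases "T = 0") (auto simp: powr_diff)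
  finally show ?thesis .
qed simp

lemma powr_add_le:
  assumes "x \<ge> 0" "y \<ge> 0" "e \<ge> 1"
  shows "x powr e + y powr e \<le> (x + y) powr (e :: real)"
proof -
  have "(\<Sum>b\<in>{False, True}. (if b then x else y) powr e) \<le> (x + y) powr e"
    by (rule sum_powr_le) (use assms in auto)
  then show ?thesis by simp
qed

context
  fixes d N :: nat and \<alpha> l :: real and \<gamma> :: "nat \<Rightarrow> real"
  assumes w: "pos_weights d \<gamma>" and \<alpha>: "\<alpha> > 0" and l: "\<alpha> * l > 1" "l \<le> 2" and N: "prime N"
begin

definition omega :: "(nat \<Rightarrow> int) \<Rightarrow> real" where
  "omega k = korobov_r d \<alpha> \<gamma> k powr (- l)"

text \<open>The frequencies in the first \<open>s\<close> coordinates, padded with zeros.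
  Embedding all dimensions \<open>s \<le> d\<close> in one space lets a single weight function and
  a single inner product serve the induction on \<open>s\<close>.\<close>

definition freqs_upto :: "nat \<Rightarrow> (nat \<Rightarrow> int) set" where
  "freqs_upto s = {k \<in> int_vecs d. \<forall>j<d. s \<le> j \<longrightarrow> k j = 0}"

lemma freqs_upto_subset: "freqs_upto s \<subseteq> int_vecs d"
  by (auto simp: freqs_upto_def)

lemma l_pos: "l > 0"
  using pos_if_mult_gt_1 l \<alpha> by blast

lemma N_gt_1: "N > 1"
  using N prime_gt_1_nat by blast

lemma omega_nonneg [simp]: "omega k \<ge> 0"
  by (simp add: omega_def)

lemma summable_omega: "X \<subseteq> int_vecs d \<Longrightarrow> omega summable_on X"
  by (rule nonneg_bdd_above_summable_on)
     (auto simp: omega_def intro!: bdd_aboveI2 sum_korobov_r_le[OF w l(1)])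

lemma infsum_omega_mono:
  "A \<subseteq> B \<Longrightarrow> B \<subseteq> int_vecs d \<Longrightarrow> infsum omega A \<le> infsum omega B"
  by (rule infsum_mono2) (auto intro: summable_omega)

lemma infsum_omega_Un:
  "A \<inter> B = {} \<Longrightarrow> A \<subseteq> int_vecs d \<Longrightarrow> B \<subseteq> int_vecs d \<Longrightarrow>
    infsum omega (A \<union> B) = infsum omega A + infsum omega B"
  by (intro infsum_Un_disjoint summable_omega)

lemma inverse_square_eq_omega_powr: "1 / (korobov_r d \<alpha> \<gamma> k)\<^sup>2 = omega k powr (2 / l)"
proof -
  have "korobov_r d \<alpha> \<gamma> k \<ge> 1" using korobov_r_ge_1[OF w] \<alpha> by simp
  then have "omega k powr (2 / l) = korobov_r d \<alpha> \<gamma> k powr (- 2)"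
    unfolding omega_def using l_pos by (simp add: powr_powr)
  also have "\<dots> = 1 / (korobov_r d \<alpha> \<gamma> k)\<^sup>2"
    using \<open>korobov_r d \<alpha> \<gamma> k \<ge> 1\<close> by (simp add: powr_minus_divide powr_numeral)
  finally show ?thesis by simp
qed

text \<open>Transfers bounds on sums of \<open>omega\<close>, which can be averaged over the
  generating vector, to sums of \<open>omega powr (2 / l)\<close>, of which \<open>cbc_P\<close>
  is one.\<close>

lemma summable_omega_powr:
  assumes "X \<subseteq> int_vecs d"
  shows "(\<lambda>k. omega k powr (2 / l)) summable_on X"
    and "infsum omega X \<le> T \<Longrightarrow> (\<Sum>\<^sub>\<infinity>k\<in>X. omega k powr (2 / l)) \<le> T powr (2 / l)"
proof -
  have fin: "(\<Sum>k\<in>Y. omega k powr (2 / l)) \<le> infsum omega X powr (2 / l)" if "finite Y" "Y \<subseteq> X" for Y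
    using that l l_pos finite_sum_le_infsum[OF summable_omega[OF assms] that]
    by (intro sum_powr_le) auto
  show summ: "(\<lambda>k. omega k powr (2 / l)) summable_on X"
    by (rule nonneg_bdd_above_summable_on) (auto intro!: bdd_aboveI2 fin)
  assume "infsum omega X \<le> T"
  moreover have "infsum omega X \<ge> 0" by (rule infsum_nonneg) simp
  ultimately have "infsum omega X powr (2 / l) \<le> T powr (2 / l)"
    using l_pos by (intro powr_mono2) auto
  then show "(\<Sum>\<^sub>\<infinity>k\<in>X. omega k powr (2 / l)) \<le> T powr (2 / l)"
    by (intro infsum_le_finite_sums[OF summ]) (use fin order_trans in blast)
qed

lemma cbc_P_eq_infsum_omega:
  assumes s: "s \<le> d"
  shows "cbc_P s \<alpha> \<gamma> N g =
    (\<Sum>\<^sub>\<infinity>k\<in>{k \<in> freqs_upto s - {zero_vec d}. int N dvd int_dot d k g}. omega k powr (2 / l))"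
proof -
  define ext where "ext = (\<lambda>k::nat \<Rightarrow> int. \<lambda>j\<in>{..<d}. if j < s then k j else 0)"
  have dot: "int_dot d (ext k) g = int_dot s k g" for k
  proof -
    have "int_dot d (ext k) g = (\<Sum>j<d. if j < s then k j * g j else 0)"
      unfolding int_dot_def ext_def by (intro sum.cong) auto
    also have "\<dots> = (\<Sum>j<s. k j * g j)"
      using s by (intro sum.mono_neutral_cong_right) auto
    finally show ?thesis by (simp add: int_dot_def)
  qed
  have "{j. j < d \<and> ext k j \<noteq> 0} = {j. j < s \<and> k j \<noteq> 0}" for k
    using s by (auto simp: ext_def)
  then have r: "korobov_r d \<alpha> \<gamma> (ext k) = korobov_r s \<alpha> \<gamma> k" for k
    unfolding korobov_r_def using s by (intro prod.cong) (auto simp: ext_def)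
  have ext_int: "ext k \<in> int_vecs d" for k
    by (simp add: ext_def int_vecs_def)
  have bij: "bij_betw ext (int_vecs s) (freqs_upto s)"
  proof (rule bij_betw_byWitness[where f' = "\<lambda>k. restrict k {..<s}"])
    show "\<forall>k\<in>int_vecs s. restrict (ext k) {..<s} = k"
    proof
      fix k assume "k \<in> int_vecs s"
      moreover have "restrict (ext k) {..<s} \<in> int_vecs s"
        by (simp add: int_vecs_def restrict_PiE_iff)
      moreover have "restrict (ext k) {..<s} j = k j" if "j < s" for j
        using s that by (simp add: ext_def)
      ultimately show "restrict (ext k) {..<s} = k" by (intro int_vecs_eqI)
    qed
    show "\<forall>k\<in>freqs_upto s. ext (restrict k {..<s}) = k"
    proof
      fix k assume "k \<in> freqs_upto s"
      then show "ext (restrict k {..<s}) = k"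
        by (intro int_vecs_eqI[OF ext_int]) (auto simp: ext_def freqs_upto_def)
    qed
    show "ext ` int_vecs s \<subseteq> freqs_upto s"
      using ext_int by (auto simp: freqs_upto_def ext_def)
    show "(\<lambda>k. restrict k {..<s}) ` freqs_upto s \<subseteq> int_vecs s"
      by (simp add: image_subset_iff int_vecs_def restrict_PiE_iff)
  qed
  have ext_zero: "ext k = zero_vec d \<longleftrightarrow> k = zero_vec s" if "k \<in> int_vecs s" for k
  proof
    assume e: "ext k = zero_vec d"
    show "k = zero_vec s"
    proof (rule int_vecs_eqI[OF that])
      fix j assume "j < s"
      then show "k j = zero_vec s j" using fun_cong[OF e, of j] s by (simp add: ext_def)
    qed simp
  next
    assume "k = zero_vec s"
    then show "ext k = zero_vec d"
      by (intro int_vecs_eqI[OF ext_int]) (auto simp: ext_def)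
  qed
  have b: "bij_betw ext {k \<in> int_vecs s. k \<noteq> zero_vec s \<and> [int_dot s k g = 0] (mod int N)}
      {k \<in> freqs_upto s. k \<noteq> zero_vec d \<and> int N dvd int_dot d k g}"
    by (rule bij_betw_Collect[OF bij]) (simp add: ext_zero dot cong_0_iff)
  have eqs: "{k \<in> int_vecs s. k \<noteq> zero_vec s \<and> [int_dot s k g = 0] (mod int N)} =
      {k \<in> int_vecs s - {zero_vec s}. [int_dot s k g = 0] (mod int N)}"
    "{k \<in> freqs_upto s. k \<noteq> zero_vec d \<and> int N dvd int_dot d k g} =
      {k \<in> freqs_upto s - {zero_vec d}. int N dvd int_dot d k g}"
    by auto
  have bij: "bij_betw ext {k \<in> int_vecs s - {zero_vec s}. [int_dot s k g = 0] (mod int N)}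
      {k \<in> freqs_upto s - {zero_vec d}. int N dvd int_dot d k g}"
    using b unfolding eqs .
  show ?thesis
    unfolding cbc_P_def infsum_reindex_bij_betw[OF bij, symmetric]
    by (simp add: r flip: inverse_square_eq_omega_powr)
qed

lemma omega_scale:
  assumes s: "s < d" and k: "k s \<noteq> 0"
  shows "omega (k(s := int N * k s)) = real N powr (- \<alpha> * l) * omega k"
proof -
  have "korobov_r d \<alpha> \<gamma> (k(s := int N * k s)) =
      korobov_factor \<alpha> (\<gamma> s) (int N * k s) * (\<Prod>j\<in>{..<d} - {s}. korobov_factor \<alpha> (\<gamma> j) (k j))"
    unfolding korobov_r_eq_prod using s by (subst prod.remove[of _ s]) (auto intro!: prod.cong)
  also have "korobov_factor \<alpha> (\<gamma> s) (int N * k s) = real N powr \<alpha> * korobov_factor \<alpha> (\<gamma> s) (k s)"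
    using k N_gt_1 by (simp add: korobov_factor_def abs_mult powr_mult)
  also have "\<dots> * (\<Prod>j\<in>{..<d} - {s}. korobov_factor \<alpha> (\<gamma> j) (k j)) = real N powr \<alpha> * korobov_r d \<alpha> \<gamma> k"
    unfolding korobov_r_eq_prod using s by (subst (2) prod.remove[of _ s]) auto
  finally have r: "korobov_r d \<alpha> \<gamma> (k(s := int N * k s)) = real N powr \<alpha> * korobov_r d \<alpha> \<gamma> k" .
  show ?thesis
    unfolding omega_def r powr_mult powr_powr by simp
qed

text \<open>The averaging step. For a frequency \<open>k\<close> with \<open>k s\<close> not
  divisible by \<open>N\<close> at most one choice of the new component makes \<open>k\<close> a
  dual lattice point, and none if the contribution of the other components vanishes modulo
  \<open>N\<close>. If \<open>k s\<close> is divisible by \<open>N\<close>, all choices do or none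
  does, according to whether that contribution vanishes; but such \<open>k\<close> arise by
  scaling from arbitrary frequencies with vanishing contribution, at the cost of a factor \<open>N
  powr (- \<alpha> * l) \<le> 1 / (N - 1)\<close>.\<close>

lemma exists_good_component:
  assumes s: "s < d"
  shows "\<exists>z\<in>{1..int N - 1}.
    infsum omega {k \<in> freqs_upto (Suc s). k s \<noteq> 0 \<and> int N dvd int_dot d k (g(s := z))}
      \<le> (infsum omega (freqs_upto (Suc s)) - infsum omega (freqs_upto s)) / (real N - 1)"
proof (rule ccontr)
  let ?I = "{1..int N - 1}"
  define c where "c = (\<lambda>k::nat \<Rightarrow> int. \<Sum>j\<in>{..<d} - {s}. k j * g j)"
  have dot: "int_dot d k (g(s := z)) = c k + k s * z" for k z
    unfolding int_dot_def c_def using s by (subst sum.remove[of _ s]) auto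
  define Y where "Y = {k \<in> freqs_upto (Suc s). k s \<noteq> 0}"
  define Z where "Z = (\<lambda>z. {k \<in> Y. int N dvd c k + k s * z})"
  define A where "A = (\<lambda>z. {k \<in> Y. \<not> int N dvd k s \<and> int N dvd c k + k s * z})"
  define D where "D = {k \<in> Y. int N dvd k s \<and> int N dvd c k}"
  define Y0 where "Y0 = {k \<in> Y. int N dvd c k}"
  have Ysub: "Y \<subseteq> int_vecs d" by (auto simp: Y_def freqs_upto_def)
  then have sub: "A z \<subseteq> int_vecs d" "D \<subseteq> int_vecs d" "Y0 \<subseteq> int_vecs d" "Y - Y0 \<subseteq> int_vecs d" for z
    by (auto simp: A_def D_def Y0_def)
  have Y: "infsum omega Y = infsum omega (freqs_upto (Suc s)) - infsum omega (freqs_upto s)"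
  proof -
    have "freqs_upto (Suc s) = freqs_upto s \<union> Y"
      using s by (auto simp: freqs_upto_def Y_def Suc_le_eq)
    moreover have "freqs_upto s \<inter> Y = {}" using s by (auto simp: freqs_upto_def Y_def)
    ultimately show ?thesis
      using infsum_omega_Un[of "freqs_upto s" Y] Ysub freqs_upto_subset[of s] by simp
  qed
  have pN: "prime (int N)" using N by (simp add: prime_int_nat_transfer)
  have Z: "infsum omega (Z z) = infsum omega (A z) + infsum omega D" for z
  proof -
    have "Z z = A z \<union> D" by (auto simp: Z_def A_def D_def dvd_add_left_iff)
    moreover have "A z \<inter> D = {}" by (auto simp: A_def D_def)
    ultimately show ?thesis using infsum_omega_Un sub by simp
  qed
  have "(\<Sum>z\<in>?I. infsum omega (A z)) = infsum omega (\<Union>z\<in>?I. A z)"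
  proof (rule sum_infsum)
    fix z z' assume z: "z \<in> ?I" "z' \<in> ?I" "z \<noteq> z'"
    show "A z \<inter> A z' = {}"
    proof (rule ccontr)
      assume "A z \<inter> A z' \<noteq> {}"
      then obtain k where k: "\<not> int N dvd k s" "int N dvd c k + k s * z" "int N dvd c k + k s * z'"
        by (auto simp: A_def)
      have "int N dvd k s * (z - z')"
        using dvd_diff[OF k(2,3)] by (simp add: right_diff_distrib)
      then have "int N dvd z - z'" using k(1) pN prime_dvd_mult_iff by blast
      then show False using eq_if_dvd_diff z by blast
    qed
  qed (use summable_omega sub in auto)
  also have "\<dots> \<le> infsum omega (Y - Y0)"
  proof (rule infsum_omega_mono[OF _ sub(4)])
    show "(\<Union>z\<in>?I. A z) \<subseteq> Y - Y0"
    proof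
      fix k assume "k \<in> (\<Union>z\<in>?I. A z)"
      then obtain z where z: "z \<in> ?I" and k: "k \<in> Y" "\<not> int N dvd k s" "int N dvd c k + k s * z"
        by (auto simp: A_def)
      have "\<not> int N dvd z" using z zdvd_imp_le[of "int N" z] by auto
      then have "\<not> int N dvd k s * z" using k(2) pN prime_dvd_mult_iff by blast
      then have "\<not> int N dvd c k" using k(3) dvd_add_right_iff by blast
      then show "k \<in> Y - Y0" using k by (auto simp: Y0_def)
    qed
  qed
  finally have sumA: "(\<Sum>z\<in>?I. infsum omega (A z)) \<le> infsum omega (Y - Y0)" .
  have sumD: "(real N - 1) * infsum omega D \<le> infsum omega Y0"
  proof -
    (* scaling the coordinate s by N maps the frequencies with vanishing contribution onto D *)
    let ?\<sigma> = "\<lambda>k::nat \<Rightarrow> int. k(s := int N * k s)"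
    have c_upd: "c (k(s := x)) = c k" for k x
      unfolding c_def by (intro sum.cong) auto
    have "bij_betw ?\<sigma> Y0 D"
    proof (rule bij_betw_byWitness[where f' = "\<lambda>k. k(s := k s div int N)"])
      show "?\<sigma> ` Y0 \<subseteq> D"
        using s N_gt_1 by (auto simp: D_def Y0_def Y_def freqs_upto_def int_vecs_def c_upd PiE_iff extensional_def)
      show "(\<lambda>k. k(s := k s div int N)) ` D \<subseteq> Y0"
        using s N_gt_1 by (auto simp: D_def Y0_def Y_def freqs_upto_def int_vecs_def c_upd PiE_iff extensional_def)
    qed (use N_gt_1 in \<open>auto simp: D_def\<close>)
    then have "infsum omega D = (\<Sum>\<^sub>\<infinity>k\<in>Y0. omega (?\<sigma> k))"
      by (rule infsum_reindex_bij_betw[symmetric])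
    also have "\<dots> = (\<Sum>\<^sub>\<infinity>k\<in>Y0. real N powr (- \<alpha> * l) * omega k)"
      by (rule infsum_cong) (auto simp: Y0_def Y_def omega_scale[OF s])
    also have "\<dots> = real N powr (- \<alpha> * l) * infsum omega Y0"
      by (rule infsum_cmult_right') 
    finally have D: "infsum omega D = real N powr (- \<alpha> * l) * infsum omega Y0" .
    have "(real N - 1) * real N powr (- \<alpha> * l) \<le> real N * real N powr (- 1)"
      using N_gt_1 l by (intro mult_mono powr_mono) auto
    also have "\<dots> = 1" using N_gt_1 by (simp add: powr_minus)
    finally have "(real N - 1) * real N powr (- \<alpha> * l) * infsum omega Y0 \<le> 1 * infsum omega Y0"
      by (intro mult_right_mono infsum_nonneg) auto
    then show ?thesis by (simp add: D mult.assoc)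
  qed
  have "(\<Sum>z\<in>?I. infsum omega (Z z)) = (\<Sum>z\<in>?I. infsum omega (A z)) + (real N - 1) * infsum omega D"
    using N_gt_1 by (simp add: Z sum.distrib of_nat_diff)
  also have "\<dots> \<le> infsum omega (Y - Y0) + infsum omega Y0" using sumA sumD by simp
  also have "\<dots> = infsum omega Y"
  proof -
    have "Y - Y0 \<union> Y0 = Y" by (auto simp: Y0_def)
    moreover have "(Y - Y0) \<inter> Y0 = {}" by blast
    ultimately show ?thesis using infsum_omega_Un[of "Y - Y0" Y0] sub by simp
  qed
  finally have le: "(\<Sum>z\<in>?I. infsum omega (Z z)) \<le> infsum omega Y" .
  have Zeq: "{k \<in> freqs_upto (Suc s). k s \<noteq> 0 \<and> int N dvd int_dot d k (g(s := z))} = Z z" for z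
    by (auto simp: Z_def Y_def dot)
  assume "\<not> ?thesis"
  then have gt: "infsum omega Y / (real N - 1) < infsum omega (Z z)" if "z \<in> ?I" for z
    using that unfolding Zeq Y by (auto simp: not_le)
  have "(\<Sum>z\<in>?I. infsum omega Y / (real N - 1)) < (\<Sum>z\<in>?I. infsum omega (Z z))"
    by (rule sum_strict_mono) (use gt N_gt_1 in auto)
  moreover have "(\<Sum>z\<in>?I. infsum omega Y / (real N - 1)) = infsum omega Y"
    using N_gt_1 by (simp add: of_nat_diff)
  ultimately show False using le by simp
qed

lemma infsum_omega_freqs_upto_0: "infsum omega (freqs_upto 0) = 1"
proof -
  have "freqs_upto 0 = {zero_vec d}"
    using int_vecs_neq_zero_iff by (auto simp: freqs_upto_def)
  then show ?thesis by (simp add: omega_def)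
qed

text \<open>The induction starts with no coordinates at all: the first component is a minimizer
  like the others, because every value from \<open>1\<close> to \<open>N - 1\<close> gives the
  same dual lattice in dimension one. In the step, \<open>cbc_P\<close> grows by the contribution
  of the frequencies with \<open>k s \<noteq> 0\<close>, and \<open>powr_add_le\<close> merges
  both bounds.\<close>

lemma cbc_P_le:
  assumes cbc: "cbc_output d \<alpha> \<gamma> N g" and s: "s \<le> d"
  shows "cbc_P s \<alpha> \<gamma> N g \<le> ((infsum omega (freqs_upto s) - 1) / (real N - 1)) powr (2 / l)"
  using s
proof (induction s)
  case 0
  have "{k \<in> freqs_upto 0 - {zero_vec d}. int N dvd int_dot d k g} = {}"
    using int_vecs_neq_zero_iff by (auto simp: freqs_upto_def)
  then show ?case by (simp only: cbc_P_eq_infsum_omega[OF 0] infsum_empty) simp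
next
  case (Suc s)
  then have s: "s < d" by simp
  let ?e = "2 / l" and ?W = "\<lambda>s. infsum omega (freqs_upto s)"
  obtain z where z: "z \<in> {1..int N - 1}"
    and T: "infsum omega {k \<in> freqs_upto (Suc s). k s \<noteq> 0 \<and> int N dvd int_dot d k (g(s := z))}
      \<le> (?W (Suc s) - ?W s) / (real N - 1)"
    using exists_good_component[OF s, of g] by blast
  have "cbc_P (Suc s) \<alpha> \<gamma> N g \<le> cbc_P (Suc s) \<alpha> \<gamma> N (g(s := z))"
  proof (cases "s = 0")
    case True
    have "int_dot (Suc s) k g = k 0 * g 0" "int_dot (Suc s) k (g(s := z)) = k 0 * z" for k
      using True by (simp_all add: int_dot_def)
    moreover have "g 0 = 1" using cbc by (simp add: cbc_output_def)
    moreover have "int N dvd k * z \<longleftrightarrow> int N dvd k" for k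
    proof -
      have "\<not> int N dvd z" using z zdvd_imp_le[of "int N" z] by auto
      then show ?thesis using N by (simp add: prime_dvd_mult_iff prime_int_nat_transfer)
    qed
    ultimately show ?thesis unfolding cbc_P_def by (simp add: cong_0_iff)
  next
    case False
    then have "is_arg_min (\<lambda>z. cbc_P (Suc s) \<alpha> \<gamma> N (g(s := z))) (\<lambda>z. z \<in> {1..int N - 1}) (g s)"
      using cbc s unfolding cbc_output_def by auto
    then have "cbc_P (Suc s) \<alpha> \<gamma> N (g(s := g s)) \<le> cbc_P (Suc s) \<alpha> \<gamma> N (g(s := z))"
      using z by (simp only: is_arg_min_linorder)
    then show ?thesis by simp
  qed
  also have "\<dots> = cbc_P s \<alpha> \<gamma> N g + (\<Sum>\<^sub>\<infinity>k\<in>{k \<in> freqs_upto (Suc s). k s \<noteq> 0 \<and>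
      int N dvd int_dot d k (g(s := z))}. omega k powr ?e)"
  proof -
    let ?A = "{k \<in> freqs_upto s - {zero_vec d}. int N dvd int_dot d k g}"
    let ?B = "{k \<in> freqs_upto (Suc s). k s \<noteq> 0 \<and> int N dvd int_dot d k (g(s := z))}"
    have dot: "int_dot d k (g(s := z)) = int_dot d k g" if "k s = 0" for k
      unfolding int_dot_def using that by (intro sum.cong) auto
    have mem: "k \<in> freqs_upto (Suc s) \<and> k s = 0 \<longleftrightarrow> k \<in> freqs_upto s" for k
      using s by (auto simp: freqs_upto_def Suc_le_eq)
    have "k \<in> freqs_upto (Suc s) - {zero_vec d} \<and> int N dvd int_dot d k (g(s := z)) \<longleftrightarrow> k \<in> ?A \<union> ?B" for k
    proof (cases "k s = 0")
      case True
      then show ?thesis using mem[of k] dot[of k] by simp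
    next
      case False
      then have "k \<noteq> zero_vec d" using s by auto
      with False show ?thesis using mem[of k] by simp
    qed
    then have "{k \<in> freqs_upto (Suc s) - {zero_vec d}. int N dvd int_dot d k (g(s := z))} = ?A \<union> ?B"
      by blast
    moreover have "?A \<inter> ?B = {}" using s by (auto simp: freqs_upto_def)
    moreover have "?A \<subseteq> int_vecs d" "?B \<subseteq> int_vecs d" by (auto simp: freqs_upto_def)
    ultimately show ?thesis
      using s by (simp add: cbc_P_eq_infsum_omega infsum_Un_disjoint summable_omega_powr(1))
  qed
  also have "\<dots> \<le> ((?W s - 1) / (real N - 1)) powr ?e + ((?W (Suc s) - ?W s) / (real N - 1)) powr ?e"
    using Suc T by (intro add_mono summable_omega_powr(2)) (auto simp: freqs_upto_def)
  also have "\<dots> \<le> ((?W s - 1) / (real N - 1) + (?W (Suc s) - ?W s) / (real N - 1)) powr ?e"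
  proof (rule powr_add_le)
    have "?W 0 \<le> ?W s" "?W s \<le> ?W (Suc s)"
      by (rule infsum_omega_mono; auto simp: freqs_upto_def)+
    then show "0 \<le> (?W s - 1) / (real N - 1)" "0 \<le> (?W (Suc s) - ?W s) / (real N - 1)"
      using N_gt_1 by (simp_all add: infsum_omega_freqs_upto_0)
  qed (use l l_pos in simp)
  also have "(?W s - 1) / (real N - 1) + (?W (Suc s) - ?W s) / (real N - 1) = (?W (Suc s) - 1) / (real N - 1)"
    by (simp add: add_divide_distrib[symmetric])
  finally show ?case .
qed

text \<open>A single dual lattice point of weight below \<open>M\<close> would contribute more to
  \<open>cbc_P\<close> than the bound on the whole sum allows. The loss from \<open>N - 1\<close>
  to \<open>N / 2\<close> is harmless, as \<open>N \<ge> 2\<close>.\<close>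

lemma korobov_r_ge_if_cbc_output:
  assumes cbc: "cbc_output d \<alpha> \<gamma> N g" and M: "M > 0"
    and Ml: "M powr l * euler_prod d \<alpha> \<gamma> l \<le> real N / 2"
    and k: "k \<in> dual_lattice d N g - {zero_vec d}"
  shows "korobov_r d \<alpha> \<gamma> k \<ge> M"
proof (rule ccontr)
  let ?r = "korobov_r d \<alpha> \<gamma> k" and ?W = "euler_prod d \<alpha> \<gamma> l"
  assume "\<not> ?thesis"
  then have r: "1 \<le> ?r" "?r < M" using korobov_r_ge_1[OF w, of \<alpha> k] \<alpha> by auto
  have W1: "?W \<ge> 1" by (rule euler_prod_ge_1[OF w l(1)])
  let ?K = "{k \<in> freqs_upto d - {zero_vec d}. int N dvd int_dot d k g}"
  have kK: "k \<in> ?K"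
    using k by (auto simp: dual_lattice_def freqs_upto_def cong_0_iff int_dot_def mult.commute)
  have full: "infsum omega (freqs_upto d) \<le> ?W"
    by (rule infsum_le_finite_sums[OF summable_omega[OF freqs_upto_subset]])
       (use freqs_upto_subset in \<open>auto simp: omega_def intro!: sum_korobov_r_le[OF w l(1)]\<close>)
  have ge1: "infsum omega (freqs_upto d) \<ge> 1"
    using infsum_omega_mono[of "freqs_upto 0" "freqs_upto d"]
    by (auto simp: freqs_upto_def simp flip: infsum_omega_freqs_upto_0)
  have "omega k powr (2 / l) \<le> cbc_P d \<alpha> \<gamma> N g"
    unfolding cbc_P_eq_infsum_omega[OF order_refl]
    using finite_sum_le_infsum[OF summable_omega_powr(1), of ?K "{k}"] kK
    by (auto simp: freqs_upto_def)
  also have "\<dots> \<le> ((infsum omega (freqs_upto d) - 1) / (real N - 1)) powr (2 / l)"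
    by (rule cbc_P_le[OF cbc order_refl])
  finally have "(omega k powr (2 / l)) powr (l / 2) \<le>
      (((infsum omega (freqs_upto d) - 1) / (real N - 1)) powr (2 / l)) powr (l / 2)"
    using l_pos by (intro powr_mono2[of "l / 2"]) auto
  moreover have "(x powr (2 / l)) powr (l / 2) = x" if "x \<ge> 0" for x
    using that l_pos by (simp add: powr_powr)
  moreover have "(infsum omega (freqs_upto d) - 1) / (real N - 1) \<ge> 0"
    using ge1 N_gt_1 by simp
  ultimately have "omega k \<le> (infsum omega (freqs_upto d) - 1) / (real N - 1)"
    by (simp only: omega_nonneg)
  also have "\<dots> \<le> (?W - 1) / (real N - 1)"
    using full N_gt_1 by (intro divide_right_mono) auto
  also have "\<dots> < ?W / (real N - 1)" using N_gt_1 by (intro divide_strict_right_mono) auto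
  also have "\<dots> \<le> ?W / (real N / 2)" using N_gt_1 W1 by (intro divide_left_mono) auto
  also have "\<dots> \<le> 1 / M powr l"
    using Ml M N_gt_1 W1 by (simp add: field_simps)
  also have "\<dots> \<le> omega k"
    unfolding omega_def powr_minus_divide using r l_pos
    by (intro divide_left_mono powr_mono2) auto
  finally show False by simp
qed

end

section \<open>The threshold\<close>

lemma continuous_on_real_zeta:
  assumes a: "a > 1"
  shows "continuous_on {a..} real_zeta"
proof -
  have "uniform_limit {a..} (\<lambda>m s. \<Sum>n<m. 1 / real (Suc n) powr s) (\<lambda>s. \<Sum>n. 1 / real (Suc n) powr s) sequentially"
  proof (rule Weierstrass_m_test)
    show "norm (1 / real (Suc n) powr s) \<le> 1 / real (Suc n) powr a" if "s \<in> {a..}" for n s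
      using that by (auto intro!: divide_left_mono powr_mono)
  qed (rule summable_zeta[OF a])
  then have "continuous_on {a..} (\<lambda>s. \<Sum>n. 1 / real (Suc n) powr s)"
    by (rule uniform_limit_theorem[rotated])
       (auto intro!: continuous_intros always_eventually simp del: of_nat_Suc)
  then show ?thesis by (simp add: real_zeta_def[abs_def])
qed

text \<open>Some partial sum of the harmonic series exceeds \<open>Z\<close>, and the
  corresponding partial sum of the zeta series is continuous at \<open>1\<close>.\<close>

lemma real_zeta_large_near_1:
  "\<exists>e>0. \<forall>s. 1 < s \<and> s < 1 + e \<longrightarrow> real_zeta s > Z"
proof -
  obtain m where m: "harm m > Z"
    using harm_at_top unfolding filterlim_at_top_dense eventually_sequentially by blast
  let ?h = "\<lambda>s. \<Sum>n<m. 1 / real (Suc n) powr s"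
  have "?h 1 = harm m"
    by (simp add: harm_def inverse_eq_divide sum.atLeast1_atMost_eq lessThan_atLeast0 atLeastLessThanSuc_atLeastAtMost
        del: of_nat_Suc)
  then have "?h 1 > Z" using m by simp
  moreover have "isCont ?h 1" by (intro continuous_intros) auto
  ultimately have "eventually (\<lambda>s. ?h s > Z) (at 1)"
    unfolding isCont_def by (rule order_tendstoD(1)[rotated])
  then obtain e where e: "e > 0" "\<And>s. s \<noteq> 1 \<Longrightarrow> dist s 1 < e \<Longrightarrow> ?h s > Z"
    unfolding eventually_at by auto
  have "real_zeta s > Z" if s: "1 < s" "s < 1 + e" for s
  proof -
    have "?h s > Z" using s by (intro e(2)) (auto simp: dist_real_def)
    also have "?h s \<le> real_zeta s" by (rule sum_le_real_zeta[OF s(1)])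
    finally show ?thesis .
  qed
  then show ?thesis using e(1) by blast
qed

text \<open>The function whose maximum over \<open>l\<close> is the threshold.\<close>

definition threshold_val :: "nat \<Rightarrow> real \<Rightarrow> (nat \<Rightarrow> real) \<Rightarrow> real \<Rightarrow> real \<Rightarrow> real" where
  "threshold_val d \<alpha> \<gamma> c l = (c / euler_prod d \<alpha> \<gamma> l) powr (1 / l)"

lemma threshold_eq: "threshold d \<alpha> \<gamma> c = (GREATEST x. x \<in> threshold_val d \<alpha> \<gamma> c ` {1 / \<alpha> <.. 2})"
proof -
  have "(\<Prod>j<d. inverse (1 + 2 * \<gamma> j powr l * real_zeta (\<alpha> * l))) = inverse (euler_prod d \<alpha> \<gamma> l)" for l
    unfolding euler_prod_def by (rule prod_inversef[unfolded o_def])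
  then show ?thesis
    unfolding threshold_def threshold_val_def by (simp add: divide_inverse)
qed

text \<open>The maximum over the half-open interval is attained: the function is continuous, and
  as \<open>l\<close> decreases to \<open>1 / \<alpha>\<close>, the pole of the zeta function
  makes it smaller than its value at \<open>2\<close>.\<close>

lemma threshold_attained:
  assumes w: "pos_weights d \<gamma>" and \<alpha>: "\<alpha> > 1 / 2" and d: "d \<ge> 1" and c: "c > 0"
  obtains l where "1 / \<alpha> < l" "l \<le> 2" "threshold d \<alpha> \<gamma> c = threshold_val d \<alpha> \<gamma> c l"
    and "\<And>l'. 1 / \<alpha> < l' \<Longrightarrow> l' \<le> 2 \<Longrightarrow> threshold_val d \<alpha> \<gamma> c l' \<le> threshold d \<alpha> \<gamma> c"
proof -
  let ?f = "threshold_val d \<alpha> \<gamma> c" and ?W = "euler_prod d \<alpha> \<gamma>"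
  have gt1: "\<alpha> * l > 1" if "l > 1 / \<alpha>" for l
    using that \<alpha> by (simp add: field_simps)
  have W1: "?W l \<ge> 1" if "l > 1 / \<alpha>" for l
    by (rule euler_prod_ge_1[OF w gt1[OF that]])
  have two: "1 / \<alpha> < 2" using \<alpha> by (simp add: field_simps)
  define y where "y = ?f 2"
  have y: "y > 0" using c W1[OF two] by (simp add: y_def threshold_val_def)
  (* a lower bound for y powr l, uniform in 0 < l \<le> 2 *)
  define \<mu> where "\<mu> = min 1 (y\<^sup>2)"
  have \<mu>: "\<mu> > 0" using y by (simp add: \<mu>_def)
  have g0: "0 < \<gamma> 0" "\<gamma> 0 \<le> 1" using w d by (auto simp: pos_weights_def)
  obtain e where e: "e > 0" "\<And>s. 1 < s \<Longrightarrow> s < 1 + e \<Longrightarrow> real_zeta s > c / (2 * (\<gamma> 0)\<^sup>2 * \<mu>)"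
    using real_zeta_large_near_1 by blast
  define a where "a = min 2 ((1 + e / 2) / \<alpha>)"
  have a: "1 / \<alpha> < a" "a \<le> 2"
    using two e(1) \<alpha> by (auto simp: a_def field_simps)
  have small: "?f l \<le> y" if l: "1 / \<alpha> < l" "l < a" for l
  proof -
    have l': "0 < l" "l \<le> 2" using l a \<alpha> by (auto intro: less_trans[of 0 "1 / \<alpha>" l])
    have "l < (1 + e / 2) / \<alpha>" using l(2) by (simp add: a_def)
    then have "\<alpha> * l < 1 + e / 2" using \<alpha> by (simp add: field_simps)
    then have z: "real_zeta (\<alpha> * l) > c / (2 * (\<gamma> 0)\<^sup>2 * \<mu>)" using gt1[OF l(1)] e by simp
    have "c / \<mu> = 2 * (\<gamma> 0)\<^sup>2 * (c / (2 * (\<gamma> 0)\<^sup>2 * \<mu>))" using g0 by simp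
    also have "\<dots> \<le> 2 * (\<gamma> 0)\<^sup>2 * real_zeta (\<alpha> * l)" using z by (intro mult_left_mono) auto
    also have "\<dots> \<le> 2 * \<gamma> 0 powr l * real_zeta (\<alpha> * l)"
    proof (intro mult_right_mono mult_left_mono)
      have "\<gamma> 0 powr 2 \<le> \<gamma> 0 powr l" using g0 l' by (intro powr_mono') auto
      then show "(\<gamma> 0)\<^sup>2 \<le> \<gamma> 0 powr l" using g0 by (simp add: powr_numeral)
    qed (use real_zeta_ge_1[OF gt1[OF l(1)]] in auto)
    also have "\<dots> \<le> 1 + 2 * \<gamma> 0 powr l * real_zeta (\<alpha> * l)" by simp
    also have "\<dots> \<le> ?W l"
    proof -
      let ?g = "\<lambda>j. 1 + 2 * \<gamma> j powr l * real_zeta (\<alpha> * l)"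
      have g1: "?g j \<ge> 1" for j using real_zeta_ge_1[OF gt1[OF l(1)]] by simp
      have "?W l = ?g 0 * (\<Prod>j\<in>{..<d} - {0}. ?g j)"
        unfolding euler_prod_def using d by (subst prod.remove[of _ 0]) auto
      moreover have "(\<Prod>j\<in>{..<d} - {0}. ?g j) \<ge> 1" using g1 by (intro prod_ge_1) auto
      ultimately show ?thesis using g1[of 0] mult_left_mono[of 1 _ "?g 0"] by simp
    qed
    finally have "c / \<mu> \<le> ?W l" .
    then have "c / ?W l \<le> \<mu>" using \<mu> W1[OF l(1)] by (simp add: field_simps)
    also have "\<mu> \<le> y powr l"
    proof (cases "y \<ge> 1")
      case True
      then have "1 \<le> y powr l" using l' by (intro ge_one_powr_ge_zero) auto
      then show ?thesis by (simp add: \<mu>_def)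
    next
      case False
      then have "y powr 2 \<le> y powr l" using y l' by (intro powr_mono') auto
      then show ?thesis using y by (simp add: \<mu>_def powr_numeral)
    qed
    finally have "?f l \<le> (y powr l) powr (1 / l)"
      unfolding threshold_val_def using c W1[OF l(1)] l' by (intro powr_mono2) auto
    also have "\<dots> = y" using y l' by (simp add: powr_powr)
    finally show ?thesis .
  qed
  have Wpos: "?W l > 0" if "l \<in> {a..2}" for l
  proof -
    have "1 / \<alpha> < l" using that a(1) by simp
    then show ?thesis using W1[of l] by linarith
  qed
  have "continuous_on {a..2} ?f"
    unfolding threshold_val_def
  proof (intro continuous_intros)
    show "continuous_on {a..2} ?W"
      unfolding euler_prod_def
    proof (intro continuous_intros)
      show "continuous_on {a..2} (\<lambda>l. real_zeta (\<alpha> * l))"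
        by (rule continuous_on_compose2[OF continuous_on_real_zeta[OF gt1[OF a(1)]]])
           (use \<alpha> in \<open>auto intro!: continuous_intros mult_left_mono\<close>)
      show "\<forall>l\<in>{a..2}. \<gamma> j \<noteq> 0" if "j \<in> {..<d}" for j
        using w that by (force simp: pos_weights_def)
    qed
    show "\<forall>l\<in>{a..2}. ?W l \<noteq> 0" using Wpos by force
    show "\<forall>l\<in>{a..2}. c / ?W l \<noteq> 0" using Wpos c by force
    show "\<forall>l\<in>{a..2}. l \<noteq> 0" using a \<alpha> less_trans[of 0 "1 / \<alpha>" a] by auto
  qed
  then obtain l where l: "l \<in> {a..2}" "\<And>l'. l' \<in> {a..2} \<Longrightarrow> ?f l' \<le> ?f l"
    using continuous_attains_sup[of "{a..2}" ?f] a by auto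
  have max: "?f l' \<le> ?f l" if "1 / \<alpha> < l'" "l' \<le> 2" for l'
  proof (cases "l' < a")
    case True
    have "?f l' \<le> y" by (rule small[OF that(1) True])
    also have "\<dots> \<le> ?f l" unfolding y_def using a by (intro l(2)) auto
    finally show ?thesis .
  qed (use l(2) that in auto)
  have la: "1 / \<alpha> < l" "l \<le> 2" using l a by auto
  have "threshold d \<alpha> \<gamma> c = ?f l"
    unfolding threshold_eq
    by (rule Greatest_equality) (use la max in auto)
  with la max show ?thesis by (intro that[of l]) auto
qed

lemma threshold_equation:
  assumes w: "pos_weights d \<gamma>" and \<alpha>: "\<alpha> > 1 / 2" and d: "d \<ge> 1" and c: "c > 0"
  obtains l where "\<alpha> * l > 1" "l \<le> 2" "threshold d \<alpha> \<gamma> c powr l * euler_prod d \<alpha> \<gamma> l = c"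
    "threshold d \<alpha> \<gamma> c > 0"
proof -
  obtain l where l: "1 / \<alpha> < l" "l \<le> 2" "threshold d \<alpha> \<gamma> c = threshold_val d \<alpha> \<gamma> c l"
    using threshold_attained[OF assms] by blast
  have \<alpha>l: "\<alpha> * l > 1" using l \<alpha> by (simp add: field_simps)
  have W: "euler_prod d \<alpha> \<gamma> l \<ge> 1" by (rule euler_prod_ge_1[OF w \<alpha>l])
  have l0: "l > 0" using l \<alpha> less_trans[of 0 "1 / \<alpha>" l] by simp
  have "threshold d \<alpha> \<gamma> c powr l = c / euler_prod d \<alpha> \<gamma> l"
    using c W l0 unfolding l(3) threshold_val_def by (simp add: powr_powr)
  then show ?thesis
    using W c l \<alpha>l by (intro that[of l]) (auto simp: threshold_val_def)
qed

text \<open>The maximizing exponent exceeds \<open>1 / \<alpha>\<close>, and the product is at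
  least \<open>1\<close>.\<close>

lemma threshold_le:
  assumes w: "pos_weights d \<gamma>" and \<alpha>: "\<alpha> > 1 / 2" and d: "d \<ge> 1" and c: "c > 0" "c \<le> real N" "N \<ge> 1"
  shows "threshold d \<alpha> \<gamma> c \<le> real N powr \<alpha>"
proof -
  obtain l where l: "\<alpha> * l > 1" "l \<le> 2" "threshold d \<alpha> \<gamma> c powr l * euler_prod d \<alpha> \<gamma> l = c"
      "threshold d \<alpha> \<gamma> c > 0"
    using threshold_equation[OF w \<alpha> d c(1)] by blast
  let ?M = "threshold d \<alpha> \<gamma> c"
  have l0: "l > 0"
  proof (rule ccontr)
    assume "\<not> l > 0"
    then have "\<alpha> * l \<le> 0" using \<alpha> by (simp add: mult_le_0_iff)
    with l(1) show False by simp
  qed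
  have "?M powr l * 1 \<le> ?M powr l * euler_prod d \<alpha> \<gamma> l"
    using euler_prod_ge_1[OF w l(1)] by (intro mult_left_mono) auto
  also have "\<dots> \<le> real N" using l(3) c(2) by simp
  finally have "(?M powr l) powr (1 / l) \<le> real N powr (1 / l)"
    using l0 by (intro powr_mono2) auto
  then have "?M \<le> real N powr (1 / l)" using l0 l(4) by (simp add: powr_powr)
  also have "\<dots> \<le> real N powr \<alpha>" using l0 l(1) c(3) by (intro powr_mono) (auto simp: field_simps)
  finally show ?thesis .
qed

text \<open>The threshold is a maximum, so it can be compared with the value at \<open>l = 1 /
  \<beta>\<close>.\<close>

lemma threshold_ge:
  assumes w: "pos_weights d \<gamma>" and \<alpha>: "\<alpha> > 1 / 2" and d: "d \<ge> 1" and c: "c > 0" "b \<le> c" "b \<ge> 0"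
    and \<beta>: "1 / 2 \<le> \<beta>" "\<beta> < \<alpha>"
  shows "threshold d \<alpha> \<gamma> c \<ge> (b / euler_prod d \<alpha> \<gamma> (1 / \<beta>)) powr \<beta>"
proof -
  have l: "1 / \<alpha> < 1 / \<beta>" "1 / \<beta> \<le> 2" using \<alpha> \<beta> by (auto simp: field_simps)
  have "\<alpha> * (1 / \<beta>) > 1" using \<beta> by (simp add: field_simps)
  then have W: "euler_prod d \<alpha> \<gamma> (1 / \<beta>) \<ge> 1" by (rule euler_prod_ge_1[OF w])
  then have "(b / euler_prod d \<alpha> \<gamma> (1 / \<beta>)) powr \<beta> \<le> (c / euler_prod d \<alpha> \<gamma> (1 / \<beta>)) powr \<beta>"
    using c \<beta> by (intro powr_mono2 divide_right_mono divide_nonneg_nonneg) auto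
  also have "\<dots> = threshold_val d \<alpha> \<gamma> c (1 / \<beta>)" using \<beta> by (simp add: threshold_val_def)
  also have "\<dots> \<le> threshold d \<alpha> \<gamma> c"
    using threshold_attained[OF w \<alpha> d c(1)] l by metis
  finally show ?thesis .
qed

section \<open>Asymptotics of the parameters\<close>

lemma affine_ln_le_powr:
  fixes x :: real
  assumes "x \<ge> 1" "\<eta> > 0" "a \<ge> 0" "b \<ge> 0"
  shows "a + b * ln x \<le> (a + b / \<eta>) * x powr \<eta>"
proof -
  have "ln x \<le> x powr \<eta> / \<eta>" using assms by (intro Transcendental.ln_powr_bound) auto
  then have "b * ln x \<le> b / \<eta> * x powr \<eta>" using assms mult_left_mono[of "ln x" "x powr \<eta> / \<eta>" b] by simp
  moreover have "a * 1 \<le> a * x powr \<eta>"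
    using assms by (intro mult_left_mono ge_one_powr_ge_zero) auto
  ultimately show ?thesis by (simp add: algebra_simps)
qed

text \<open>Since \<open>2 ^ (m0 - 1) < N\<close>, the number \<open>m0\<close> is logarithmic in
  \<open>N\<close>.\<close>

lemma R_star_le_powr:
  assumes \<epsilon>: "\<epsilon> > 0" and \<alpha>: "\<alpha> > 0"
  obtains C where "C > 0"
    "\<And>N m0 M. \<lbrakk>N \<ge> 1; m0 \<ge> 1; M > 0; M \<le> real N powr \<alpha>; 2 ^ (m0 - 1) < M powr (1 / \<alpha>)\<rbrakk>
      \<Longrightarrow> R_star d m0 \<le> C * real N powr \<epsilon>"
proof -
  define \<eta> where "\<eta> = \<epsilon> / real (Suc d)"
  have \<eta>: "\<eta> > 0" using \<epsilon> by (simp add: \<eta>_def)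
  define B where "B = 1 + real d + 2 / \<eta>"
  have B: "B > 0" using \<eta> by (simp add: B_def add_pos_nonneg)
  show ?thesis
  proof (rule that)
    show "1 + 3 ^ d * B ^ (d - 1) > 0" using B by (simp add: add_pos_nonneg)
    fix N m0 :: nat and M :: real
    assume N: "N \<ge> 1" and m0: "m0 \<ge> 1" and M: "M > 0" "M \<le> real N powr \<alpha>" and lt: "2 ^ (m0 - 1) < M powr (1 / \<alpha>)"
    have "M powr (1 / \<alpha>) \<le> (real N powr \<alpha>) powr (1 / \<alpha>)" using M \<alpha> by (intro powr_mono2) auto
    also have "\<dots> = real N" using \<alpha> N by (simp add: powr_powr)
    finally have "M powr (1 / \<alpha>) \<le> real N" .
    with lt have "2 ^ (m0 - 1) < real N" by (rule less_le_trans)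
    then have "ln (2 ^ (m0 - 1)) < ln (real N)" using N by (subst ln_less_cancel_iff) auto
    then have "real (m0 - 1) * ln 2 < ln (real N)" by (simp add: ln_realpow)
    moreover have "real (m0 - 1) * (1 / 2) \<le> real (m0 - 1) * ln 2"
      using ln2_ge_two_thirds by (intro mult_left_mono) auto
    ultimately have "real m0 \<le> 1 + 2 * ln (real N)" using m0 by (simp add: of_nat_diff)
    then have "real m0 + real d \<le> (1 + real d) + 2 * ln (real N)" by simp
    also have "\<dots> \<le> B * real N powr \<eta>"
      unfolding B_def using N \<eta> by (intro affine_ln_le_powr) auto
    finally have "(real m0 + real d) ^ (d - 1) \<le> (B * real N powr \<eta>) ^ (d - 1)"
      by (intro power_mono) auto
    also have "\<dots> = B ^ (d - 1) * real N powr (\<eta> * real (d - 1))"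
      using N by (simp add: power_mult_distrib powr_power mult.commute)
    also have "\<dots> \<le> B ^ (d - 1) * real N powr \<epsilon>"
    proof (intro mult_left_mono powr_mono)
      have "\<eta> * real (d - 1) \<le> \<eta> * real (Suc d)" using \<eta> by (intro mult_left_mono) auto
      then show "\<eta> * real (d - 1) \<le> \<epsilon>" by (simp add: \<eta>_def)
    qed (use N B in auto)
    finally have *: "(real m0 + real d) ^ (d - 1) \<le> B ^ (d - 1) * real N powr \<epsilon>" .
    have "R_star d m0 \<le> 1 + 3 ^ d * (B ^ (d - 1) * real N powr \<epsilon>)"
      unfolding R_star_def using * by (intro add_left_mono mult_mono) auto
    also have "1 \<le> 1 * real N powr \<epsilon>" using N \<epsilon> ge_one_powr_ge_zero[of "real N" \<epsilon>] by simp
    finally show "R_star d m0 \<le> (1 + 3 ^ d * B ^ (d - 1)) * real N powr \<epsilon>"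
      by (simp add: algebra_simps)
  qed
qed

lemma num_shifts_ge: "K > 0 \<Longrightarrow> N \<ge> 1 \<Longrightarrow> 2 * K * real R * ln (real N) \<le> real (num_shifts K N R)"
  unfolding num_shifts_def by (simp add: of_nat_nat ceiling_le_iff)

lemma num_shifts_pos: "K > 0 \<Longrightarrow> N > 2 \<Longrightarrow> R \<ge> 1 \<Longrightarrow> num_shifts K N R > 0"
proof -
  assume a: "K > 0" "N > 2" "R \<ge> 1"
  then have "ln (real N) > 0" by simp
  then have "2 * K * real R * ln (real N) > 0" using a by (intro mult_pos_pos) auto
  moreover have "2 * K * real R * ln (real N) \<le> real (num_shifts K N R)"
    using a by (intro num_shifts_ge) auto
  ultimately have "real (num_shifts K N R) > 0" by (rule less_le_trans)
  then show ?thesis by simp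
qed

lemma num_shifts_le_powr:
  assumes "K > 0" "N \<ge> 1" "R \<ge> 1" "\<epsilon> > 0"
  shows "real (num_shifts K N R) \<le> (1 + 2 * K / \<epsilon>) * real R * real N powr \<epsilon>"
proof -
  have "2 * K * real R * ln (real N) \<ge> 0" using assms by simp
  then have "real (num_shifts K N R) \<le> 2 * K * real R * ln (real N) + 1"
    unfolding num_shifts_def by (simp add: of_nat_nat)
  also have "\<dots> \<le> real R * (1 + 2 * K * ln (real N))"
    using assms by (simp add: algebra_simps)
  also have "\<dots> \<le> real R * ((1 + 2 * K / \<epsilon>) * real N powr \<epsilon>)"
    using assms by (intro mult_left_mono affine_ln_le_powr) auto
  finally show ?thesis by (simp add: mult_ac)
qed

text \<open>The dependence on \<open>R\<close> and \<open>S\<close> is polylogarithmic and is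
  absorbed by the loss \<open>\<tau>\<close> in the exponent: for every \<open>\<beta> <
  \<alpha>\<close> the threshold is at least a constant times \<open>N powr
  \<beta>\<close>.\<close>

lemma sqrt_over_threshold_le:
  assumes w: "pos_weights d \<gamma>" and \<alpha>: "\<alpha> > 1 / 2" and d: "d \<ge> 1" and K: "K > 0" and \<tau>: "\<tau> > 0" and \<kappa>: "\<kappa> > 0"
  obtains C where "C \<ge> 0"
    "\<And>N m0 R c. \<lbrakk>N > 2; m0 \<ge> 1; R \<ge> 1; \<kappa> * real N \<le> c; c \<le> real N;
       2 ^ (m0 - 1) < threshold d \<alpha> \<gamma> c powr (1 / \<alpha>); real R \<le> R_star d m0\<rbrakk>
      \<Longrightarrow> sqrt (1 + real R) / threshold d \<alpha> \<gamma> c \<le> C * real (N * R * num_shifts K N R) powr (- \<alpha> + \<tau>)"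
proof -
  (* the exponent of the lower bound for the threshold; 1 / 2 corresponds to the largest
     admissible l = 2 and takes over when \<alpha> - \<tau> / 2 is too small *)
  define \<beta> where "\<beta> = max (1 / 2) (\<alpha> - \<tau> / 2)"
  have \<beta>: "1 / 2 \<le> \<beta>" "\<beta> < \<alpha>" using \<alpha> \<tau> by (auto simp: \<beta>_def)
  (* the target exponent, replaced by 0 where the bound claimed grows with the cost *)
  define e where "e = max 0 (\<alpha> - \<tau>)"
  have e: "e \<ge> 0" "e < \<beta>" using \<tau> by (auto simp: e_def \<beta>_def max_def)
  (* chosen so that N powr \<epsilon> from the square root and (N powr (3 * \<epsilon>)) powr e from R * S
     together fill the gap between e and \<beta> *)
  define \<epsilon> where "\<epsilon> = (\<beta> - e) / (1 + 3 * e)"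
  have \<epsilon>: "\<epsilon> > 0" using e by (simp add: \<epsilon>_def)
  have \<epsilon>': "\<epsilon> + 3 * \<epsilon> * e = \<beta> - e"
  proof -
    have "\<epsilon> * (1 + 3 * e) = \<beta> - e" using e by (simp add: \<epsilon>_def)
    then show ?thesis by (simp add: algebra_simps)
  qed
  have \<alpha>0: "\<alpha> > 0" using \<alpha> by simp
  obtain C1 where C1: "C1 > 0" "\<And>N m0 M. \<lbrakk>N \<ge> 1; m0 \<ge> 1; M > 0; M \<le> real N powr \<alpha>; 2 ^ (m0 - 1) < M powr (1 / \<alpha>)\<rbrakk>
      \<Longrightarrow> R_star d m0 \<le> C1 * real N powr \<epsilon>"
    using R_star_le_powr[OF \<epsilon> \<alpha>0, of d] by blast
  define C2 where "C2 = 1 + 2 * K / \<epsilon>"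
  have C2: "C2 > 0" using K \<epsilon> by (simp add: C2_def add_pos_nonneg)
  define \<theta> where "\<theta> = (\<kappa> / euler_prod d \<alpha> \<gamma> (1 / \<beta>)) powr \<beta>"
  have "\<alpha> * (1 / \<beta>) > 1" using \<beta> by (simp add: field_simps)
  then have W: "euler_prod d \<alpha> \<gamma> (1 / \<beta>) \<ge> 1" by (rule euler_prod_ge_1[OF w])
  have \<theta>: "\<theta> > 0" using \<kappa> W by (simp add: \<theta>_def)
  define D where "D = 2 * (C1 + 1) * (C1 * (C2 * C1)) powr e"
  show ?thesis
  proof (rule that)
    show "D / \<theta> \<ge> 0" using \<theta> C1 by (simp add: D_def)
    fix N m0 R :: nat and c :: real
    assume N: "N > 2" and m0: "m0 \<ge> 1" and R: "R \<ge> 1" and c: "\<kappa> * real N \<le> c" "c \<le> real N"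
      and lt: "2 ^ (m0 - 1) < threshold d \<alpha> \<gamma> c powr (1 / \<alpha>)" and RR: "real R \<le> R_star d m0"
    let ?M = "threshold d \<alpha> \<gamma> c" and ?S = "num_shifts K N R" and ?N = "real N"
    let ?p = "real (N * R * ?S)"
    have "0 < \<kappa> * ?N" using \<kappa> N by simp
    then have c0: "c > 0" using c by linarith
    have M0: "?M > 0" using threshold_equation[OF w \<alpha> d c0] by blast
    have Mle: "?M \<le> ?N powr \<alpha>" by (rule threshold_le[OF w \<alpha> d c0 c(2)]) (use N in simp)
    have Mge: "?M \<ge> \<theta> * ?N powr \<beta>"
    proof -
      have "\<theta> * ?N powr \<beta> = (\<kappa> * ?N / euler_prod d \<alpha> \<gamma> (1 / \<beta>)) powr \<beta>"
        using \<kappa> W by (simp add: \<theta>_def powr_mult powr_divide)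
      also have "\<dots> \<le> ?M" by (rule threshold_ge[OF w \<alpha> d c0 c(1) _ \<beta>]) (use \<kappa> in simp)
      finally show ?thesis .
    qed
    have R1: "real R \<le> C1 * ?N powr \<epsilon>"
      using RR C1(2)[of N m0 ?M] N m0 M0 Mle lt by fastforce
    have S1: "real ?S \<le> C2 * C1 * ?N powr (2 * \<epsilon>)"
    proof -
      have "real ?S \<le> C2 * real R * ?N powr \<epsilon>"
        unfolding C2_def by (rule num_shifts_le_powr) (use K N R \<epsilon> in auto)
      also have "\<dots> \<le> C2 * (C1 * ?N powr \<epsilon>) * ?N powr \<epsilon>"
        using R1 C2 by (intro mult_right_mono mult_left_mono) auto
      also have "\<dots> = C2 * C1 * ?N powr (2 * \<epsilon>)"
        by (simp add: powr_add[symmetric])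
      finally show ?thesis .
    qed
    have S0: "?S > 0" by (rule num_shifts_pos) (use K N R in auto)
    have p1: "?p \<ge> 1"
    proof -
      have "N * R * ?S \<ge> 1" using N R S0 by (simp add: Suc_le_eq)
      then show ?thesis by (metis of_nat_1 of_nat_mono)
    qed
    have RS: "real R * real ?S \<le> C1 * (C2 * C1) * ?N powr (3 * \<epsilon>)"
    proof -
      have "real R * real ?S \<le> (C1 * ?N powr \<epsilon>) * (C2 * C1 * ?N powr (2 * \<epsilon>))"
        using R1 S1 C1 by (intro mult_mono) auto
      also have "\<dots> = C1 * (C2 * C1) * (?N powr \<epsilon> * ?N powr (2 * \<epsilon>))" by (simp add: mult_ac)
      also have "\<dots> = C1 * (C2 * C1) * ?N powr (3 * \<epsilon>)" by (simp add: powr_add[symmetric])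
      finally show ?thesis .
    qed
    have "?p powr (\<alpha> - \<tau>) \<le> ?p powr e" using p1 by (intro powr_mono) (auto simp: e_def)
    also have "\<dots> = ?N powr e * (real R * real ?S) powr e"
      by (simp add: powr_mult mult_ac)
    also have "\<dots> \<le> ?N powr e * (C1 * (C2 * C1) * ?N powr (3 * \<epsilon>)) powr e"
      using RS e by (intro mult_left_mono powr_mono2) auto
    also have "\<dots> = (C1 * (C2 * C1)) powr e * ?N powr (e + 3 * \<epsilon> * e)"
      by (simp add: powr_mult powr_powr powr_add mult_ac)
    finally have p_le: "?p powr (\<alpha> - \<tau>) \<le> (C1 * (C2 * C1)) powr e * ?N powr (e + 3 * \<epsilon> * e)" .
    have sq: "sqrt (1 + real R) \<le> 2 * (C1 + 1) * ?N powr \<epsilon>"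
    proof -
      have "sqrt (1 + real R) \<le> 1 + real R"
        by (rule real_le_lsqrt) (auto simp: power2_eq_square algebra_simps)
      also have "\<dots> \<le> 2 * real R" using R by simp
      also have "\<dots> \<le> 2 * (C1 * ?N powr \<epsilon>)" using R1 by simp
      also have "\<dots> \<le> 2 * ((C1 + 1) * ?N powr \<epsilon>)" by (simp add: algebra_simps)
      finally show ?thesis by (simp only: mult.assoc)
    qed
    have "sqrt (1 + real R) * ?p powr (\<alpha> - \<tau>) \<le>
        (2 * (C1 + 1) * ?N powr \<epsilon>) * ((C1 * (C2 * C1)) powr e * ?N powr (e + 3 * \<epsilon> * e))"
      using C1 by (intro mult_mono sq p_le) auto
    also have "\<dots> = D * (?N powr \<epsilon> * ?N powr (e + 3 * \<epsilon> * e))" by (simp add: D_def mult_ac)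
    also have "?N powr \<epsilon> * ?N powr (e + 3 * \<epsilon> * e) = ?N powr \<beta>"
    proof -
      have "\<epsilon> + (e + 3 * \<epsilon> * e) = \<beta>" using \<epsilon>' by linarith
      then show ?thesis by (simp only: powr_add[symmetric])
    qed
    also have "D * ?N powr \<beta> \<le> D * (?M / \<theta>)"
      using Mge \<theta> C1 by (intro mult_left_mono) (auto simp: field_simps D_def)
    finally have *: "sqrt (1 + real R) * ?p powr (\<alpha> - \<tau>) \<le> D / \<theta> * ?M" by simp
    have "s / m \<le> D' * (1 / p)" if "s * p \<le> D' * m" "m > 0" "p > 0" for s m D' p :: real
      using that by (simp add: field_simps)
    moreover have "?p powr (\<alpha> - \<tau>) > 0" unfolding powr_gt_zero using p1 by linarith
    ultimately have "sqrt (1 + real R) / ?M \<le> D / \<theta> * (1 / ?p powr (\<alpha> - \<tau>))"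
      using * M0 by blast
    moreover have "?p powr (- \<alpha> + \<tau>) = 1 / ?p powr (\<alpha> - \<tau>)"
      by (simp add: powr_minus_divide[symmetric])
    ultimately show "sqrt (1 + real R) / ?M \<le> D / \<theta> * ?p powr (- \<alpha> + \<tau>)"
      by (simp only:)
  qed
qed

lemma failure_probability_tendsto_0:
  assumes K: "K > 1" and \<alpha>: "\<alpha> > 0"
  shows "\<forall>\<^sub>F N in sequentially. \<forall>m0 M. m0 \<ge> 1 \<and> 0 < M \<and> M \<le> real N powr \<alpha> \<and> 2 ^ (m0 - 1) < M powr (1 / \<alpha>) \<longrightarrow>
    2 * real N powr (1 - K) * (R_star d m0)\<^sup>2 < 1"
proof -
  (* R_star\<^sup>2 then grows at most like the square root of N powr (K - 1) *)
  define \<epsilon> where "\<epsilon> = (K - 1) / 4"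
  have \<epsilon>: "\<epsilon> > 0" using K by (simp add: \<epsilon>_def)
  obtain C where C: "C > 0" "\<And>N m0 M. \<lbrakk>N \<ge> 1; m0 \<ge> 1; M > 0; M \<le> real N powr \<alpha>; 2 ^ (m0 - 1) < M powr (1 / \<alpha>)\<rbrakk>
      \<Longrightarrow> R_star d m0 \<le> C * real N powr \<epsilon>"
    using R_star_le_powr[OF \<epsilon> \<alpha>, of d] by blast
  have "((\<lambda>N. 2 * C\<^sup>2 * real N powr (- (2 * \<epsilon>))) \<longlongrightarrow> 2 * C\<^sup>2 * 0) sequentially"
    by (intro tendsto_mult tendsto_const tendsto_neg_powr filterlim_real_sequentially) (use \<epsilon> in simp)
  then have "\<forall>\<^sub>F N in sequentially. 2 * C\<^sup>2 * real N powr (- (2 * \<epsilon>)) < 1"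
    by (rule order_tendstoD(2)) simp
  then show ?thesis
    using eventually_ge_at_top[of 1]
  proof eventually_elim
    case (elim N)
    show ?case
    proof (intro allI impI)
      fix m0 :: nat and M :: real
      assume a: "m0 \<ge> 1 \<and> 0 < M \<and> M \<le> real N powr \<alpha> \<and> 2 ^ (m0 - 1) < M powr (1 / \<alpha>)"
      have "0 \<le> R_star d m0" by (simp add: R_star_def)
      then have "(R_star d m0)\<^sup>2 \<le> (C * real N powr \<epsilon>)\<^sup>2"
        using C(2)[of N m0 M] a elim by (intro power_mono) auto
      then have "2 * real N powr (1 - K) * (R_star d m0)\<^sup>2 \<le> 2 * real N powr (1 - K) * (C * real N powr \<epsilon>)\<^sup>2"
        by (intro mult_left_mono) auto
      also have "\<dots> = 2 * C\<^sup>2 * (real N powr (1 - K) * (real N powr \<epsilon> * real N powr \<epsilon>))"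
        by (simp add: power2_eq_square mult_ac)
      also have "real N powr (1 - K) * (real N powr \<epsilon> * real N powr \<epsilon>) = real N powr (- (2 * \<epsilon>))"
        unfolding powr_add[symmetric] by (rule arg_cong) (simp add: \<epsilon>_def field_simps)
      finally show "2 * real N powr (1 - K) * (R_star d m0)\<^sup>2 < 1" using elim by simp
    qed
  qed
qed

section \<open>The error of the randomly shifted lattice algorithm\<close>

lemma has_sum_sum:
  fixes s :: "'i \<Rightarrow> 'b :: {topological_comm_monoid_add, t2_space}"
  assumes "\<And>n. n \<in> I \<Longrightarrow> (f n has_sum s n) A"
  shows "((\<lambda>k. \<Sum>n\<in>I. f n k) has_sum (\<Sum>n\<in>I. s n)) A"
  using assms
  by (induction I rule: infinite_finite_induct) (auto intro!: has_sum_add)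

lemma korobov_has_sum:
  assumes "f \<in> korobov_space d \<alpha> \<gamma>" "x \<in> space (cube d)"
  shows "((\<lambda>k. fourier_coeff d f k * wave d k x) has_sum f x) (int_vecs d)"
  using assms by (simp add: korobov_space_def)

text \<open>Aliasing: the lattice rule identifies frequencies that agree modulo the dual
  lattice.\<close>

lemma lattice_coeff_has_sum:
  assumes f: "f \<in> korobov_space d \<alpha> \<gamma>" and N: "N > 0"
  shows "((\<lambda>k. if [int_dot d k g = int_dot d l g] (mod int N)
      then fourier_coeff d f k * wave d k z else 0) has_sum
      (wave d l z * lattice_coeff d N g f l z)) (int_vecs d)"
proof -
  let ?c = "fourier_coeff d f"
  let ?t = "\<lambda>n j. real n * real_of_int (g j) / real N + z j"
  let ?T = "\<lambda>n k. ?c k * wave d k (?t n) * expi2 (- real_dot d l (?t n))"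
  let ?s = "\<lambda>n. f (\<lambda>j\<in>{..<d}. frac (?t n j)) * expi2 (- real_dot d l (?t n))"
  let ?a = "\<lambda>k. int_dot d k g - int_dot d l g"
  have dot: "real_dot d k (?t n) = real n * (real_of_int (int_dot d k g) / real N) + real_dot d k z" for k n
    by (simp add: real_dot_def int_dot_def ring_distribs sum.distrib sum_distrib_left sum_divide_distrib mult_ac)
  have "((\<lambda>k. ?T n k) has_sum
      ?s n) (int_vecs d)" for n
  proof -
    have "(\<lambda>j\<in>{..<d}. frac (?t n j)) \<in> space (cube d)"
      unfolding space_cube by (auto simp: frac_lt_1)
    from korobov_has_sum[OF f this] show ?thesis
      unfolding expi2_real_dot_frac by (rule has_sum_cmult_left)
  qed
  then have "((\<lambda>k. \<Sum>n<N. ?T n k) has_sum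
      (\<Sum>n<N. ?s n)) (int_vecs d)"
    by (rule has_sum_sum)
  then have "((\<lambda>k. wave d l z * (1 / of_nat N) * (\<Sum>n<N. ?T n k)) has_sum
      wave d l z * (1 / of_nat N) * (\<Sum>n<N. ?s n)) (int_vecs d)"
    by (rule has_sum_cmult_right)
  moreover have "wave d l z * (1 / of_nat N) * (\<Sum>n<N. ?T n k) =
      (if [int_dot d k g = int_dot d l g] (mod int N) then ?c k * wave d k z else 0)" for k
  proof -
    have e: "?T n k =
        ?c k * wave d k z * expi2 (- real_dot d l z) * expi2 (real n * (real_of_int (?a k) / real N))" for n
      unfolding dot by (simp add: expi2_add[symmetric] mult.assoc) (simp add: algebra_simps diff_divide_distrib)
    have "(\<Sum>n<N. ?T n k) =
        ?c k * wave d k z * expi2 (- real_dot d l z) * (if int N dvd ?a k then of_nat N else 0)"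
      unfolding e sum_distrib_left[symmetric] sum_expi2_multiples[OF N] ..
    moreover have "int N dvd ?a k \<longleftrightarrow> [int_dot d k g = int_dot d l g] (mod int N)"
      by (simp add: cong_iff_dvd_diff)
    ultimately show ?thesis using N expi2_mult_minus[of "real_dot d l z"] by (auto simp: mult_ac)
  qed
  ultimately show ?thesis
    by (simp only: lattice_coeff_def Let_def mult.assoc)
qed

text \<open>The coefficients are recovered exactly up to the least squares solution for the
  aliasing terms.\<close>

lemma approx_coeffs_error:
  fixes a :: "nat \<Rightarrow> complex" and N :: nat and g :: "nat \<Rightarrow> int" and \<Delta> :: "nat \<Rightarrow> real"
    and f :: "(nat \<Rightarrow> real) \<Rightarrow> complex"
  assumes S: "S > 0" and ex: "gram_expands d S y F"
  defines "x \<equiv> data_vec d N g S y F \<Delta> f"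
  shows "(\<Sum>i<length F. (cmod (approx_coeffs d N g S y F \<Delta> f $ i - a i))\<^sup>2) \<le>
    1 / real S * (\<Sum>q<length F * S. (cmod (x $ q -
      (\<Sum>i<length F. B_mat d S y F $$ (q, i) * (wave d (F ! i) \<Delta> * a i))))\<^sup>2)"
proof -
  let ?v = "length F" and ?p = "length F * S" and ?B = "B_mat d S y F" and ?G = "gram_mat d S y F"
  let ?e = "\<lambda>i. wave d (F ! i) \<Delta>"
  let ?X = "approx_coeffs d N g S y F \<Delta> f"
  let ?Gi = "the (mat_inverse ?G)" and ?D = "D_mat d F \<Delta>" and ?Bh = "mat_adjoint (B_mat d S y F)"
  let ?g = "\<lambda>i j. \<Sum>q<?p. cnj (?B $$ (q, i)) * ?B $$ (q, j)"
  let ?Di = "mat_diag ?v (\<lambda>i. expi2 (- real_dot d (F ! i) \<Delta>))"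
  have B: "?B \<in> carrier_mat ?p ?v" by (rule B_mat_carrier)
  have Bh: "?Bh \<in> carrier_mat ?v ?p" by (rule mat_adjoint_carrier[OF B])
  have G: "?G \<in> carrier_mat ?v ?v" by (rule gram_mat_carrier)
  have "invertible_mat ?G"
    using spectral_norm_inverse_le_iff[OF G, of "real S"] ex S by auto
  then obtain H where H1: "?G * H = 1\<^sub>m ?v" and "H * ?G = 1\<^sub>m (dim_row H)"
    using G by (auto simp: invertible_mat_def inverts_mat_def)
  then have H: "H \<in> carrier_mat ?v ?v"
    using G by (metis carrier_matI carrier_matD index_mult_mat(2,3) index_one_mat(2,3))
  with H1 have "?Gi = H" using mat_inverse_unique[OF G] by blast
  with H H1 \<open>H * ?G = 1\<^sub>m (dim_row H)\<close> have Gi: "?Gi \<in> carrier_mat ?v ?v" "?G * ?Gi = 1\<^sub>m ?v" "?Gi * ?G = 1\<^sub>m ?v"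
    by auto
  have Di: "the (mat_inverse ?D) = ?Di"
    by (rule mat_inverse_unique[of _ ?v]) (auto simp: D_mat_def)
  have x: "x \<in> carrier_vec ?p" by (simp add: x_def data_vec_def)
  define b where "b = Matrix.vec ?v (\<lambda>i. ?e i * a i)"
  have b: "b \<in> carrier_vec ?v" by (simp add: b_def)
  define h where "h = x - ?B *\<^sub>v b"
  have h: "h \<in> carrier_vec ?p" unfolding h_def by (intro minus_carrier_vec x mult_mat_vec_carrier[OF B b])
  define u where "u = ?Gi *\<^sub>v (?Bh *\<^sub>v h)"
  have Bhh: "?Bh *\<^sub>v h \<in> carrier_vec ?v" by (rule mult_mat_vec_carrier[OF Bh h])
  have u: "u \<in> carrier_vec ?v" unfolding u_def by (rule mult_mat_vec_carrier[OF Gi(1) Bhh])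
  have Bb: "?B *\<^sub>v b \<in> carrier_vec ?p" by (rule mult_mat_vec_carrier[OF B b])
  have Gb: "?G *\<^sub>v b \<in> carrier_vec ?v" by (rule mult_mat_vec_carrier[OF G b])
  have "?Gi *\<^sub>v (?Bh *\<^sub>v x) = b + u"
  proof -
    have "x = ?B *\<^sub>v b + h" using x B by (intro eq_vecI) (auto simp: h_def simp del: index_mult_mat_vec)
    then have "?Bh *\<^sub>v x = ?Bh *\<^sub>v (?B *\<^sub>v b) + ?Bh *\<^sub>v h"
      using mult_add_distrib_mat_vec[OF Bh Bb h] by simp
    also have "?Bh *\<^sub>v (?B *\<^sub>v b) = ?G *\<^sub>v b"
      unfolding gram_mat_def by (rule assoc_mult_mat_vec[OF Bh B b, symmetric])
    finally have "?Gi *\<^sub>v (?Bh *\<^sub>v x) = ?Gi *\<^sub>v (?G *\<^sub>v b) + u"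
      unfolding u_def using mult_add_distrib_mat_vec[OF Gi(1) Gb Bhh] by simp
    also have "?Gi *\<^sub>v (?G *\<^sub>v b) = b"
      using assoc_mult_mat_vec[OF Gi(1) G b] Gi(3) b by simp
    finally show ?thesis .
  qed
  moreover have "?X = ?Di *\<^sub>v (?Gi *\<^sub>v (?Bh *\<^sub>v x))"
    unfolding approx_coeffs_def Di x_def[symmetric]
    using assoc_mult_mat_vec[OF mult_carrier_mat[OF mat_diag_dim Gi(1)] Bh x, of "\<lambda>i. expi2 (- real_dot d (F ! i) \<Delta>)"]
      assoc_mult_mat_vec[OF mat_diag_dim Gi(1) mult_mat_vec_carrier[OF Bh x], of "\<lambda>i. expi2 (- real_dot d (F ! i) \<Delta>)"]
    by simp
  ultimately have app: "?X = ?Di *\<^sub>v (b + u)" by simp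
  have comp: "cmod (?X $ i - a i) = cmod (u $ i)" if i: "i < ?v" for i
  proof -
    have "?X $ i = expi2 (- real_dot d (F ! i) \<Delta>) * (b $ i + u $ i)"
    proof -
      have "?X $ i = (\<Sum>j<?v. ?Di $$ (i, j) * (b $ j + u $ j))"
        unfolding app using i b u by (auto simp: scalar_prod_def atLeast0LessThan mat_diag_def intro!: sum.cong)
      also have "\<dots> = (\<Sum>j<?v. if j = i then expi2 (- real_dot d (F ! i) \<Delta>) * (b $ i + u $ i) else 0)"
        using i by (intro sum.cong) (auto simp: mat_diag_def)
      also have "\<dots> = expi2 (- real_dot d (F ! i) \<Delta>) * (b $ i + u $ i)" using i by simp
      finally show ?thesis .
    qed
    also have "\<dots> - a i = expi2 (- real_dot d (F ! i) \<Delta>) * u $ i"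
      using i expi2_mult_minus[of "real_dot d (F ! i) \<Delta>"] by (simp add: b_def algebra_simps)
    finally show ?thesis by (simp add: norm_mult)
  qed
  have idx: "(A *\<^sub>v t) $ i = (\<Sum>j<n. A $$ (i, j) * t $ j)"
    if "A \<in> carrier_mat m n" "t \<in> carrier_vec n" "i < m" for A :: "complex Matrix.mat" and t m n i
    using that by (auto simp: scalar_prod_def atLeast0LessThan intro!: sum.cong)
  have "real S * (\<Sum>i<?v. (cmod (u $ i))\<^sup>2) \<le> (\<Sum>q<?p. (cmod (h $ q))\<^sup>2)"
  proof (rule least_squares_stability[where n = ?v and B = "\<lambda>q i. ?B $$ (q, i)" and w = "\<lambda>i. (?Gi *\<^sub>v u) $ i"])
    have gram: "?g i j = ?G $$ (i, j)" if "i < ?v" "j < ?v" for i j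
      using that by (simp add: gram_mat_index)
    have "l2norm ?v (\<lambda>i. \<Sum>j<?v. ?g i j * w j) =
        l2norm ?v (\<lambda>i. \<Sum>j<?v. ?G $$ (i, j) * w j)" for w
      by (intro l2norm_cong sum.cong) (auto simp: gram)
    then show "expands ?v (real S) ?g"
      using ex by (simp add: expands_def)
    fix i assume i: "i < ?v"
    have "(\<Sum>j<?v. ?g i j * t $ j) = (?G *\<^sub>v t) $ i"
      if "t \<in> carrier_vec ?v" for t
      using i by (simp add: idx[OF G that i] gram)
    note mult = this
    have Giu: "?Gi *\<^sub>v u \<in> carrier_vec ?v" by (rule mult_mat_vec_carrier[OF Gi(1) u])
    have "?G *\<^sub>v (?Gi *\<^sub>v u) = u"
      using assoc_mult_mat_vec[OF G Gi(1) u] Gi(2) u by simp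
    then show "(\<Sum>j<?v. ?g i j * (?Gi *\<^sub>v u) $ j) = u $ i"
      using mult[OF Giu] by simp
    have "?G *\<^sub>v u = ?Bh *\<^sub>v h"
      unfolding u_def using assoc_mult_mat_vec[OF G Gi(1) Bhh] Gi(2) Bhh by simp
    moreover have "(?Bh *\<^sub>v h) $ i = (\<Sum>q<?p. cnj (?B $$ (q, i)) * h $ q)"
      using i by (simp add: idx[OF Bh h i] mat_adjoint_index[OF B])
    ultimately show "(\<Sum>j<?v. ?g i j * u $ j) =
        (\<Sum>q<?p. cnj (?B $$ (q, i)) * h $ q)"
      using mult[OF u] by simp
  qed (use S in simp)
  then have "(\<Sum>i<?v. (cmod (u $ i))\<^sup>2) \<le> 1 / real S * (\<Sum>q<?p. (cmod (h $ q))\<^sup>2)"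
    using S by (simp add: field_simps)
  also have "(\<Sum>q<?p. (cmod (h $ q))\<^sup>2) = (\<Sum>q<?p. (cmod (x $ q - (\<Sum>i<?v. ?B $$ (q, i) * (?e i * a i))))\<^sup>2)"
  proof (intro sum.cong refl)
    fix q assume q: "q \<in> {..<?p}"
    have "h $ q = x $ q - (?B *\<^sub>v b) $ q"
      unfolding h_def using q B by (intro index_minus_vec(1)) simp
    also have "(?B *\<^sub>v b) $ q = (\<Sum>i<?v. ?B $$ (q, i) * b $ i)"
      using q by (intro idx[OF B b]) simp
    also have "\<dots> = (\<Sum>i<?v. ?B $$ (q, i) * (?e i * a i))"
      by (intro sum.cong) (auto simp: b_def)
    finally show "(cmod (h $ q))\<^sup>2 = (cmod (x $ q - (\<Sum>i<?v. ?B $$ (q, i) * (?e i * a i))))\<^sup>2" by simp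
  qed
  finally show ?thesis using comp by simp
qed

lemma borel_measurable_fourier_series:
  assumes "\<And>x. x \<in> space (cube d) \<Longrightarrow>
      ((\<lambda>k. c k * wave d k x) has_sum F x) (int_vecs d)"
  shows "F \<in> borel_measurable (cube d)"
proof (rule borel_measurable_LIMSEQ_metric)
  show "(\<lambda>x. \<Sum>k\<in>int_box d n. c k * wave d k x) \<in> borel_measurable (cube d)" for n
    by measurable
  show "(\<lambda>n. \<Sum>k\<in>int_box d n. c k * wave d k x) \<longlonglongrightarrow> F x" if "x \<in> space (cube d)" for x
    by (rule has_sum_LIMSEQ_exhaustion[OF assms[OF that] _ incseq_int_box Union_int_box]) simp
qed

text \<open>The fiber contains all frequencies of its residue class that lie in the frequency set,
  so the exact coefficients leave as residual only aliasing terms from outside the frequency set.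
  As a function of the random shift it is a Fourier series.\<close>

lemma residual_has_sum:
  fixes d :: nat
  assumes f: "f \<in> korobov_space d \<alpha> \<gamma>" and N: "N > 0" and S: "S > 0" and F: "distinct F"
    and setF: "set F = {k \<in> int_vecs d. k \<in> A \<and> [int_dot d k g = int_dot d l g] (mod int N)}"
    and q: "q < length F * S"
  defines "rest \<equiv> {k \<in> int_vecs d - A. [int_dot d k g = int_dot d l g] (mod int N)}"
  shows "((\<lambda>k. (if k \<in> rest then fourier_coeff d f k * wave d k (y (q div S, q mod S)) else 0) *
      wave d k \<Delta>) has_sum
    (data_vec d N g S y F \<Delta> f $ q - (\<Sum>i<length F. B_mat d S y F $$ (q, i) *
      (wave d (F ! i) \<Delta> * fourier_coeff d f (F ! i))))) (int_vecs d)"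
proof -
  let ?c = "fourier_coeff d f" and ?y = "y (q div S, q mod S)"
  let ?z = "\<lambda>j. ?y j + \<Delta> j"
  let ?m = "F ! (q div S)"
  have "q div S < length F" using q by (simp add: less_mult_imp_div_less)
  then have m: "?m \<in> set F" by simp
  have cong: "[int_dot d k g = int_dot d ?m g] (mod int N) \<longleftrightarrow> [int_dot d k g = int_dot d l g] (mod int N)" for k
    using m by (auto simp: setF cong_def)
  have e: "wave d k ?z = wave d k ?y * wave d k \<Delta>" for k
    by (simp add: real_dot_add expi2_add)
  let ?data = "data_vec d N g S y F \<Delta> f $ q" and ?w = "\<lambda>k. ?c k * wave d k ?z"
  have data: "?data = wave d ?m ?z * lattice_coeff d N g f ?m ?z"
    using q by (simp add: data_vec_def Let_def)
  have 1: "((\<lambda>k. if [int_dot d k g = int_dot d l g] (mod int N) then ?w k else 0)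
      has_sum ?data) (int_vecs d)"
    using lattice_coeff_has_sum[OF f N, of g ?m ?z] unfolding data cong .
  have 2: "((\<lambda>k. if k \<in> set F then ?w k else 0) has_sum
      (\<Sum>k\<in>set F. ?w k)) (int_vecs d)"
  proof -
    have "((\<lambda>k. if k \<in> set F then ?w k else 0) has_sum
      (\<Sum>k\<in>set F. ?w k)) (int_vecs d) \<longleftrightarrow>
      ((\<lambda>k. ?w k) has_sum (\<Sum>k\<in>set F. ?w k)) (set F)"
      by (rule has_sum_cong_neutral) (auto simp: setF)
    then show ?thesis by (simp add: has_sum_finiteI)
  qed
  have "(\<Sum>k\<in>set F. ?w k) = (\<Sum>i<length F. ?w (F ! i))"
    using sum.reindex_bij_betw[OF bij_betw_nth[OF F refl refl], of "\<lambda>k. ?w k"] by simp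
  also have "\<dots> = (\<Sum>i<length F. B_mat d S y F $$ (q, i) * (wave d (F ! i) \<Delta> * ?c (F ! i)))"
    using q by (intro sum.cong) (auto simp: B_mat_index e mult_ac)
  finally have 3: "(\<Sum>k\<in>set F. ?w k) = \<dots>" .
  have "((\<lambda>k. (if [int_dot d k g = int_dot d l g] (mod int N) then ?w k else 0) +
      - (if k \<in> set F then ?w k else 0)) has_sum
      (?data + - (\<Sum>k\<in>set F. ?w k))) (int_vecs d)"
    by (intro has_sum_add 1 has_sum_uminusI 2)
  also have "?this \<longleftrightarrow> ?thesis"
    unfolding 3 add_uminus_conv_diff
    by (rule has_sum_cong) (auto simp: rest_def setF e)
  finally show ?thesis .
qed

text \<open>Outside the frequency set the weight is at least \<open>M\<close>.\<close>

lemma korobov_tail: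
  assumes f: "f \<in> korobov_space d \<alpha> \<gamma>" "korobov_norm d \<alpha> \<gamma> f \<le> 1" and w: "pos_weights d \<gamma>" and \<alpha>: "\<alpha> \<ge> 0"
    and M: "M > 0"
  shows "(\<lambda>k. (cmod (fourier_coeff d f k))\<^sup>2) summable_on int_vecs d"
    and "X \<subseteq> int_vecs d - freq_set d \<alpha> \<gamma> M \<Longrightarrow> (\<Sum>\<^sub>\<infinity>k\<in>X. (cmod (fourier_coeff d f k))\<^sup>2) \<le> 1 / M\<^sup>2"
proof -
  let ?c = "\<lambda>k. (cmod (fourier_coeff d f k))\<^sup>2" and ?r = "korobov_r d \<alpha> \<gamma>"
  have cr: "(\<lambda>k. ?c k * (?r k)\<^sup>2) summable_on int_vecs d"
    using f by (simp add: korobov_space_def)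
  have le1: "(\<Sum>\<^sub>\<infinity>k\<in>int_vecs d. ?c k * (?r k)\<^sup>2) \<le> 1"
    using f(2) by (simp add: korobov_norm_def)
  show summ: "?c summable_on int_vecs d"
  proof (rule summable_on_comparison_test[OF cr])
    fix k
    have "1 \<le> (?r k)\<^sup>2" using korobov_r_ge_1[OF w \<alpha>, of k] by (simp add: one_le_power)
    then show "?c k \<le> ?c k * (?r k)\<^sup>2" by (simp add: mult_le_cancel_left1)
  qed auto
  assume X: "X \<subseteq> int_vecs d - freq_set d \<alpha> \<gamma> M"
  have "(\<Sum>\<^sub>\<infinity>k\<in>X. ?c k) \<le> (\<Sum>\<^sub>\<infinity>k\<in>int_vecs d. 1 / M\<^sup>2 * (?c k * (?r k)\<^sup>2))"
  proof (rule infsum_mono_neutral)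
    show "?c summable_on X" by (rule summable_on_subset_banach[OF summ]) (use X in auto)
    show "(\<lambda>k. 1 / M\<^sup>2 * (?c k * (?r k)\<^sup>2)) summable_on int_vecs d" by (intro summable_on_cmult_right cr)
    show "?c k \<le> 1 / M\<^sup>2 * (?c k * (?r k)\<^sup>2)" if "k \<in> X \<inter> int_vecs d" for k
    proof -
      have "M \<le> ?r k" using X that by (auto simp: freq_set_def)
      then have "M\<^sup>2 \<le> (?r k)\<^sup>2" using M by (intro power_mono) auto
      then have "?c k * M\<^sup>2 \<le> ?c k * (?r k)\<^sup>2" by (intro mult_left_mono) auto
      then show ?thesis using M by (simp add: field_simps)
    qed
  qed (use X in auto)
  also have "\<dots> = 1 / M\<^sup>2 * (\<Sum>\<^sub>\<infinity>k\<in>int_vecs d. ?c k * (?r k)\<^sup>2)" by (rule infsum_cmult_right')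
  also have "\<dots> \<le> 1 / M\<^sup>2 * 1" using le1 by (intro mult_left_mono) auto
  finally show "(\<Sum>\<^sub>\<infinity>k\<in>X. ?c k) \<le> 1 / M\<^sup>2" by simp
qed

lemma fiber_enumE:
  assumes "fiber_enum d \<alpha> \<gamma> N M g Fs"
  obtains ls where "\<And>j. j < length Fs \<Longrightarrow> ls ! j \<in> freq_set d \<alpha> \<gamma> M"
    "\<And>j. j < length Fs \<Longrightarrow> distinct (Fs ! j)"
    "\<And>j. j < length Fs \<Longrightarrow> set (Fs ! j) = fiber d \<alpha> \<gamma> N M g (ls ! j)"
    "\<And>i j. i < length Fs \<Longrightarrow> j < length Fs \<Longrightarrow> i \<noteq> j \<Longrightarrow> set (Fs ! i) \<inter> set (Fs ! j) = {}"
    "(\<Union>j<length Fs. set (Fs ! j)) = freq_set d \<alpha> \<gamma> M"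
proof -
  from assms obtain ls where ls: "length ls = length Fs" "set ls \<subseteq> freq_set d \<alpha> \<gamma> M"
    and F: "\<forall>j<length Fs. distinct (Fs ! j) \<and> set (Fs ! j) = fiber d \<alpha> \<gamma> N M g (ls ! j)"
    and disj: "\<forall>i<length Fs. \<forall>j<length Fs. i \<noteq> j \<longrightarrow>
           fiber d \<alpha> \<gamma> N M g (ls ! i) \<inter> fiber d \<alpha> \<gamma> N M g (ls ! j) = {}"
    and un: "(\<Union>j<length Fs. fiber d \<alpha> \<gamma> N M g (ls ! j)) = freq_set d \<alpha> \<gamma> M"
    unfolding fiber_enum_def by blast
  show ?thesis
  proof (rule that[of ls])
    show "ls ! j \<in> freq_set d \<alpha> \<gamma> M" if "j < length Fs" for j
      using ls that nth_mem[of j ls] by auto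
    show "(\<Union>j<length Fs. set (Fs ! j)) = freq_set d \<alpha> \<gamma> M"
      using un F by simp
  qed (use F disj in auto)
qed

lemma length_fiber_le:
  assumes "pos_weights d \<gamma>" "\<alpha> > 0" "fiber_enum d \<alpha> \<gamma> N M g Fs" "F \<in> set Fs"
  shows "distinct F" "set F \<subseteq> int_vecs d" "F \<noteq> []" "length F \<le> max_fiber_length d \<alpha> \<gamma> N M g"
proof -
  obtain ls where ls: "\<And>j. j < length Fs \<Longrightarrow> ls ! j \<in> freq_set d \<alpha> \<gamma> M"
    "\<And>j. j < length Fs \<Longrightarrow> distinct (Fs ! j)"
    "\<And>j. j < length Fs \<Longrightarrow> set (Fs ! j) = fiber d \<alpha> \<gamma> N M g (ls ! j)"
    using fiber_enumE[OF assms(3)] by metis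
  obtain j where j: "j < length Fs" "F = Fs ! j" using assms(4) by (metis in_set_conv_nth)
  show "distinct F" using ls(2) j by simp
  have F: "set F = fiber d \<alpha> \<gamma> N M g (ls ! j)" using ls(3) j by simp
  then show "set F \<subseteq> int_vecs d" by (auto simp: fiber_def freq_set_def)
  have "ls ! j \<in> set F" using ls(1)[OF j(1)] by (simp add: F fiber_def)
  then show "F \<noteq> []" by auto
  have "length F = card (fiber d \<alpha> \<gamma> N M g (ls ! j))"
    using F distinct_card[OF \<open>distinct F\<close>] by simp
  also have "\<dots> \<le> max_fiber_length d \<alpha> \<gamma> N M g"
    using ls(1)[OF j(1)] by (intro card_fiber_le_max_fiber_length assms) (simp add: freq_set_def)
  finally show "length F \<le> max_fiber_length d \<alpha> \<gamma> N M g" .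
qed

text \<open>Different fibers belong to different residue classes.\<close>

lemma card_fibers_le:
  assumes "fiber_enum d \<alpha> \<gamma> N M g Fs" "N > 0"
  shows "card (set Fs) \<le> N"
proof -
  obtain ls where ls: "\<And>j. j < length Fs \<Longrightarrow> ls ! j \<in> freq_set d \<alpha> \<gamma> M"
    "\<And>j. j < length Fs \<Longrightarrow> set (Fs ! j) = fiber d \<alpha> \<gamma> N M g (ls ! j)"
    "\<And>i j. i < length Fs \<Longrightarrow> j < length Fs \<Longrightarrow> i \<noteq> j \<Longrightarrow> set (Fs ! i) \<inter> set (Fs ! j) = {}"
    using fiber_enumE[OF assms(1)] by metis
  let ?h = "\<lambda>j. int_dot d (ls ! j) g mod int N"
  have "inj_on ?h {..<length Fs}"
  proof (rule inj_onI, rule ccontr)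
    fix i j assume ij: "i \<in> {..<length Fs}" "j \<in> {..<length Fs}" "?h i = ?h j" "i \<noteq> j"
    then have "ls ! i \<in> set (Fs ! i) \<inter> set (Fs ! j)"
      using ls(1) ls(2) by (auto simp: fiber_def cong_def)
    then show False using ls(3)[of i j] ij by auto
  qed
  moreover have "?h ` {..<length Fs} \<subseteq> {0..<int N}" using assms(2) by auto
  ultimately have "card {..<length Fs} \<le> card {0..<int N}" by (intro card_inj_on_le) auto
  then show ?thesis using card_length[of Fs] by simp
qed

text \<open>Averaged over the random shift, the aliasing terms in each of the \<open>S * length
  F\<close> equations of a fiber are orthogonal and amount to the squared mass of \<open>f\<close>
  on the part of the residue class outside the frequency set. Least squares divides the sum by
  \<open>S\<close>, so each class enters with the factor \<open>length F \<le> R\<close>, and the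
  classes are disjoint.\<close>

lemma ran_error_le:
  assumes w: "pos_weights d \<gamma>" and \<alpha>: "\<alpha> > 0" and N: "N > 0" and M: "M > 0" and S: "S > 0"
    and enum: "fiber_enum d \<alpha> \<gamma> N M g Fs" and good: "good_shifts d S Fs y"
    and len: "\<And>F. F \<in> set Fs \<Longrightarrow> length F \<le> R"
  shows "ran_error d \<alpha> \<gamma> (lattice_algorithm d N g S y Fs) \<le> ennreal (sqrt (1 + real R) / M)"
  unfolding ran_error_def
proof (rule SUP_least)
  fix f assume "f \<in> {f \<in> korobov_space d \<alpha> \<gamma>. korobov_norm d \<alpha> \<gamma> f \<le> 1}"
  then have f: "f \<in> korobov_space d \<alpha> \<gamma>" "korobov_norm d \<alpha> \<gamma> f \<le> 1" by auto
  let ?A = "freq_set d \<alpha> \<gamma> M" and ?c = "fourier_coeff d f" and ?J = "length Fs"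
  let ?C = "\<lambda>k. (cmod (?c k))\<^sup>2"
  let ?err = "\<lambda>\<Delta>. \<integral>\<^sup>+x. ennreal ((cmod (f x - lattice_algorithm d N g S y Fs \<Delta> f x))\<^sup>2) \<partial>cube d"
  let ?v = "\<lambda>j. length (Fs ! j)" and ?app = "\<lambda>\<Delta> j i. approx_coeffs d N g S y (Fs ! j) \<Delta> f $ i"
  obtain ls where ls: "\<And>j. j < ?J \<Longrightarrow> ls ! j \<in> ?A"
    "\<And>j. j < ?J \<Longrightarrow> distinct (Fs ! j)"
    "\<And>j. j < ?J \<Longrightarrow> set (Fs ! j) = fiber d \<alpha> \<gamma> N M g (ls ! j)"
    "\<And>i j. i < ?J \<Longrightarrow> j < ?J \<Longrightarrow> i \<noteq> j \<Longrightarrow> set (Fs ! i) \<inter> set (Fs ! j) = {}"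
    "(\<Union>j<?J. set (Fs ! j)) = ?A"
    using fiber_enumE[OF enum] by metis
  have finA: "finite ?A" by (rule finite_freq_set[OF w \<alpha>])
  note tail = korobov_tail[OF f w less_imp_le[OF \<alpha>] M]
  define rest where "rest = (\<lambda>j. {k \<in> int_vecs d - ?A. [int_dot d k g = int_dot d (ls ! j) g] (mod int N)})"
  define mass where "mass = (\<lambda>j. \<Sum>\<^sub>\<infinity>k\<in>rest j. ?C k)"
  define \<eta> where "\<eta> = (\<lambda>j q \<Delta>. data_vec d N g S y (Fs ! j) \<Delta> f $ q -
    (\<Sum>i<?v j. B_mat d S y (Fs ! j) $$ (q, i) * (wave d (Fs ! j ! i) \<Delta> * ?c (Fs ! j ! i))))"
  let ?H = "\<lambda>j q \<Delta>. (cmod (\<eta> j q \<Delta>))\<^sup>2" and ?y = "\<lambda>q. y (q div S, q mod S)"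
  let ?E = "\<lambda>j q \<Delta>. ennreal (1 / real S) * ennreal (?H j q \<Delta>)"
  have rest_summable: "(\<lambda>k. ?C k) summable_on rest j" for j
    by (rule summable_on_subset_banach[OF tail(1)]) (auto simp: rest_def)

  have \<eta>_sum: "((\<lambda>k. (if k \<in> rest j then ?c k * wave d k (?y q) else 0) *
      wave d k \<Delta>) has_sum \<eta> j q \<Delta>) (int_vecs d)"
    if "j < ?J" "q < ?v j * S" for j q \<Delta>
    unfolding \<eta>_def rest_def
    by (rule residual_has_sum[OF f(1) N S ls(2)[OF that(1)] _ that(2)])
       (auto simp: ls(3)[OF that(1)] fiber_def freq_set_def)
  have \<eta>_meas: "\<eta> j q \<in> borel_measurable (cube d)" if "j < ?J" "q < ?v j * S" for j q
    by (rule borel_measurable_fourier_series[OF \<eta>_sum[OF that]])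
  have \<eta>_le: "(\<integral>\<^sup>+\<Delta>. ennreal (?H j q \<Delta>) \<partial>cube d) \<le> ennreal (mass j)"
    if jq: "j < ?J" "q < ?v j * S" for j q
  proof (rule fourier_parseval_le[OF \<eta>_sum[OF jq]])
    fix X assume X: "finite X" "X \<subseteq> int_vecs d"
    have "(\<Sum>k\<in>X. (cmod (if k \<in> rest j then ?c k * wave d k (?y q) else 0))\<^sup>2) =
        (\<Sum>k\<in>X \<inter> rest j. ?C k)"
      using X by (intro sum.mono_neutral_cong_right) (auto simp: norm_mult)
    also have "\<dots> \<le> mass j"
      unfolding mass_def using X by (intro finite_sum_le_infsum rest_summable) auto
    finally show "(\<Sum>k\<in>X. (cmod (if k \<in> rest j then ?c k * wave d k (?y q) else 0))\<^sup>2)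
      \<le> mass j" .
  qed

  have mass: "(\<Sum>j<?J. mass j) \<le> 1 / M\<^sup>2"
  proof -
    have "(\<Sum>j<?J. mass j) = (\<Sum>\<^sub>\<infinity>k\<in>(\<Union>j<?J. rest j). ?C k)"
      unfolding mass_def
    proof (rule sum_infsum)
      fix i j assume ij: "i \<in> {..<?J}" "j \<in> {..<?J}" "i \<noteq> j"
      show "rest i \<inter> rest j = {}"
      proof (rule ccontr)
        assume "rest i \<inter> rest j \<noteq> {}"
        then have "[int_dot d (ls ! i) g = int_dot d (ls ! j) g] (mod int N)"
          by (auto simp: rest_def cong_def)
        then have "ls ! i \<in> set (Fs ! i) \<inter> set (Fs ! j)"
          using ls(1,3) ij by (auto simp: fiber_def)
        then show False using ls(4)[of i j] ij by auto
      qed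
    qed (use rest_summable in auto)
    also have "\<dots> \<le> 1 / M\<^sup>2" by (rule tail(2)) (auto simp: rest_def)
    finally show ?thesis .
  qed
  have mass_nonneg: "mass j \<ge> 0" for j unfolding mass_def by (rule infsum_nonneg) simp

  have inner: "?err \<Delta> \<le>
      ennreal (1 / M\<^sup>2 + (\<Sum>j<?J. \<Sum>q<?v j * S. 1 / real S * ?H j q \<Delta>))" for \<Delta>
  proof -
    let ?D = "\<lambda>j i. (cmod (?app \<Delta> j i - ?c (Fs ! j ! i)))\<^sup>2"
    define b where "b = (\<lambda>k. \<Sum>j<?J. \<Sum>i<?v j. if Fs ! j ! i = k then ?app \<Delta> j i else 0)"
    have mem: "Fs ! j ! i \<in> ?A" if "j < ?J" "i < ?v j" for j i
      using that ls(5) nth_mem by blast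
    have b_nth: "b (Fs ! j ! i) = ?app \<Delta> j i" if ji: "j < ?J" "i < ?v j" for j i
    proof -
      have "Fs ! j' ! i' = Fs ! j ! i \<longleftrightarrow> j' = j \<and> i' = i" if "j' < ?J" "i' < ?v j'" for j' i'
      proof
        assume eq: "Fs ! j' ! i' = Fs ! j ! i"
        then have in_both: "Fs ! j ! i \<in> set (Fs ! j') \<inter> set (Fs ! j)"
          using ji that nth_mem by (metis IntI)
        have "j' = j"
        proof (rule ccontr)
          assume "j' \<noteq> j"
          then have "set (Fs ! j') \<inter> set (Fs ! j) = {}" using ls(4) ji that by blast
          with in_both show False by blast
        qed
        then show "j' = j \<and> i' = i"
          using eq ls(2)[OF ji(1)] ji that by (auto simp: nth_eq_iff_index_eq)
      qed auto
      then have "b (Fs ! j ! i) = (\<Sum>j'<?J. \<Sum>i'<?v j'. if j' = j then if i' = i then ?app \<Delta> j i else 0 else 0)"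
        unfolding b_def by (intro sum.cong) auto
      also have "\<dots> = (\<Sum>j'<?J. if j' = j then \<Sum>i'<?v j. if i' = i then ?app \<Delta> j i else 0 else 0)"
        by (intro sum.cong) auto
      also have "\<dots> = ?app \<Delta> j i" using ji by simp
      finally show ?thesis .
    qed
    have b_out: "b k = 0" if "k \<notin> ?A" for k
      unfolding b_def using that mem by (intro sum.neutral ballI) auto
    have b_sum: "((\<lambda>k. b k * wave d k x) has_sum lattice_algorithm d N g S y Fs \<Delta> f x) (int_vecs d)" for x
      unfolding b_def lattice_algorithm_def sum_distrib_right
    proof (intro has_sum_sum)
      fix j i assume "j \<in> {..<?J}" "i \<in> {..<?v j}"
      then have "Fs ! j ! i \<in> int_vecs d" using mem by (auto simp: freq_set_def)
      then show "((\<lambda>k. (if Fs ! j ! i = k then ?app \<Delta> j i else 0) * wave d k x) has_sum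
          ?app \<Delta> j i * wave d (Fs ! j ! i) x) (int_vecs d)"
        by (intro has_sum_finite_neutralI[of "{Fs ! j ! i}"]) auto
    qed
    let ?B = "\<lambda>k. (cmod (?c k - b k))\<^sup>2"
    have "?err \<Delta> \<le> ennreal (1 / M\<^sup>2 + (\<Sum>j<?J. \<Sum>i<?v j. ?D j i))"
    proof (rule fourier_parseval_le[where c = "\<lambda>k. ?c k - b k"])
      fix x assume "x \<in> space (cube d)"
      from has_sum_add[OF korobov_has_sum[OF f(1) this] has_sum_uminusI[OF b_sum[of x]]]
      show "((\<lambda>k. (?c k - b k) * wave d k x) has_sum
          (f x - lattice_algorithm d N g S y Fs \<Delta> f x)) (int_vecs d)"
        by (simp add: left_diff_distrib)
    next
      fix X assume X: "finite X" "X \<subseteq> int_vecs d"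
      have "(\<Sum>k\<in>X. ?B k) = (\<Sum>k\<in>X - ?A. ?B k) + (\<Sum>k\<in>X \<inter> ?A. ?B k)"
        using X by (subst sum.union_disjoint[symmetric]) (auto intro!: sum.cong)
      also have "(\<Sum>k\<in>X - ?A. ?B k) = (\<Sum>k\<in>X - ?A. ?C k)"
        using b_out by (intro sum.cong) auto
      also have "\<dots> \<le> (\<Sum>\<^sub>\<infinity>k\<in>int_vecs d - ?A. ?C k)"
        using X by (intro finite_sum_le_infsum summable_on_subset_banach[OF tail(1)]) auto
      also have "\<dots> \<le> 1 / M\<^sup>2" by (rule tail(2)) simp
      also have "(\<Sum>k\<in>X \<inter> ?A. ?B k) \<le> (\<Sum>k\<in>?A. ?B k)"
        using finA by (intro sum_mono2) auto
      also have "\<dots> = (\<Sum>j<?J. \<Sum>k\<in>set (Fs ! j). ?B k)"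
        unfolding ls(5)[symmetric] using ls(4) by (intro sum.UNION_disjoint) auto
      also have "\<dots> = (\<Sum>j<?J. \<Sum>i<?v j. ?D j i)"
      proof (intro sum.cong refl)
        fix j assume j: "j \<in> {..<?J}"
        have "(\<Sum>k\<in>set (Fs ! j). ?B k) = (\<Sum>i<?v j. (cmod (?c (Fs ! j ! i) - b (Fs ! j ! i)))\<^sup>2)"
          using j ls(2)
            sum.reindex_bij_betw[OF bij_betw_nth[OF _ refl refl], of "Fs ! j" "\<lambda>k. ?B k"]
          by simp
        also have "\<dots> = (\<Sum>i<?v j. ?D j i)"
          using j b_nth by (intro sum.cong) (auto simp: norm_minus_commute)
        finally show "(\<Sum>k\<in>set (Fs ! j). ?B k) = (\<Sum>i<?v j. ?D j i)" .
      qed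
      finally show "(\<Sum>k\<in>X. ?B k) \<le>
          1 / M\<^sup>2 + (\<Sum>j<?J. \<Sum>i<?v j. ?D j i)" by simp
    qed
    also have "\<dots> \<le> ennreal (1 / M\<^sup>2 + (\<Sum>j<?J. \<Sum>q<?v j * S. 1 / real S * ?H j q \<Delta>))"
    proof (intro ennreal_leI add_left_mono sum_mono)
      fix j assume j: "j \<in> {..<?J}"
      then have "gram_expands d S y (Fs ! j)" using good good_shifts_iff[OF S] by auto
      from approx_coeffs_error[OF S this, of N g \<Delta> f "\<lambda>i. ?c (Fs ! j ! i)"]
      show "(\<Sum>i<?v j. ?D j i) \<le>
          (\<Sum>q<?v j * S. 1 / real S * ?H j q \<Delta>)"
        unfolding \<eta>_def sum_distrib_left .
    qed
    finally show ?thesis .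
  qed

  have "(\<integral>\<^sup>+\<Delta>. ?err \<Delta> \<partial>cube d) \<le>
      (\<integral>\<^sup>+\<Delta>. ennreal (1 / M\<^sup>2) + (\<Sum>j<?J. \<Sum>q<?v j * S. ?E j q \<Delta>) \<partial>cube d)"
  proof (rule nn_integral_mono)
    fix \<Delta>
    have "ennreal (1 / M\<^sup>2 + (\<Sum>j<?J. \<Sum>q<?v j * S. 1 / real S * ?H j q \<Delta>)) =
        ennreal (1 / M\<^sup>2) + (\<Sum>j<?J. \<Sum>q<?v j * S. ?E j q \<Delta>)"
    proof -
      have "(\<Sum>j<?J. \<Sum>q<?v j * S. ?E j q \<Delta>) =
          ennreal (\<Sum>j<?J. \<Sum>q<?v j * S. 1 / real S * ?H j q \<Delta>)"
        by (simp add: sum_nonneg sum_ennreal flip: ennreal_mult')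
      then show ?thesis by (simp add: sum_nonneg)
    qed
    with inner[of \<Delta>] show "?err \<Delta> \<le>
        ennreal (1 / M\<^sup>2) + (\<Sum>j<?J. \<Sum>q<?v j * S. ?E j q \<Delta>)"
      by simp
  qed
  also have "\<dots> = ennreal (1 / M\<^sup>2) + (\<Sum>j<?J. \<Sum>q<?v j * S. ennreal (1 / real S) *
      (\<integral>\<^sup>+\<Delta>. ennreal (?H j q \<Delta>) \<partial>cube d))"
  proof -
    have sq: "(\<lambda>\<Delta>. ?H j q \<Delta>) \<in> borel_measurable (cube d)"
      if "j < ?J" "q < ?v j * S" for j q
      using \<eta>_meas[OF that] by measurable
    have m: "(\<lambda>\<Delta>. \<Sum>q<?v j * S. ?E j q \<Delta>) \<in> borel_measurable (cube d)"
      if "j < ?J" for j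
      using that sq by (intro borel_measurable_sum borel_measurable_times_ennreal) auto
    have "(\<integral>\<^sup>+\<Delta>. ennreal (1 / M\<^sup>2) + (\<Sum>j<?J. \<Sum>q<?v j * S. ?E j q \<Delta>) \<partial>cube d) =
        (\<integral>\<^sup>+\<Delta>. ennreal (1 / M\<^sup>2) \<partial>cube d) +
        (\<integral>\<^sup>+\<Delta>. (\<Sum>j<?J. \<Sum>q<?v j * S. ?E j q \<Delta>) \<partial>cube d)"
      by (rule nn_integral_add) (use m in auto)
    also have "(\<integral>\<^sup>+\<Delta>. (\<Sum>j<?J. \<Sum>q<?v j * S. ?E j q \<Delta>) \<partial>cube d) =
        (\<Sum>j<?J. \<integral>\<^sup>+\<Delta>. (\<Sum>q<?v j * S. ?E j q \<Delta>) \<partial>cube d)"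
      by (rule nn_integral_sum) (use m in auto)
    also have "\<dots> = (\<Sum>j<?J. \<Sum>q<?v j * S. \<integral>\<^sup>+\<Delta>. ?E j q \<Delta> \<partial>cube d)"
      by (intro sum.cong refl nn_integral_sum) (use sq in auto)
    also have "\<dots> = (\<Sum>j<?J. \<Sum>q<?v j * S. ennreal (1 / real S) * (\<integral>\<^sup>+\<Delta>. ennreal (?H j q \<Delta>) \<partial>cube d))"
      by (intro sum.cong refl nn_integral_cmult) (use sq in auto)
    also have "(\<integral>\<^sup>+\<Delta>. ennreal (1 / M\<^sup>2) \<partial>cube d) = ennreal (1 / M\<^sup>2)"
      by (simp add: prob_space.emeasure_space_1[OF prob_space_cube])
    finally show ?thesis .
  qed
  also have "\<dots> \<le> ennreal (1 / M\<^sup>2) + (\<Sum>j<?J. \<Sum>q<?v j * S. ennreal (1 / real S) * ennreal (mass j))"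
    using \<eta>_le by (intro add_left_mono sum_mono mult_left_mono) auto
  also have "\<dots> = ennreal (1 / M\<^sup>2 + (\<Sum>j<?J. real (?v j) * mass j))"
  proof -
    have "(\<Sum>q<?v j * S. ennreal (1 / real S) * ennreal (mass j)) = ennreal (real (?v j) * mass j)" for j
    proof -
      have "(\<Sum>q<?v j * S. ennreal (1 / real S) * ennreal (mass j)) = (\<Sum>q<?v j * S. ennreal (1 / real S * mass j))"
        using mass_nonneg by (intro sum.cong refl ennreal_mult[symmetric]) auto
      also have "\<dots> = ennreal (\<Sum>q<?v j * S. 1 / real S * mass j)"
        using mass_nonneg by (intro sum_ennreal) auto
      also have "(\<Sum>q<?v j * S. 1 / real S * mass j) = real (?v j) * mass j"
        using S by simp
      finally show ?thesis .
    qed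
    then have "(\<Sum>j<?J. \<Sum>q<?v j * S. ennreal (1 / real S) * ennreal (mass j)) = (\<Sum>j<?J. ennreal (real (?v j) * mass j))"
      by simp
    also have "\<dots> = ennreal (\<Sum>j<?J. real (?v j) * mass j)"
      using mass_nonneg by (intro sum_ennreal) auto
    finally show ?thesis
      using mass_nonneg by (simp add: ennreal_plus[symmetric] sum_nonneg del: ennreal_plus)
  qed
  also have "\<dots> \<le> ennreal ((1 + real R) / M\<^sup>2)"
  proof (rule ennreal_leI)
    have "(\<Sum>j<?J. real (?v j) * mass j) \<le> (\<Sum>j<?J. real R * mass j)"
      using len mass_nonneg by (intro sum_mono mult_right_mono) auto
    also have "\<dots> = real R * (\<Sum>j<?J. mass j)" by (simp add: sum_distrib_left)
    also have "\<dots> \<le> real R * (1 / M\<^sup>2)" using mass by (intro mult_left_mono) auto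
    finally show "1 / M\<^sup>2 + (\<Sum>j<?J. real (?v j) * mass j) \<le> (1 + real R) / M\<^sup>2"
      by (simp add: add_divide_distrib)
  qed
  finally have le: "(\<integral>\<^sup>+\<Delta>. ?err \<Delta> \<partial>cube d)
      \<le> ennreal ((1 + real R) / M\<^sup>2)" (is "?I \<le> _") .
  have finite: "?I \<noteq> (\<top> :: ennreal)" by (rule neq_top_trans[OF ennreal_neq_top le])
  have "enn2real ?I \<le> (1 + real R) / M\<^sup>2" by (rule enn2real_leI[OF _ le]) (use M in simp)
  then have "sqrt (enn2real ?I) \<le> sqrt ((1 + real R) / M\<^sup>2)" by (rule real_sqrt_le_mono)
  also have "\<dots> = sqrt (1 + real R) / M" using M by (simp add: real_sqrt_divide)
  finally show "ennreal_sqrt ?I \<le> ennreal (sqrt (1 + real R) / M)"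
    using finite by (simp add: ennreal_sqrt_def ennreal_leI)
qed

section \<open>Combining the estimates\<close>

lemma exists_dyadic_exponent:
  assumes "x > (1 :: real)"
  obtains m :: nat where "m \<ge> 1" "2 ^ (m - 1) < x" "x \<le> 2 ^ m"
proof -
  obtain n where n: "x \<le> 2 ^ n" using real_arch_pow[of 2 x] less_imp_le by auto
  define m where "m = (LEAST m. x \<le> 2 ^ m)"
  have le: "x \<le> 2 ^ m" unfolding m_def by (rule LeastI[of _ n]) (rule n)
  have "m \<noteq> 0" using le assms by (intro notI) simp
  then have "\<not> x \<le> 2 ^ (m - 1)" unfolding m_def by (intro not_less_Least) simp
  then show ?thesis using le \<open>m \<noteq> 0\<close> by (intro that[of m]) auto
qed

text \<open>The conditional bound holds uniformly over the good values of the first component, so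
  it survives averaging over them.\<close>

lemma prob_joint_law_ge:
  assumes meas: "\<And>g. g \<in> set_pmf p \<Longrightarrow> P g \<Longrightarrow> {y \<in> space (\<kappa> g). Q g y} \<in> sets (\<kappa> g)"
    and prob: "\<And>g. g \<in> set_pmf p \<Longrightarrow> prob_space (\<kappa> g)"
    and b: "\<And>g. g \<in> set_pmf p \<Longrightarrow> P g \<Longrightarrow> measure (\<kappa> g) {y \<in> space (\<kappa> g). Q g y} \<ge> b"
    and a: "measure_pmf.prob p {g. P g} \<ge> a" and pos: "a \<ge> 0" "b \<ge> 0"
  shows "measure (joint_law p \<kappa>) {(g, y) \<in> space (joint_law p \<kappa>). P g \<and> Q g y} \<ge> a * b"
proof -
  let ?L = "joint_law p \<kappa>"
  let ?X = "{(g, y) \<in> space ?L. P g \<and> Q g y}"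
  interpret prob_space ?L by (rule prob_space_joint_law[OF prob])
  have section_eq: "Pair g -` ?X = (if P g then {y \<in> space (\<kappa> g). Q g y} else {})" if "g \<in> set_pmf p" for g
    using that by (auto simp: space_joint_law)
  have X: "?X \<in> sets ?L"
    unfolding sets_joint_law using section_eq meas by (auto simp: space_joint_law)
  have "ennreal (a * b) \<le> ennreal b * emeasure (measure_pmf p) {g. P g}"
    using mult_right_mono[OF a pos(2)] pos
    by (simp add: measure_pmf.emeasure_eq_measure mult.commute ennreal_leI flip: ennreal_mult)
  also have "\<dots> = (\<integral>\<^sup>+g. ennreal b * indicator {g. P g} g \<partial>measure_pmf p)"
    by (simp add: nn_integral_cmult_indicator)
  also have "\<dots> \<le> (\<integral>\<^sup>+g. emeasure (\<kappa> g) (Pair g -` ?X) \<partial>measure_pmf p)"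
  proof (rule nn_integral_mono_AE, rule AE_pmfI)
    fix g assume g: "g \<in> set_pmf p"
    interpret k: prob_space "\<kappa> g" by (rule prob[OF g])
    show "ennreal b * indicator {g. P g} g \<le> emeasure (\<kappa> g) (Pair g -` ?X)"
      unfolding section_eq[OF g] using b[OF g]
      by (auto simp: k.emeasure_eq_measure indicator_def ennreal_leI)
  qed
  also have "\<dots> = emeasure ?L ?X" by (rule emeasure_joint_law[OF X, symmetric])
  also have "\<dots> = ennreal (measure ?L ?X)" by (rule emeasure_eq_measure)
  finally show ?thesis by (simp add: ennreal_le_iff)
qed

lemma threshold_gt_1_dyadic:
  fixes M \<alpha> :: real
  assumes "M > 1" "\<alpha> > 0"
  obtains m :: nat where "m \<ge> 1" "2 ^ (m - 1) < M powr (1 / \<alpha>)" "M powr (1 / \<alpha>) \<le> 2 ^ m"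
proof (rule exists_dyadic_exponent)
  show "M powr (1 / \<alpha>) > 1" using powr_less_mono2[of "1 / \<alpha>" 1 M] assms by simp
qed (use that in blast)

theorem theorem2:
  fixes d :: nat and \<alpha> \<delta> K :: real and \<gamma> :: "nat \<Rightarrow> real"
  assumes "d \<ge> 1" and "\<alpha> > 1 / 2"
    and "\<forall>j<d. 0 < \<gamma> j \<and> \<gamma> j \<le> 1"
    and "0 < \<delta>" and "\<delta> < 1" and "K > 1"
  defines "R \<equiv> \<lambda>N g. max_fiber_length d \<alpha> \<gamma> N (M_ran d \<alpha> \<gamma> \<delta> N) g"
  defines "S \<equiv> \<lambda>N g. num_shifts K N (R N g)"
  defines "R' \<equiv> \<lambda>N g. max_fiber_length d \<alpha> \<gamma> N (M_cbc d \<alpha> \<gamma> N) g"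
  defines "S' \<equiv> \<lambda>N g. num_shifts K N (R' N g)"
  shows
    "(\<forall>N m0. admissible d \<alpha> \<gamma> \<delta> N m0 \<longrightarrow>
        measure_pmf.prob (pmf_of_set (gen_vecs d N)) {g. good_gen d \<alpha> \<gamma> \<delta> N m0 g} \<ge> \<delta>) \<and>
     (\<forall>\<^sub>F N in sequentially. \<forall>m0. admissible d \<alpha> \<gamma> \<delta> N m0 \<longrightarrow>
        2 * real N powr (1 - K) * (R_star d m0)\<^sup>2 < 1) \<and>
     (\<forall>N m0. admissible d \<alpha> \<gamma> \<delta> N m0 \<and> 2 * real N powr (1 - K) * (R_star d m0)\<^sup>2 < 1 \<longrightarrow>
        (\<forall>g\<in>gen_vecs d N. \<forall>Fs.
           good_gen d \<alpha> \<gamma> \<delta> N m0 g \<and> fiber_enum d \<alpha> \<gamma> N (M_ran d \<alpha> \<gamma> \<delta> N) g Fs \<longrightarrow>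
           measure (shift_law d (R N g) (S N g))
             {y \<in> space (shift_law d (R N g) (S N g)). good_shifts d (S N g) Fs y}
           \<ge> 1 - 2 * real N powr (1 - K) * (R_star d m0)\<^sup>2) \<and>
        (\<forall>Fs. (\<forall>g\<in>gen_vecs d N. fiber_enum d \<alpha> \<gamma> N (M_ran d \<alpha> \<gamma> \<delta> N) g (Fs g)) \<longrightarrow>
           (let P = joint_law (pmf_of_set (gen_vecs d N)) (\<lambda>g. shift_law d (R N g) (S N g)) in
            measure P {(g, y) \<in> space P. good_gen d \<alpha> \<gamma> \<delta> N m0 g \<and> good_shifts d (S N g) (Fs g) y}
            \<ge> \<delta> * (1 - 2 * real N powr (1 - K) * (R_star d m0)\<^sup>2))) \<and>
        \<delta> * (1 - 2 * real N powr (1 - K) * (R_star d m0)\<^sup>2) > 0) \<and>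
     (\<forall>\<tau>. 0 < \<tau> \<and> \<tau> \<le> 1 \<longrightarrow> (\<exists>C.
        (\<forall>N m0 g Fs y.
           admissible d \<alpha> \<gamma> \<delta> N m0 \<and> g \<in> gen_vecs d N \<and> good_gen d \<alpha> \<gamma> \<delta> N m0 g \<and>
           fiber_enum d \<alpha> \<gamma> N (M_ran d \<alpha> \<gamma> \<delta> N) g Fs \<and>
           y \<in> space (shift_law d (R N g) (S N g)) \<and> good_shifts d (S N g) Fs y \<longrightarrow>
           error_bound d \<alpha> \<gamma> \<tau> C N g (R N g) (S N g) Fs y) \<and>
        (\<alpha> \<in> \<nat> \<longrightarrow>
           (\<forall>N g Fs y.
              prime N \<and> N > 2 \<and> M_cbc d \<alpha> \<gamma> N > 1 \<and> cbc_output d \<alpha> \<gamma> N g \<and>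
              fiber_enum d \<alpha> \<gamma> N (M_cbc d \<alpha> \<gamma> N) g Fs \<and>
              y \<in> space (shift_law d (R' N g) (S' N g)) \<and> good_shifts d (S' N g) Fs y \<longrightarrow>
              error_bound d \<alpha> \<gamma> \<tau> C N g (R' N g) (S' N g) Fs y))))"
proof -
  have w: "pos_weights d \<gamma>" using assms(3) by (simp add: pos_weights_def)
  have d: "d \<ge> 1" and \<alpha>: "\<alpha> > 1 / 2" and \<delta>: "0 < \<delta>" "\<delta> < 1" and K: "K > 1" by fact+
  have \<alpha>0: "\<alpha> > 0" using \<alpha> by simp
  have K0: "K > 0" using K by simp
  let ?M = "M_ran d \<alpha> \<gamma> \<delta>" and ?c = "\<lambda>N. (real N - 1) * (1 - \<delta>)"
  let ?fail = "\<lambda>N m0. 2 * real N powr (1 - K) * (R_star d m0)\<^sup>2"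
  let ?\<kappa> = "\<lambda>N g. shift_law d (R N g) (S N g)" and ?p = "\<lambda>N. pmf_of_set (gen_vecs d N)"
  let ?L = "\<lambda>N. joint_law (?p N) (?\<kappa> N)" and ?b = "min ((1 - \<delta>) / 2) (1 / 2)"
  let ?Y = "\<lambda>N g Fs. {y \<in> space (?\<kappa> N g). good_shifts d (S N g) Fs y}"
  let "_ \<and> _ \<and> _ \<and> (\<forall>\<tau>. 0 < \<tau> \<and> \<tau> \<le> 1 \<longrightarrow> (\<exists>C. ?ran \<tau> C \<and> (\<alpha> \<in> \<nat> \<longrightarrow> ?cbc \<tau> C)))" = ?thesis
  have adm: "prime N" "N > 2" "?M N > 1" "m0 \<ge> 1" "2 ^ (m0 - 1) < ?M N powr (1 / \<alpha>)" "?M N powr (1 / \<alpha>) \<le> 2 ^ m0"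
    if "admissible d \<alpha> \<gamma> \<delta> N m0" for N m0
    using that by (auto simp: admissible_def)
  have c: "0 < ?c N" "?c N \<le> real N" "(1 - \<delta>) / 2 * real N \<le> ?c N" if "N > 2" for N
  proof -
    show "0 < ?c N" using that \<delta> by (intro mult_pos_pos) auto
    have "(real N - 1) * (1 - \<delta>) \<le> (real N - 1) * 1" using that \<delta> by (intro mult_left_mono) auto
    then show "?c N \<le> real N" by simp
    have "(1 - \<delta>) * (real N / 2) \<le> (1 - \<delta>) * (real N - 1)" using that \<delta> by (intro mult_left_mono) auto
    then show "(1 - \<delta>) / 2 * real N \<le> ?c N" by (simp add: mult_ac)
  qed
  have M_le: "?M N \<le> real N powr \<alpha>" if "N > 2" for N
    unfolding M_ran_def by (rule threshold_le[OF w \<alpha> d c(1,2)[OF that]]) (use that in simp)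

  have part1: "measure_pmf.prob (?p N) {g. good_gen d \<alpha> \<gamma> \<delta> N m0 g} \<ge> \<delta>"
    if a: "admissible d \<alpha> \<gamma> \<delta> N m0" for N m0
  proof -
    have N: "N > 2" "N > 0" using adm(2)[OF a] by auto
    obtain l where l: "\<alpha> * l > 1" "?M N powr l * euler_prod d \<alpha> \<gamma> l = ?c N" "?M N > 0"
      using threshold_equation[OF w \<alpha> d c(1)[OF N(1)]] unfolding M_ran_def by metis
    have "\<delta> \<le> measure_pmf.prob (?p N)
        {g. \<forall>k\<in>dual_lattice d N g - {zero_vec d}. korobov_r d \<alpha> \<gamma> k \<ge> ?M N}"
      by (rule prob_dual_lattice_avoids[OF w \<alpha>0 l(1) d adm(1)[OF a] l(3) M_le[OF N(1)]]) (use \<delta> l in auto)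
    also have "\<dots> \<le> measure_pmf.prob (?p N) {g. good_gen d \<alpha> \<gamma> \<delta> N m0 g}"
    proof (rule measure_pmf.finite_measure_mono)
      show "{g. \<forall>k\<in>dual_lattice d N g - {zero_vec d}. korobov_r d \<alpha> \<gamma> k \<ge> ?M N} \<subseteq> {g. good_gen d \<alpha> \<gamma> \<delta> N m0 g}"
        using merit_ge_iff[OF w \<alpha>0 d N(2)] max_fiber_length_le_R_star[OF w \<alpha>0 d adm(4)[OF a] N(2) _ adm(6)[OF a]]
        by (auto simp: good_gen_def)
    qed simp
    finally show ?thesis .
  qed

  have R1: "R N g \<ge> 1" if "admissible d \<alpha> \<gamma> \<delta> N m0" for N m0 g
    unfolding R_def by (rule max_fiber_length_pos[OF w \<alpha>0 adm(3)[OF that]])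
  have S0: "S N g > 0" if "admissible d \<alpha> \<gamma> \<delta> N m0" for N m0 g
    unfolding S_def by (rule num_shifts_pos[OF K0 adm(2)[OF that] R1[OF that]])

  have part2a: "\<forall>\<^sub>F N in sequentially. \<forall>m0. admissible d \<alpha> \<gamma> \<delta> N m0 \<longrightarrow> ?fail N m0 < 1"
    using failure_probability_tendsto_0[OF K \<alpha>0, of d]
  proof eventually_elim
    case (elim N)
    show ?case
    proof (intro allI impI)
      fix m0 assume a: "admissible d \<alpha> \<gamma> \<delta> N m0"
      have "m0 \<ge> 1 \<and> 0 < ?M N \<and> ?M N \<le> real N powr \<alpha> \<and> 2 ^ (m0 - 1) < ?M N powr (1 / \<alpha>)"
        using adm[OF a] M_le[OF adm(2)[OF a]] by auto
      with elim show "?fail N m0 < 1" by blast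
    qed
  qed

  have part2b: "measure (?\<kappa> N g) (?Y N g Fs)
      \<ge> 1 - ?fail N m0"
    if a: "admissible d \<alpha> \<gamma> \<delta> N m0" and g: "good_gen d \<alpha> \<gamma> \<delta> N m0 g"
      and Fs: "fiber_enum d \<alpha> \<gamma> N (?M N) g Fs" for N m0 g Fs
  proof -
    have N: "N > 2" "N \<ge> 1" "N > 0" using adm(2)[OF a] by auto
    have "measure (?\<kappa> N g) (?Y N g Fs)
        \<ge> 1 - real (card (set Fs)) * (2 * (real (R N g))\<^sup>2 * real N powr (- K))"
    proof (rule prob_good_shifts[OF S0[OF a] _ K0 N(2)])
      show "2 * K * real (R N g) * ln (real N) \<le> real (S N g)"
        unfolding S_def by (rule num_shifts_ge[OF K0 N(2)])
      show "distinct F \<and> set F \<subseteq> int_vecs d \<and> F \<noteq> [] \<and> length F \<le> R N g" if "F \<in> set Fs" for F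
        using length_fiber_le[OF w \<alpha>0 Fs that] by (simp add: R_def)
    qed
    moreover have "real (card (set Fs)) * (2 * (real (R N g))\<^sup>2 * real N powr (- K)) \<le> ?fail N m0"
    proof -
      have RR: "real (R N g) \<le> R_star d m0" using g by (simp add: good_gen_def R_def)
      have "real (card (set Fs)) * (2 * (real (R N g))\<^sup>2 * real N powr (- K)) \<le>
          real N * (2 * (R_star d m0)\<^sup>2 * real N powr (- K))"
        using card_fibers_le[OF Fs N(3)] RR by (intro mult_mono power_mono) auto
      also have "\<dots> = 2 * (real N powr 1 * real N powr (- K)) * (R_star d m0)\<^sup>2" using N by simp
      also have "real N powr 1 * real N powr (- K) = real N powr (1 - K)" by (simp only: powr_add[symmetric] diff_conv_add_uminus)
      finally show ?thesis .
    qed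
    ultimately show ?thesis by linarith
  qed

  have part2c: "measure (?L N)
      {(g, y) \<in> space (?L N).
        good_gen d \<alpha> \<gamma> \<delta> N m0 g \<and> good_shifts d (S N g) (Fs g) y} \<ge> \<delta> * (1 - ?fail N m0)"
    if a: "admissible d \<alpha> \<gamma> \<delta> N m0" and small: "?fail N m0 < 1"
      and Fs: "\<forall>g\<in>gen_vecs d N. fiber_enum d \<alpha> \<gamma> N (?M N) g (Fs g)" for N m0 Fs
  proof (rule prob_joint_law_ge)
    have "gen_vecs d N \<noteq> {}" using gen_vecs_nonempty adm(2)[OF a] by simp
    then have set: "set_pmf (?p N) = gen_vecs d N" by (simp add: set_pmf_of_set)
    fix g assume g: "g \<in> set_pmf (?p N)"
    then have enum: "fiber_enum d \<alpha> \<gamma> N (?M N) g (Fs g)" using Fs set by simp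
    show "?Y N g (Fs g) \<in> sets (?\<kappa> N g)"
      by (rule sets_good_shifts[OF S0[OF a]]) (use length_fiber_le[OF w \<alpha>0 enum] in \<open>simp add: R_def\<close>)
    show "prob_space (?\<kappa> N g)" by (rule prob_space_shift_law)
    assume "good_gen d \<alpha> \<gamma> \<delta> N m0 g"
    then show "1 - ?fail N m0 \<le> measure (?\<kappa> N g)
        (?Y N g (Fs g))"
      using part2b[OF a _ enum] by blast
  qed (use part1[OF a] small \<delta> in auto)

  have part3: "\<exists>C. ?ran \<tau> C \<and> (\<alpha> \<in> \<nat> \<longrightarrow> ?cbc \<tau> C)"
    if \<tau>: "0 < \<tau>" for \<tau>
  proof -
    (* one lower bound for both constants c / N makes C serve both constructions of g *)
    have \<kappa>: "?b > 0" using \<delta> by simp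
    obtain C where C: "\<And>N m0 R c. \<lbrakk>N > 2; m0 \<ge> 1; R \<ge> 1; ?b * real N \<le> c; c \<le> real N;
       2 ^ (m0 - 1) < threshold d \<alpha> \<gamma> c powr (1 / \<alpha>); real R \<le> R_star d m0\<rbrakk>
      \<Longrightarrow> sqrt (1 + real R) / threshold d \<alpha> \<gamma> c \<le> C * real (N * R * num_shifts K N R) powr (- \<alpha> + \<tau>)"
      using sqrt_over_threshold_le[OF w \<alpha> d K0 \<tau> \<kappa>] by metis
    have bound: "error_bound d \<alpha> \<gamma> \<tau> C N g L (num_shifts K N L) Fs y"
      if N: "N > 2" and M: "M = threshold d \<alpha> \<gamma> c" "M > 1" and c: "?b * real N \<le> c" "c \<le> real N"
        and L: "L = max_fiber_length d \<alpha> \<gamma> N M g" and merit: "merit d \<alpha> \<gamma> N g \<ge> M"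
        and enum: "fiber_enum d \<alpha> \<gamma> N M g Fs" and good: "good_shifts d (num_shifts K N L) Fs y"
      for N g L Fs y M c
    proof -
      obtain m0 :: nat where m0: "m0 \<ge> 1" "2 ^ (m0 - 1) < M powr (1 / \<alpha>)" "M powr (1 / \<alpha>) \<le> 2 ^ m0"
        using threshold_gt_1_dyadic[OF M(2) \<alpha>0] by blast
      have L1: "L \<ge> 1" unfolding L by (rule max_fiber_length_pos[OF w \<alpha>0 M(2)])
      have Lm: "real L \<le> R_star d m0"
        unfolding L by (rule max_fiber_length_le_R_star[OF w \<alpha>0 d m0(1) _ merit m0(3)]) (use N in simp)
      have "ran_error d \<alpha> \<gamma> (lattice_algorithm d N g (num_shifts K N L) y Fs) \<le> ennreal (sqrt (1 + real L) / M)"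
      proof (rule ran_error_le[OF w \<alpha>0 _ _ num_shifts_pos[OF K0 N L1] enum good])
        show "length F \<le> L" if "F \<in> set Fs" for F
          unfolding L by (rule length_fiber_le(4)[OF w \<alpha>0 enum that])
      qed (use N M in auto)
      also have "\<dots> \<le> ennreal (C * real (N * L * num_shifts K N L) powr (- \<alpha> + \<tau>))"
        unfolding M(1) by (intro ennreal_leI C[OF N m0(1) L1 c _ Lm]) (use m0(2) M(1) in simp)
      finally show ?thesis unfolding error_bound_def .
    qed
    show ?thesis
    proof (intro exI[of _ C] conjI allI impI; elim conjE)
      fix N m0 g Fs y
      assume a: "admissible d \<alpha> \<gamma> \<delta> N m0" and g: "good_gen d \<alpha> \<gamma> \<delta> N m0 g"
        and Fs: "fiber_enum d \<alpha> \<gamma> N (M_ran d \<alpha> \<gamma> \<delta> N) g Fs" and y: "good_shifts d (S N g) Fs y"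
      show "error_bound d \<alpha> \<gamma> \<tau> C N g (R N g) (S N g) Fs y"
        unfolding S_def
      proof (rule bound[OF adm(2)[OF a] _ adm(3)[OF a] _ c(2)[OF adm(2)[OF a]] _ _ Fs])
        have "?b * real N \<le> (1 - \<delta>) / 2 * real N"
          by (rule mult_right_mono[OF min.cobounded1]) simp
        also have "\<dots> \<le> ?c N" by (rule c(3)[OF adm(2)[OF a]])
        finally show "?b * real N \<le> ?c N" .
        show "?M N \<le> merit d \<alpha> \<gamma> N g" using g by (simp add: good_gen_def)
        show "good_shifts d (num_shifts K N (R N g)) Fs y" using y by (simp add: S_def)
      qed (simp_all add: M_ran_def R_def)
    next
      fix N g Fs y
      assume N: "prime N" "N > 2" and M1: "M_cbc d \<alpha> \<gamma> N > 1" and cbc: "cbc_output d \<alpha> \<gamma> N g"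
        and Fs: "fiber_enum d \<alpha> \<gamma> N (M_cbc d \<alpha> \<gamma> N) g Fs" and y: "good_shifts d (S' N g) Fs y"
      have N0: "N > 0" "real N / 2 > 0" using N by auto
      obtain l where l: "\<alpha> * l > 1" "l \<le> 2" "M_cbc d \<alpha> \<gamma> N powr l * euler_prod d \<alpha> \<gamma> l = real N / 2" "M_cbc d \<alpha> \<gamma> N > 0"
        using threshold_equation[OF w \<alpha> d N0(2)] unfolding M_cbc_def by metis
      have "korobov_r d \<alpha> \<gamma> k \<ge> M_cbc d \<alpha> \<gamma> N" if "k \<in> dual_lattice d N g - {zero_vec d}" for k
        using korobov_r_ge_if_cbc_output[OF w \<alpha>0 l(1,2) N(1) cbc l(4) _ that] l(3) by simp
      then have merit: "merit d \<alpha> \<gamma> N g \<ge> M_cbc d \<alpha> \<gamma> N"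
        using merit_ge_iff[OF w \<alpha>0 d N0(1)] by blast
      show "error_bound d \<alpha> \<gamma> \<tau> C N g (R' N g) (S' N g) Fs y"
        unfolding S'_def
      proof (rule bound[OF N(2) _ M1 _ _ _ merit Fs])
        show "M_cbc d \<alpha> \<gamma> N = threshold d \<alpha> \<gamma> (real N / 2)" by (simp add: M_cbc_def)
        have "?b * real N \<le> 1 / 2 * real N"
          by (rule mult_right_mono[OF min.cobounded2]) simp
        then show "?b * real N \<le> real N / 2" by simp
        show "good_shifts d (num_shifts K N (R' N g)) Fs y" using y by (simp add: S'_def)
      qed (simp_all add: R'_def)
    qed
  qed

  show ?thesis
    unfolding Let_def
    using part1 part2a part2b part2c part3 \<delta> by (intro conjI allI impI ballI; (elim conjE)?) auto
qed

end
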